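(* Let $k \geq 5$ be an integer and let $G$ be a finite simple connected $k$-regular graph of order $n$. Then $D'(G) \leq 2$.
   Context: A graph is $k$-regular if every vertex has degree $k$; the order of a graph is its number of vertices. The distinguishing index $D'(G)$ of a graph $G$ is the least number $d$ such that $G$ has an edge labeling with $d$ labels (an arbitrary map from $E(G)$ to a set of $d$ labels, not necessarily a proper edge colouring) that is preserved only by the identity automorphism of $G$. An automorphism $\varphi$ of $G$ preserves an edge labeling $c$ if $c(\varphi(u)\varphi(w)) = c(uw)$ for every edge $uw\in E(G)$. *)

theory Defs
  imports "Graph_Theory.Graph_Theory" "HOL-Library.Extended_Nat"
begin

text \<open>
  A finite simple graph is a \<^locale>\<open>pair_graph\<close>: a finite vertex set with a symmetric, irreflexive set
  of arcs, an undirected edge \<open>uw\<close> being the pair of arcs \<open>(u, w)\<close>, \<open>(w, u)\<close>. Hence the degree of a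
  vertex is its out-degree, and edges are recovered as two-element sets.
\<close>

definition edges :: "'a pair_pre_digraph \<Rightarrow> 'a set set" where
  "edges G = {{u, w} | u w. (u, w) \<in> parcs G}"

definition regular :: "nat \<Rightarrow> 'a pair_pre_digraph \<Rightarrow> bool" where
  "regular k G \<longleftrightarrow> (\<forall>v \<in> pverts G. out_degree G v = k)"

text \<open>Only the values of \<open>\<phi>\<close> on the vertices matter, so an automorphism \<open>\<phi>\<close> is the identity when it
  fixes every vertex of the graph.\<close>

definition automorphism :: "'a pair_pre_digraph \<Rightarrow> ('a \<Rightarrow> 'a) \<Rightarrow> bool" where
  "automorphism G \<phi> \<longleftrightarrow>
     bij_betw \<phi> (pverts G) (pverts G) \<and>
     (\<forall>u \<in> pverts G. \<forall>w \<in> pverts G. (\<phi> u, \<phi> w) \<in> parcs G \<longleftrightarrow> (u, w) \<in> parcs G)"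

definition preserves_labeling ::
  "'a pair_pre_digraph \<Rightarrow> ('a \<Rightarrow> 'a) \<Rightarrow> ('a set \<Rightarrow> nat) \<Rightarrow> bool" where
  "preserves_labeling G \<phi> c \<longleftrightarrow> (\<forall>u w. {u, w} \<in> edges G \<longrightarrow> c {\<phi> u, \<phi> w} = c {u, w})"

definition distinguishing_labeling :: "'a pair_pre_digraph \<Rightarrow> nat \<Rightarrow> ('a set \<Rightarrow> nat) \<Rightarrow> bool" where
  "distinguishing_labeling G d c \<longleftrightarrow>
     c ` edges G \<subseteq> {..<d} \<and>
     (\<forall>\<phi>. automorphism G \<phi> \<and> preserves_labeling G \<phi> c \<longrightarrow> (\<forall>v \<in> pverts G. \<phi> v = v))"

text \<open>The index is \<open>\<infinity>\<close> for a graph without any distinguishing labeling, such as \<open>K\<^sub>2\<close>; a finite bound on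
  it therefore includes the existence of a labeling.\<close>

definition distinguishing_index :: "'a pair_pre_digraph \<Rightarrow> enat" where
  "distinguishing_index G = (INF d \<in> {d. \<exists>c. distinguishing_labeling G d c}. enat d)"

end

theory Submission
  imports Defs "HOL-Combinatorics.Permutations"
begin

text \<open>
  Call the edges with label 0 red. If an edge \<open>v\<^sub>0v\<^sub>1\<close> can be deleted together with its ends without
  disconnecting the graph, give \<open>v\<^sub>0\<close> no red edge, \<open>v\<^sub>1\<close> a single red edge \<open>v\<^sub>1v\<^sub>2\<close>, every other
  neighbour of \<open>v\<^sub>0\<close> at least two red edges and every remaining vertex at least one. Then a
  colour-preserving automorphism fixes \<open>v\<^sub>0\<close>, \<open>v\<^sub>1\<close> and \<open>v\<^sub>2\<close>. The other edges are coloured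
  recursively. In a connected part attached to a fixed vertex \<open>u\<close>, take a neighbour \<open>c\<close> of \<open>u\<close> and make
  it the only red, or the only non-red, neighbour of \<open>u\<close> in its orbit; then \<open>c\<close> is fixed as well and
  the components left after its removal are parts of the same kind. Equivalent components have to
  receive inequivalent colourings, so the induction provides several inequivalent colourings at
  once. Their number is governed by orbit sizes, and an orbit inside the neighbourhood of a fixed
  vertex has fewer than \<open>k\<close> elements. A suitable edge exists unless the graph is \<open>K\<^bsub>k+1\<^esub>\<close> or \<open>K\<^bsub>k,k\<^esub>\<close>,
  for which explicit colourings are given.\<close>

section \<open>Sums of proper choices\<close>

text \<open>The obstacle is that demands multiply: \<open>m\<close> equivalent components need
  \<open>m\<close> inequivalent colourings each, and every component splits again. Two facts keep
  the demand \<open>t\<close> below the number of free edges at a vertex. If \<open>m\<close>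
  equivalent components meet an orbit, it contains \<open>m\<close> disjoint copies of the orbit
  inside one of them, so the product of demand and orbit size does not grow when
  \<open>t = 1\<close>. And \<open>t\<close> inequivalent colourings of the union cost only
  \<open>max t (m + 1)\<close> per component, because sums of codes are compared instead of whole
  tuples; since \<open>m + 1 <= 2 * m\<close>, the product stays bounded for \<open>t >= 2\<close>
  too. A neighbour of the root \<open>v0\<close> that needs two red edges cannot be the only non-red
  neighbour of the vertex it hangs on. One of the two ways to single it out is lost, so its bound is
  on the product of \<open>t\<close> and the orbit size, while a bound on a sum suffices elsewhere.
  If the ends of the root edge have no common neighbour, the only violation possible at the start is
  an orbit of all \<open>k - 1\<close> neighbours of \<open>v0\<close> other than \<open>v1\<close>
  that are also neighbours of another vertex. This is why the search for a root edge ends at the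
  complete bipartite graph.\<close>

definition proper_choice :: "'i set \<Rightarrow> ('i \<Rightarrow> 'i \<Rightarrow> bool) \<Rightarrow> ('i \<Rightarrow> 'c set) \<Rightarrow> ('i \<Rightarrow> 'c) \<Rightarrow> bool" where
  "proper_choice I c A f \<longleftrightarrow>
     (\<forall>i\<in>I. f i \<in> A i) \<and> (\<forall>i\<in>I. \<forall>j\<in>I. c i j \<longrightarrow> f i \<noteq> f j)"

text \<open>Greedy list colouring of the conflict graph \<open>c\<close>: every list is longer than
  the number of conflicts.\<close>

lemma proper_choice_exists:
  assumes "finite I" "\<And>i j. c i j \<Longrightarrow> c j i" "\<And>i. \<not> c i i"
    and "\<And>i. i \<in> I \<Longrightarrow> finite (A i)"
    and "\<And>i. i \<in> I \<Longrightarrow> card {j \<in> I. c i j} + 1 \<le> card (A i)"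
  shows "\<exists>f. proper_choice I c A f"
  using assms(1,4,5)
proof (induction I)
  case empty
  then show ?case by (simp add: proper_choice_def)
next
  case (insert i I)
  have le: "card {j \<in> I. c l j} \<le> card {j \<in> insert i I. c l j}" for l
    by (rule card_mono) (use insert.hyps in auto)
  have "\<exists>f. proper_choice I c A f"
  proof (rule insert.IH)
    show "finite (A l)" if "l \<in> I" for l using insert.prems that by simp
    show "card {j \<in> I. c l j} + 1 \<le> card (A l)" if "l \<in> I" for l
      using insert.prems(2)[of l] that le[of l] by simp
  qed
  then obtain f where f: "proper_choice I c A f" by blast
  have "card (f ` {j \<in> I. c i j}) \<le> card {j \<in> I. c i j}"
    by (rule card_image_le) (use insert.hyps in simp)
  also have "\<dots> < card (A i)" using insert.prems(2)[of i] le[of i] by simp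
  finally have "\<not> A i \<subseteq> f ` {j \<in> I. c i j}"
    using card_mono[of "f ` {j \<in> I. c i j}" "A i"] insert.hyps by fastforce
  then obtain b where b: "b \<in> A i" "b \<notin> f ` {j \<in> I. c i j}" by blast
  have "proper_choice (insert i I) c A (f(i := b))"
    using f b insert.hyps(2) assms(2,3) unfolding proper_choice_def by (auto simp: image_iff; metis)
  then show ?case by blast
qed

text \<open>Give one vertex \<open>i\<close> the maximum \<open>a\<close> of its list. Each
  neighbour loses at most one list entry but also one conflict, so by induction the rest has
  \<open>t - 1\<close> sums. One more sum, smaller than all of these, comes from the least of them
  by lowering the value at \<open>i\<close>; the second surplus entry in the list of
  \<open>i\<close> makes this possible.\<close>

lemma many_choice_sums:
  fixes A :: "'i \<Rightarrow> nat set"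
  assumes "finite I" "I \<noteq> {}" "\<And>i j. c i j \<Longrightarrow> c j i" "\<And>i. \<not> c i i"
    and "\<And>i. i \<in> I \<Longrightarrow> finite (A i)"
    and "\<And>i. i \<in> I \<Longrightarrow> card {j \<in> I. c i j} + 2 \<le> card (A i)"
    and "\<And>i. i \<in> I \<Longrightarrow> t \<le> card (A i)"
  shows "\<exists>S. finite S \<and> card S = t \<and> (\<forall>s\<in>S. \<exists>f. proper_choice I c A f \<and> sum f I = s)"
  using assms(1,2,5,6,7)
proof (induction I arbitrary: A t rule: finite_ne_induct)
  case (singleton i)
  then obtain S where S: "S \<subseteq> A i" "card S = t" "finite S"
    by (metis obtain_subset_with_card_n singletonI)
  show ?case
  proof (intro exI[of _ S] conjI ballI)
    fix s assume "s \<in> S"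
    then have "proper_choice {i} c A (\<lambda>_. s) \<and> sum (\<lambda>_. s) {i} = s"
      using S assms(4) by (auto simp: proper_choice_def)
    then show "\<exists>f. proper_choice {i} c A f \<and> sum f {i} = s" by blast
  qed (use S in auto)
next
  case (insert i I)
  define a where "a = Max (A i)"
  define A' where "A' = (\<lambda>j. if c i j then A j - {a} else A j)"
  \<comment> \<open>At least 1, so that the set \<open>S\<close> of sums has a minimum that can be
    undercut.\<close>
  define t' where "t' = max 1 (t - 1)"
  have Ai: "finite (A i)" "card {j \<in> I. c i j} + 2 \<le> card (A i)"
  proof -
    have "{j \<in> insert i I. c i j} = {j \<in> I. c i j}" using assms(4) by auto
    then show "card {j \<in> I. c i j} + 2 \<le> card (A i)" using insert.prems(2)[of i] by simp
  qed (use insert.prems in simp)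
  have aA: "a \<in> A i" unfolding a_def using Ai by (intro Max_in) auto
  have A'1: "card {j \<in> I. c l j} + 2 \<le> card (A' l)" "t' \<le> card (A' l)" "finite (A' l)" if l: "l \<in> I" for l
  proof -
    have fl: "finite (A l)" and dl: "card {j \<in> insert i I. c l j} + 2 \<le> card (A l)"
      and tl: "t \<le> card (A l)" using insert.prems l by auto
    show "finite (A' l)" using fl by (simp add: A'_def)
    have *: "card {j \<in> I. c l j} + 2 \<le> card (A' l) \<and> t - 1 \<le> card (A' l)"
    proof (cases "c i l")
      case True
      then have "{j \<in> insert i I. c l j} = insert i {j \<in> I. c l j}" using assms(3) by auto
      then have "card {j \<in> insert i I. c l j} = Suc (card {j \<in> I. c l j})"
        using insert.hyps by simp
      moreover have "card (A l) - 1 \<le> card (A' l)"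
        using True fl by (simp add: A'_def card_Diff_singleton_if)
      ultimately show ?thesis using dl tl by linarith
    next
      case False
      then have "{j \<in> insert i I. c l j} = {j \<in> I. c l j}" using assms(3) by auto
      then show ?thesis using dl tl False by (simp add: A'_def)
    qed
    then show "card {j \<in> I. c l j} + 2 \<le> card (A' l)" "t' \<le> card (A' l)"
      by (auto simp: t'_def)
  qed
  obtain S where S: "finite S" "card S = t'"
    "\<forall>s\<in>S. \<exists>f. proper_choice I c A' f \<and> sum f I = s"
    using insert.IH[of A' t'] A'1 by blast
  have "S \<noteq> {}" using S by (auto simp: t'_def)
  have ext: "proper_choice (insert i I) c A (f(i := a))" "sum (f(i := a)) (insert i I) = a + sum f I"
    if "proper_choice I c A' f" for f
  proof -
    have 1: "f j \<in> A j" if "j \<in> I" for j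
      using \<open>proper_choice I c A' f\<close> that by (auto simp: proper_choice_def A'_def split: if_splits)
    have 2: "f j \<noteq> a" if "j \<in> I" "c i j" for j
      using \<open>proper_choice I c A' f\<close> that by (force simp: proper_choice_def A'_def split: if_splits)
    show "proper_choice (insert i I) c A (f(i := a))"
      using 1 2 aA assms(3,4) that insert.hyps unfolding proper_choice_def
      by (auto; metis)
    show "sum (f(i := a)) (insert i I) = a + sum f I"
      using insert.hyps by (auto intro: sum.cong)
  qed
  obtain f where f: "proper_choice I c A' f" "sum f I = Min S"
    using S \<open>S \<noteq> {}\<close> Min_in by blast
  have "card (f ` {j \<in> I. c i j}) \<le> card {j \<in> I. c i j}"
    by (rule card_image_le) (use insert.hyps in simp)
  then have "card (insert a (f ` {j \<in> I. c i j})) \<le> Suc (card {j \<in> I. c i j})"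
    using insert.hyps by (simp add: card_insert_if)
  also have "\<dots> < card (A i)" using Ai by simp
  finally have "\<not> A i \<subseteq> insert a (f ` {j \<in> I. c i j})"
    using card_mono[of "insert a (f ` {j \<in> I. c i j})" "A i"] insert.hyps by fastforce
  then obtain b where b: "b \<in> A i" "b \<noteq> a" "b \<notin> f ` {j \<in> I. c i j}" by blast
  have ba: "b < a" using b Ai by (simp add: a_def le_neq_implies_less)
  have fb: "proper_choice (insert i I) c A (f(i := b))"
  proof -
    have 1: "f j \<in> A j" if "j \<in> I" for j
      using f(1) that by (auto simp: proper_choice_def A'_def split: if_splits)
    show ?thesis using 1 b f(1) assms(3,4) insert.hyps unfolding proper_choice_def
      by (auto simp: image_iff; metis)
  qed
  have sb: "sum (f(i := b)) (insert i I) = b + Min S"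
    using insert.hyps f(2)[symmetric] by (auto intro: sum.cong)
  define T where "T = insert (b + Min S) ((+) a ` S)"
  have "b + Min S \<notin> (+) a ` S"
    using ba S(1) by (auto) (metis Min_le add_less_le_mono less_not_refl)
  then have "card T = Suc t'" using S by (simp add: T_def card_image)
  then have "t \<le> card T" by (simp add: t'_def)
  moreover have "finite T" using S by (simp add: T_def)
  ultimately obtain T' where T': "T' \<subseteq> T" "card T' = t" "finite T'"
    by (metis obtain_subset_with_card_n)
  have "\<exists>f. proper_choice (insert i I) c A f \<and> sum f (insert i I) = s" if "s \<in> T" for s
    using that S(3) ext fb sb unfolding T_def by fastforce
  then show ?case using T' by blast
qed

section \<open>Permutations acting on sets of edges, and regular graphs\<close>

abbreviation act :: "('a \<Rightarrow> 'a) \<Rightarrow> 'a set set \<Rightarrow> 'a set set" where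
  "act \<phi> R \<equiv> (`) \<phi> ` R"

definition incidence :: "'a set set \<Rightarrow> 'a \<Rightarrow> nat" where
  "incidence R w = card {e \<in> R. w \<in> e}"

text \<open>The identity off \<open>J\<close> makes the result satisfy
  \<open>permutes\<close>.\<close>

definition restrict_to :: "'a set \<Rightarrow> ('a \<Rightarrow> 'a) \<Rightarrow> 'a \<Rightarrow> 'a" where
  "restrict_to J \<phi> = (\<lambda>x. if x \<in> J then \<phi> x else x)"

lemma act_comp: "act (\<phi> \<circ> \<psi>) R = act \<phi> (act \<psi> R)"
  by (simp add: image_comp comp_def)

lemma act_id [simp]: "act id R = R" "act (\<lambda>x. x) R = R"
  by auto

lemma incidence_act:
  assumes "inj \<phi>" shows "incidence (act \<phi> R) (\<phi> w) = incidence R w"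
proof -
  have "{e \<in> act \<phi> R. \<phi> w \<in> e} = (`) \<phi> ` {e \<in> R. w \<in> e}"
  proof (intro equalityI subsetI)
    fix e assume "e \<in> {e \<in> act \<phi> R. \<phi> w \<in> e}"
    then obtain e' where "e' \<in> R" "e = \<phi> ` e'" "\<phi> w \<in> \<phi> ` e'" by blast
    then show "e \<in> (`) \<phi> ` {e \<in> R. w \<in> e}"
      using assms by (simp add: inj_image_mem_iff)
  qed blast
  moreover have "inj_on ((`) \<phi>) {e \<in> R. w \<in> e}"
    using assms by (meson inj_image_eq_iff inj_onI)
  ultimately show ?thesis by (simp only: incidence_def card_image)
qed

locale regular_graph =
  fixes V :: "'a set" and adj :: "'a \<Rightarrow> 'a \<Rightarrow> bool" and k :: nat
  assumes finite_V: "finite V"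
    and adj_sym: "adj x y \<Longrightarrow> adj y x"
    and adj_irrefl [simp]: "\<not> adj x x"
    and adj_V: "adj x y \<Longrightarrow> x \<in> V"
    and degree: "x \<in> V \<Longrightarrow> card {y. adj x y} = k"
    and k5: "5 \<le> k"
begin

definition nb :: "'a \<Rightarrow> 'a set" where
  "nb x = {y. adj x y}"

definition ED :: "'a set set" where
  "ED = {{x, y} | x y. adj x y}"

text \<open>Edges with only one end in \<open>H\<close> are included: red edges to vertices already
  fixed also help to tell vertices of \<open>H\<close> apart.\<close>

definition free_edges :: "'a set \<Rightarrow> 'a set set \<Rightarrow> 'a set set" where
  "free_edges H M = {e \<in> ED. e \<inter> H \<noteq> {}} - M"

text \<open>These are the automorphisms of the whole graph that fix every vertex outside
  \<open>H\<close>, since \<open>permutes\<close> forces the identity there. The group shrinks as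
  more vertices become fixed.\<close>

definition Stab :: "'a set \<Rightarrow> ('a \<Rightarrow> 'a) set" where
  "Stab H = {\<phi>. \<phi> permutes H \<and> (\<forall>x y. adj (\<phi> x) (\<phi> y) \<longleftrightarrow> adj x y)}"

definition orb :: "'a set \<Rightarrow> 'a \<Rightarrow> 'a set" where
  "orb H w = (\<lambda>\<phi>. \<phi> w) ` Stab H"

definition reach :: "'a set \<Rightarrow> 'a \<Rightarrow> 'a \<Rightarrow> bool" where
  "reach H = (\<lambda>a b. adj a b \<and> a \<in> H \<and> b \<in> H)\<^sup>*\<^sup>*"

definition comp :: "'a set \<Rightarrow> 'a \<Rightarrow> 'a set" where
  "comp H x = {y \<in> H. reach H x y}"

definition comps :: "'a set \<Rightarrow> 'a set set" where
  "comps H = comp H ` H"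

definition conn :: "'a set \<Rightarrow> bool" where
  "conn K \<longleftrightarrow> K \<noteq> {} \<and> (\<forall>x\<in>K. \<forall>y\<in>K. reach K x y)"

section \<open>Neighbourhoods and edges\<close>

lemma nb_iff [simp]: "y \<in> nb x \<longleftrightarrow> adj x y"
  by (simp add: nb_def)

lemma adj_comm: "adj x y \<longleftrightarrow> adj y x"
  using adj_sym by blast

lemma adj_V2: "adj x y \<Longrightarrow> y \<in> V"
  using adj_V adj_sym by blast

lemma nb_sub: "nb x \<subseteq> V"
  using adj_V2 by auto

lemma finite_nb [simp]: "finite (nb x)"
  using finite_subset[OF nb_sub finite_V] .

lemma card_nb: "x \<in> V \<Longrightarrow> card (nb x) = k"
  using degree by (simp add: nb_def)

lemma card_nb_le: "card (nb x) \<le> k"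
proof (cases "x \<in> V")
  case False
  then have "nb x = {}" using adj_V by auto
  then show ?thesis by simp
qed (simp add: card_nb)

lemma edge_iff [simp]: "{x, y} \<in> ED \<longleftrightarrow> adj x y"
  by (auto simp: ED_def doubleton_eq_iff intro: adj_sym)

lemma edgeE:
  assumes "e \<in> ED" obtains x y where "e = {x, y}" "adj x y"
  using assms by (auto simp: ED_def)

lemma edge_at:
  assumes "e \<in> ED" "x \<in> e" obtains y where "e = {x, y}" "adj x y"
proof -
  obtain a b where ab: "e = {a, b}" "adj a b" using assms(1) by (rule edgeE)
  show ?thesis
  proof (cases "x = a")
    case True
    then show ?thesis using ab that by blast
  next
    case False
    then have "e = {x, a}" "adj x a" using ab assms(2) adj_sym[OF ab(2)] by auto
    then show ?thesis using that by blast
  qed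
qed

lemma finite_ED [simp]: "finite ED"
proof -
  have "ED \<subseteq> Pow V" using adj_V adj_V2 by (auto simp: ED_def)
  then show ?thesis using finite_V by (meson finite_Pow_iff finite_subset)
qed

lemma finite_free [simp]: "finite (free_edges H M)"
  by (rule finite_subset[OF _ finite_ED]) (auto simp: free_edges_def)

lemma free_edges_ED: "free_edges H M \<subseteq> ED"
  by (auto simp: free_edges_def)

lemma edges_at: "{e \<in> ED. w \<in> e} = (\<lambda>y. {w, y}) ` nb w"
proof (intro equalityI subsetI)
  fix e assume "e \<in> {e \<in> ED. w \<in> e}"
  then obtain y where "e = {w, y}" "adj w y" using edge_at by blast
  then show "e \<in> (\<lambda>y. {w, y}) ` nb w" by auto
qed auto

lemma card_edges_at: "w \<in> V \<Longrightarrow> card {e \<in> ED. w \<in> e} = k"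
proof -
  assume "w \<in> V"
  moreover have "inj_on (\<lambda>y. {w, y}) (nb w)"
    by (rule inj_onI) (auto simp: doubleton_eq_iff)
  ultimately show ?thesis by (simp add: edges_at card_image card_nb)
qed

section \<open>Stabilizers\<close>

lemma Stab_adj: "\<phi> \<in> Stab H \<Longrightarrow> adj (\<phi> x) (\<phi> y) \<longleftrightarrow> adj x y"
  by (simp add: Stab_def)

lemma Stab_permutes: "\<phi> \<in> Stab H \<Longrightarrow> \<phi> permutes H"
  by (simp add: Stab_def)

lemma Stab_id [simp]: "id \<in> Stab H"
  by (simp add: Stab_def)

lemma Stab_comp: "\<phi> \<in> Stab H \<Longrightarrow> \<psi> \<in> Stab H \<Longrightarrow> \<phi> \<circ> \<psi> \<in> Stab H"
  by (auto simp: Stab_def intro: permutes_compose)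

lemma Stab_inv: "\<phi> \<in> Stab H \<Longrightarrow> inv \<phi> \<in> Stab H"
proof -
  assume a: "\<phi> \<in> Stab H"
  then have p: "\<phi> permutes H" by (simp add: Stab_def)
  have "adj (inv \<phi> x) (inv \<phi> y) \<longleftrightarrow> adj (\<phi> (inv \<phi> x)) (\<phi> (inv \<phi> y))" for x y
    using a by (simp add: Stab_def)
  then show ?thesis using p by (simp add: Stab_def permutes_inv permutes_inverses(1)[OF p])
qed

lemma Stab_mono: "H \<subseteq> K \<Longrightarrow> \<phi> \<in> Stab H \<Longrightarrow> \<phi> \<in> Stab K"
  by (auto simp: Stab_def intro: permutes_subset)

lemma Stab_fix: "\<phi> \<in> Stab H \<Longrightarrow> x \<notin> H \<Longrightarrow> \<phi> x = x"
  by (rule permutes_not_in[OF Stab_permutes])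

lemma Stab_in: "\<phi> \<in> Stab H \<Longrightarrow> \<phi> x \<in> H \<longleftrightarrow> x \<in> H"
  by (rule permutes_in_image[OF Stab_permutes])

lemma Stab_inj: "\<phi> \<in> Stab H \<Longrightarrow> inj \<phi>"
  by (rule permutes_inj[OF Stab_permutes])

lemma Stab_eq: "\<phi> \<in> Stab H \<Longrightarrow> \<phi> x = \<phi> y \<longleftrightarrow> x = y"
  by (rule inj_eq[OF Stab_inj])

lemma Stab_inv_simps [simp]:
  "\<phi> \<in> Stab H \<Longrightarrow> inv \<phi> (\<phi> x) = x" "\<phi> \<in> Stab H \<Longrightarrow> \<phi> (inv \<phi> x) = x"
  by (simp_all only: permutes_inverses[OF Stab_permutes])

lemma Stab_shrink:
  assumes "\<phi> \<in> Stab K" "H \<subseteq> K" "\<And>x. x \<in> K - H \<Longrightarrow> \<phi> x = x"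
  shows "\<phi> \<in> Stab H"
proof -
  have "\<phi> permutes H"
    by (rule permutes_superset[OF Stab_permutes[OF assms(1)]]) (use assms in auto)
  then show ?thesis using assms(1) by (simp add: Stab_def)
qed

lemma Stab_nb: assumes f: "\<phi> \<in> Stab H" shows "\<phi> ` nb x = nb (\<phi> x)"
proof (intro equalityI subsetI)
  fix y assume "y \<in> nb (\<phi> x)"
  then have "inv \<phi> y \<in> nb x" using Stab_adj[OF f, of x "inv \<phi> y"] f by simp
  then have "\<phi> (inv \<phi> y) \<in> \<phi> ` nb x" by (rule imageI)
  then show "y \<in> \<phi> ` nb x" using f by simp
next
  fix y assume "y \<in> \<phi> ` nb x"
  then obtain z where "y = \<phi> z" "adj x z" by auto
  then show "y \<in> nb (\<phi> x)" by (simp add: Stab_adj[OF f])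
qed

lemma act_ED: assumes f: "\<phi> \<in> Stab H" shows "act \<phi> ED = ED"
proof -
  have *: "act \<psi> ED \<subseteq> ED" if "\<psi> \<in> Stab H" for \<psi>
  proof
    fix e assume "e \<in> act \<psi> ED"
    then obtain x y where "e = \<psi> ` {x, y}" "adj x y" by (auto elim: edgeE)
    then show "e \<in> ED" using Stab_adj[OF that, of x y] by simp
  qed
  have "act \<phi> (act (inv \<phi>) ED) \<subseteq> act \<phi> ED"
    using *[OF Stab_inv[OF f]] by (rule image_mono)
  moreover have "act \<phi> (act (inv \<phi>) ED) = ED"
    using f by (simp add: image_image)
  ultimately have "ED \<subseteq> act \<phi> ED" by (simp only:)
  with *[OF f] show ?thesis by (rule subset_antisym)
qed

lemma meets_image: assumes f: "\<phi> \<in> Stab H" shows "\<phi> ` e \<inter> H \<noteq> {} \<longleftrightarrow> e \<inter> H \<noteq> {}"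
  by (auto simp: Stab_in[OF f] disjoint_iff)

lemma act_free_edges:
  assumes f: "\<phi> \<in> Stab H" and M: "act \<phi> M = M"
  shows "act \<phi> (free_edges H M) = free_edges H M"
proof -
  have inj: "inj ((`) \<phi>)" by (rule injI) (use Stab_inj[OF f] in \<open>simp add: inj_image_eq_iff\<close>)
  have "act \<phi> {e \<in> ED. e \<inter> H \<noteq> {}} = {e \<in> act \<phi> ED. e \<inter> H \<noteq> {}}"
  proof (intro equalityI subsetI)
    fix e assume "e \<in> act \<phi> {e \<in> ED. e \<inter> H \<noteq> {}}"
    then obtain d where "d \<in> ED" "d \<inter> H \<noteq> {}" "e = \<phi> ` d" by blast
    then show "e \<in> {e \<in> act \<phi> ED. e \<inter> H \<noteq> {}}" using meets_image[OF f, of d] by simp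
  next
    fix e assume e: "e \<in> {e \<in> act \<phi> ED. e \<inter> H \<noteq> {}}"
    then obtain d where d: "d \<in> ED" "e = \<phi> ` d" by blast
    then have "d \<inter> H \<noteq> {}" using e meets_image[OF f, of d] by simp
    then show "e \<in> act \<phi> {e \<in> ED. e \<inter> H \<noteq> {}}" using d by simp
  qed
  then show ?thesis
    by (simp only: free_edges_def image_set_diff[OF inj] act_ED[OF f] M)
qed

lemma orb_self [simp]: "w \<in> orb H w"
  by (auto simp: orb_def intro!: image_eqI[of _ _ id])

lemma orb_mono: "H \<subseteq> K \<Longrightarrow> orb H w \<subseteq> orb K w"
  using Stab_mono by (auto simp: orb_def)

lemma orb_sub: "w \<in> H \<Longrightarrow> orb H w \<subseteq> H"
  using Stab_in by (auto simp: orb_def)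

lemma orb_I: "\<phi> \<in> Stab H \<Longrightarrow> \<phi> w \<in> orb H w"
  by (auto simp: orb_def)

lemma orbE: assumes "x \<in> orb H w" obtains \<phi> where "\<phi> \<in> Stab H" "x = \<phi> w"
  using assms by (auto simp: orb_def)

lemma finite_orb: "w \<in> H \<Longrightarrow> H \<subseteq> V \<Longrightarrow> finite (orb H w)"
  by (meson orb_sub finite_V finite_subset)

lemma orb_image: assumes a: "\<phi> \<in> Stab H" shows "\<phi> ` orb H w = orb H w"
proof (intro equalityI subsetI)
  fix x assume "x \<in> orb H w"
  then obtain \<psi> where p: "\<psi> \<in> Stab H" "x = \<psi> w" by (rule orbE)
  have "inv \<phi> x \<in> orb H w" using orb_I[OF Stab_comp[OF Stab_inv[OF a] p(1)]] p by simp
  then have "\<phi> (inv \<phi> x) \<in> \<phi> ` orb H w" by (rule imageI)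
  then show "x \<in> \<phi> ` orb H w" using a by simp
next
  fix x assume "x \<in> \<phi> ` orb H w"
  then obtain \<psi> where p: "\<psi> \<in> Stab H" "x = \<phi> (\<psi> w)" by (auto elim: orbE)
  then show "x \<in> orb H w" using orb_I[OF Stab_comp[OF a p(1)]] by simp
qed

lemma orb_eq: assumes "x \<in> orb H w" shows "orb H x = orb H w"
proof -
  obtain \<phi> where f: "\<phi> \<in> Stab H" "x = \<phi> w" using assms by (rule orbE)
  have "\<psi> (\<phi> w) \<in> orb H w" if "\<psi> \<in> Stab H" for \<psi>
    using orb_I[OF Stab_comp[OF that f(1)]] by simp
  moreover have "\<psi> w \<in> orb H (\<phi> w)" if "\<psi> \<in> Stab H" for \<psi>
    using orb_I[OF Stab_comp[OF that Stab_inv[OF f(1)]], of "\<phi> w"] f(1) by simp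
  ultimately show ?thesis by (auto simp: f(2) elim!: orbE)
qed

text \<open>\<open>Stab H\<close> fixes \<open>u\<close>, so adjacency to \<open>u\<close> is
  constant along its orbits. This turns the degree \<open>k\<close> into bounds on orbit
  sizes.\<close>

lemma orb_nb: assumes "u \<notin> H" "adj u w" shows "orb H w \<subseteq> nb u"
proof
  fix x assume "x \<in> orb H w"
  then obtain \<phi> where f: "\<phi> \<in> Stab H" "x = \<phi> w" by (rule orbE)
  then show "x \<in> nb u" using Stab_adj[OF f(1), of u w] Stab_fix[OF f(1) assms(1)] assms(2) by simp
qed

section \<open>Connected components\<close>

lemma reach_refl [simp]: "reach H x x"
  by (simp add: reach_def)

lemma reach_step: "adj x y \<Longrightarrow> x \<in> H \<Longrightarrow> y \<in> H \<Longrightarrow> reach H x y"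
  by (simp add: reach_def r_into_rtranclp)

lemma reach_trans: "reach H x y \<Longrightarrow> reach H y z \<Longrightarrow> reach H x z"
  by (simp add: reach_def)

lemma reach_sym: "reach H x y \<Longrightarrow> reach H y x"
proof -
  have "symp (\<lambda>a b. adj a b \<and> a \<in> H \<and> b \<in> H)"
    by (rule sympI) (use adj_sym in blast)
  then have "symp (reach H)" unfolding reach_def by (rule symp_rtranclp)
  then show "reach H x y \<Longrightarrow> reach H y x" by (rule sympD)
qed

lemma reach_closed:
  assumes "reach H x y" "x \<in> A" "\<And>a b. a \<in> A \<Longrightarrow> b \<in> H \<Longrightarrow> adj a b \<Longrightarrow> b \<in> A"
  shows "y \<in> A"
  using assms(1) unfolding reach_def
  by (induction rule: rtranclp_induct) (use assms in auto)

lemma reach_mono: "reach H x y \<Longrightarrow> H \<subseteq> K \<Longrightarrow> reach K x y"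
  unfolding reach_def by (erule rtranclp_mono[THEN predicate2D, rotated]) auto

lemma conn_closed:
  assumes "conn K" "A \<subseteq> K" "A \<noteq> {}" "\<And>a b. a \<in> A \<Longrightarrow> b \<in> K \<Longrightarrow> adj a b \<Longrightarrow> b \<in> A"
  shows "A = K"
proof -
  obtain a where "a \<in> A" using assms by blast
  then have "y \<in> A" if "y \<in> K" for y
    using assms that reach_closed[of K a y A] unfolding conn_def by blast
  then show ?thesis using assms by blast
qed

lemma comp_self: "x \<in> H \<Longrightarrow> x \<in> comp H x"
  by (simp add: comp_def)

lemma comp_in_comps: "x \<in> H \<Longrightarrow> comp H x \<in> comps H"
  by (simp add: comps_def)

lemma comps_sub: "J \<in> comps H \<Longrightarrow> J \<subseteq> H"
  by (auto simp: comps_def comp_def)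

lemma comps_ne: "J \<in> comps H \<Longrightarrow> J \<noteq> {}"
  unfolding comps_def using comp_self by blast

lemma comps_eq: "J \<in> comps H \<Longrightarrow> x \<in> J \<Longrightarrow> J = comp H x"
  by (auto simp: comps_def comp_def dest: reach_sym intro: reach_trans)

lemma comps_disj: "J \<in> comps H \<Longrightarrow> J' \<in> comps H \<Longrightarrow> x \<in> J \<Longrightarrow> x \<in> J' \<Longrightarrow> J = J'"
  using comps_eq by blast

lemma comps_adj: "J \<in> comps H \<Longrightarrow> x \<in> J \<Longrightarrow> y \<in> H \<Longrightarrow> adj x y \<Longrightarrow> y \<in> J"
  using comps_sub reach_step reach_trans by (fastforce simp: comps_def comp_def)

lemma comps_conn: assumes "J \<in> comps H" shows "conn J"
proof -
  have "reach J x y" if x: "x \<in> J" and y: "y \<in> J" for x y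
  proof -
    have "reach H x y" using x y assms comps_eq[OF assms x] by (auto simp: comp_def)
    moreover have "x \<in> {z \<in> J. reach J x z}" using x by simp
    ultimately have "y \<in> {z \<in> J. reach J x z}"
    proof (rule reach_closed)
      fix a b assume "a \<in> {z \<in> J. reach J x z}" "b \<in> H" "adj a b"
      then show "b \<in> {z \<in> J. reach J x z}"
        using comps_adj[OF assms] reach_step reach_trans by blast
    qed
    then show ?thesis by simp
  qed
  then show ?thesis using comps_ne[OF assms] by (simp add: conn_def)
qed

lemma finite_comps: "H \<subseteq> V \<Longrightarrow> finite (comps H)"
  using finite_V by (auto simp: comps_def intro: finite_subset)

lemma conn_single [simp]: "conn {x}"
  by (simp add: conn_def)

lemma conn_Un:
  assumes "conn A" "conn B" "a \<in> A" "b \<in> B" "adj a b \<or> a = b"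
  shows "conn (A \<union> B)"
proof -
  have ab: "reach (A \<union> B) a b" using assms reach_step by auto
  have "reach (A \<union> B) x a" if "x \<in> A \<union> B" for x
  proof (cases "x \<in> A")
    case True
    then have "reach A x a" using assms(1,3) by (simp add: conn_def)
    then show ?thesis by (rule reach_mono) simp
  next
    case False
    then have "reach B x b" using assms that by (auto simp: conn_def)
    then have "reach (A \<union> B) x b" by (rule reach_mono) simp
    then show ?thesis using reach_trans[OF _ reach_sym[OF ab]] by simp
  qed
  then have "reach (A \<union> B) x y" if "x \<in> A \<union> B" "y \<in> A \<union> B" for x y
    using that reach_sym reach_trans by meson
  then show ?thesis using assms(3) by (auto simp: conn_def)
qed

lemma Stab_reach: assumes f: "\<phi> \<in> Stab H" and "reach H x y" shows "reach H (\<phi> x) (\<phi> y)"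
  using assms(2) unfolding reach_def
proof (induction rule: rtranclp_induct)
  case (step y z)
  then show ?case
    using Stab_adj[OF f, of y z] Stab_in[OF f] by (simp add: rtranclp.rtrancl_into_rtrancl)
qed simp

lemma Stab_comps: assumes f: "\<phi> \<in> Stab H" and "J \<in> comps H" shows "\<phi> ` J \<in> comps H"
proof -
  obtain x where x: "x \<in> H" "J = comp H x" using assms by (auto simp: comps_def)
  have "\<phi> ` comp H x = comp H (\<phi> x)"
  proof (intro equalityI subsetI)
    fix y assume "y \<in> \<phi> ` comp H x"
    then show "y \<in> comp H (\<phi> x)"
      using Stab_reach[OF f] Stab_in[OF f] by (auto simp: comp_def)
  next
    fix y assume y: "y \<in> comp H (\<phi> x)"
    then have "inv \<phi> y \<in> comp H x"
      using Stab_reach[OF Stab_inv[OF f], of "\<phi> x" y] Stab_in[OF Stab_inv[OF f]] f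
      by (simp add: comp_def)
    then have "\<phi> (inv \<phi> y) \<in> \<phi> ` comp H x" by (rule imageI)
    then show "y \<in> \<phi> ` comp H x" using f by simp
  qed
  then show ?thesis using x f comp_in_comps Stab_in[OF f] by simp
qed

text \<open>Otherwise the component would be closed under adjacency in the connected set
  \<open>K\<close>. This provides the vertex to which each remaining part is attached.\<close>

lemma comp_has_nb:
  assumes "conn K" "S \<subseteq> K" "S \<noteq> {}" "J \<in> comps (K - S)"
  obtains x s where "x \<in> J" "s \<in> S" "adj s x"
proof -
  have "J \<noteq> K" using assms comps_sub by blast
  moreover have "J \<subseteq> K" "J \<noteq> {}" using assms comps_sub comps_ne by blast+
  ultimately obtain a b where ab: "a \<in> J" "b \<in> K" "adj a b" "b \<notin> J"
    using conn_closed[OF assms(1), of J] by blast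
  then have "b \<in> S" using comps_adj[OF assms(4) ab(1), of b] by blast
  then show ?thesis using that ab adj_sym by blast
qed

text \<open>A vertex of \<open>H\<close> outside the component has no neighbour in it, and a vertex
  outside \<open>H\<close> is fixed by \<phi> anyway. So replacing \<phi> by the identity off
  \<open>J\<close> destroys no adjacency.\<close>

lemma restrict_to_Stab:
  assumes f: "\<phi> \<in> Stab H" and J: "J \<in> comps H" and im: "\<phi> ` J = J"
  shows "restrict_to J \<phi> \<in> Stab J"
proof -
  have "bij_betw \<phi> J J" using im Stab_inj[OF f] by (auto simp: bij_betw_def intro: inj_on_subset)
  then have "bij_betw (restrict_to J \<phi>) J J"
    by (subst bij_betw_cong[of _ _ \<phi>]) (auto simp: restrict_to_def)
  then have p: "restrict_to J \<phi> permutes J"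
    by (rule bij_imp_permutes) (auto simp: restrict_to_def)
  have *: "adj (\<phi> x) y \<longleftrightarrow> adj x y" if x: "x \<in> J" and y: "y \<notin> J" for x y
  proof (cases "y \<in> H")
    case True
    then show ?thesis using comps_adj[OF J] x y im by blast
  next
    case False
    then show ?thesis using Stab_adj[OF f, of x y] Stab_fix[OF f] by simp
  qed
  have "adj (restrict_to J \<phi> x) (restrict_to J \<phi> y) \<longleftrightarrow> adj x y" for x y
    using *[of x y] *[of y x] adj_comm[of x y] adj_comm[of x "\<phi> y"] Stab_adj[OF f, of x y]
    by (cases "x \<in> J"; cases "y \<in> J") (simp_all add: restrict_to_def)
  then show ?thesis using p by (simp add: Stab_def)
qed

section \<open>Gluing colourings of components\<close>

lemma act_inv: "\<phi> \<in> Stab H \<Longrightarrow> act (inv \<phi>) (act \<phi> R) = R"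
  by (simp add: image_image)

text \<open>A colouring is the set \<open>R\<close> of its red edges; \<open>M\<close> contains the edges whose colour is already decided.\<close>

definition rigid :: "'a set \<Rightarrow> 'a set \<Rightarrow> 'a set set \<Rightarrow> 'a set set \<Rightarrow> bool" where
  "rigid W H M R \<longleftrightarrow> R \<subseteq> free_edges H M \<and> (\<forall>\<phi>\<in>Stab H. act \<phi> R = R \<longrightarrow> \<phi> = id) \<and>
     (\<forall>w\<in>H. 1 \<le> incidence R w \<and> (w \<in> W \<longrightarrow> 2 \<le> incidence R w))"

text \<open>Colourings count as inequivalent if they lie in different orbits of
  \<open>Stab H\<close>. \<open>P\<close> is used for red edges from the attaching vertex into the
  part: they supply the red edges which that vertex needs itself.\<close>

definition many_rigid ::
  "'a set \<Rightarrow> 'a set \<Rightarrow> 'a set set \<Rightarrow> nat \<Rightarrow> ('a set set \<Rightarrow> bool) \<Rightarrow> bool" where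
  "many_rigid W H M t P \<longleftrightarrow> (\<exists>C. finite C \<and> card C = t \<and> (\<forall>R\<in>C. rigid W H M R \<and> P R) \<and>
     (\<forall>R\<in>C. \<forall>R'\<in>C. \<forall>\<phi>\<in>Stab H. act \<phi> R = R' \<longrightarrow> R = R'))"

definition twin_comps :: "'a set \<Rightarrow> 'a set \<Rightarrow> 'a set \<Rightarrow> bool" where
  "twin_comps H J J' \<longleftrightarrow> J \<noteq> J' \<and> (\<exists>\<phi>\<in>Stab H. \<phi> ` J = J')"

lemma twin_comps_sym: "twin_comps H J J' \<Longrightarrow> twin_comps H J' J"
proof -
  assume "twin_comps H J J'"
  then obtain \<phi> where f: "\<phi> \<in> Stab H" "\<phi> ` J = J'" "J \<noteq> J'" by (auto simp: twin_comps_def)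
  have "inv \<phi> ` \<phi> ` J = J" using f(1) by (simp add: image_image)
  then have "inv \<phi> ` J' = J" by (simp only: f(2))
  then show ?thesis using f Stab_inv unfolding twin_comps_def by blast
qed

lemma edge_meets_one_comp:
  assumes "e \<in> ED" "J \<in> comps H" "J' \<in> comps H" "e \<inter> J \<noteq> {}" "e \<inter> J' \<noteq> {}"
  shows "J = J'"
proof -
  obtain x where x: "x \<in> e" "x \<in> J" using assms by blast
  obtain y where y: "y \<in> e" "y \<in> J'" using assms by blast
  obtain z where z: "e = {x, z}" "adj x z" using edge_at[OF assms(1) x(1)] by blast
  show ?thesis
  proof (cases "y = x")
    case True
    then show ?thesis using comps_disj assms(2,3) x y by blast
  next
    case False
    then have "adj x y" using z y by simp
    then have "y \<in> J" using comps_adj[OF assms(2) x(2)] comps_sub[OF assms(3)] y by blast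
    then show ?thesis using comps_disj assms(2,3) y by blast
  qed
qed

lemma act_restrict_to:
  assumes f: "\<phi> \<in> Stab H" and J: "J \<in> comps H" and R: "R \<subseteq> free_edges J M"
  shows "act (restrict_to J \<phi>) R = act \<phi> R"
proof (rule image_cong[OF refl])
  fix e assume "e \<in> R"
  then have e: "e \<in> ED" "e \<inter> J \<noteq> {}" using R by (auto simp: free_edges_def)
  then obtain x where x: "x \<in> e" "x \<in> J" by blast
  obtain y where y: "e = {x, y}" "adj x y" using edge_at[OF e(1) x(1)] by blast
  have "y \<in> J \<or> y \<notin> H" using comps_adj[OF J x(2) _ y(2)] by blast
  then have "restrict_to J \<phi> y = \<phi> y" using Stab_fix[OF f] by (auto simp: restrict_to_def)
  moreover have "restrict_to J \<phi> x = \<phi> x" using x(2) by (simp add: restrict_to_def)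
  ultimately show "restrict_to J \<phi> ` e = \<phi> ` e" using y(1) by simp
qed

text \<open>Inequivalent colourings of \<open>H\<close> are told apart by the sum, over the components, of codes of the
  \<open>Stab H\<close>-orbits of their restrictions, because this sum is invariant under \<open>Stab H\<close>.\<close>

lemma many_rigid_glue:
  assumes HV: "H \<subseteq> V" and "H \<noteq> {}"
    and fam: "\<And>J. J \<in> comps H \<Longrightarrow> many_rigid W J M (n J) (\<lambda>R. \<exists>x\<in>J. {p J, x} \<in> R)"
    and n: "(t = 1 \<and> (\<forall>J\<in>comps H. card {J' \<in> comps H. twin_comps H J J'} + 1 \<le> n J)) \<or>
      (\<forall>J\<in>comps H. card {J' \<in> comps H. twin_comps H J J'} + 2 \<le> n J \<and> t \<le> n J)"
  shows "many_rigid W H M t (\<lambda>R. \<forall>J\<in>comps H. \<exists>x\<in>J. {p J, x} \<in> R)"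
proof -
  define I where "I = comps H"
  have finI: "finite I" using finite_comps[OF HV] by (simp add: I_def)
  have "I \<noteq> {}" using assms(2) by (auto simp: I_def comps_def)
  define isC where "isC J C \<longleftrightarrow> finite C \<and> card C = n J \<and> (\<forall>R\<in>C. rigid W J M R \<and> (\<exists>x\<in>J. {p J, x} \<in> R)) \<and>
     (\<forall>R\<in>C. \<forall>R'\<in>C. \<forall>\<phi>\<in>Stab J. act \<phi> R = R' \<longrightarrow> R = R')" for J C
  have "\<forall>J\<in>I. \<exists>C. isC J C"
    using fam unfolding many_rigid_def I_def isC_def by simp
  then obtain C where isC: "\<And>J. J \<in> I \<Longrightarrow> isC J (C J)" using bchoice[of I isC] by blast
  have C: "finite (C J)" "card (C J) = n J"
    "\<And>R. R \<in> C J \<Longrightarrow> rigid W J M R"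
    "\<And>R. R \<in> C J \<Longrightarrow> \<exists>x\<in>J. {p J, x} \<in> R"
    "\<And>R R' \<phi>. R \<in> C J \<Longrightarrow> R' \<in> C J \<Longrightarrow> \<phi> \<in> Stab J \<Longrightarrow> act \<phi> R = R' \<Longrightarrow> R = R'"
    if "J \<in> I" for J
    using isC[OF that] unfolding isC_def by blast+
  have CF: "R \<subseteq> free_edges J M" if "J \<in> I" "R \<in> C J" for J R
    using C(3)[OF that] by (simp add: rigid_def)
  \<comment> \<open>Orbits under \<open>Stab H\<close> and not \<open>Stab J\<close>, so that
    colourings of different components can have the same label.\<close>
  define orbit where "orbit R = (\<lambda>\<phi>. act \<phi> R) ` Stab H" for R
  have "finite (orbit ` Pow ED)" by simp
  then have "\<exists>(code :: 'a set set set \<Rightarrow> nat) n. code ` orbit ` Pow ED = {i. i < n} \<and> inj_on code (orbit ` Pow ED)"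
    by (rule finite_imp_inj_to_nat_seg)
  then obtain code :: "'a set set set \<Rightarrow> nat" where code: "inj_on code (orbit ` Pow ED)"
    by (elim exE conjE)
  define lab where "lab R = code (orbit R)" for R
  have lab_act: "lab (act \<phi> R) = lab R" if f: "\<phi> \<in> Stab H" for \<phi> R
  proof -
    have "orbit (act \<phi> R) = orbit R"
    proof (intro equalityI subsetI)
      fix X assume "X \<in> orbit (act \<phi> R)"
      then obtain \<psi> where "\<psi> \<in> Stab H" "X = act \<psi> (act \<phi> R)" unfolding orbit_def by (rule imageE)
      then have "\<psi> \<circ> \<phi> \<in> Stab H" "X = act (\<psi> \<circ> \<phi>) R" using Stab_comp[OF _ f] by (simp_all only: act_comp)
      then show "X \<in> orbit R" unfolding orbit_def by (intro image_eqI)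
    next
      fix X assume "X \<in> orbit R"
      then obtain \<psi> where p: "\<psi> \<in> Stab H" "X = act \<psi> R" unfolding orbit_def by (rule imageE)
      then have "\<psi> \<circ> inv \<phi> \<in> Stab H" "X = act (\<psi> \<circ> inv \<phi>) (act \<phi> R)"
        using Stab_comp[OF p(1) Stab_inv[OF f]] by (simp_all only: act_comp act_inv[OF f])
      then show "X \<in> orbit (act \<phi> R)" unfolding orbit_def by (intro image_eqI)
    qed
    then show ?thesis by (simp add: lab_def)
  qed
  have lab_inj: "inj_on lab (C J)" if J: "J \<in> I" for J
  proof (rule inj_onI)
    fix R R' assume R: "R \<in> C J" "R' \<in> C J" "lab R = lab R'"
    have JH: "J \<in> comps H" using J by (simp add: I_def)
    have RF: "R \<subseteq> free_edges J M" "R' \<subseteq> free_edges J M" using CF J R by auto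
    then have "R \<in> Pow ED" "R' \<in> Pow ED"
      using subset_trans[OF RF(1) free_edges_ED] subset_trans[OF RF(2) free_edges_ED] by simp_all
    then have "orbit R \<in> orbit ` Pow ED" "orbit R' \<in> orbit ` Pow ED" by (blast intro: imageI)+
    with code R(3) have "orbit R = orbit R'" unfolding lab_def by (rule inj_onD)
    moreover have "act id R' \<in> orbit R'" unfolding orbit_def by (rule image_eqI[of _ _ id]) simp_all
    ultimately have "R' \<in> orbit R" by simp
    then obtain \<phi> where f: "\<phi> \<in> Stab H" "R' = act \<phi> R" unfolding orbit_def by (rule imageE)
    \<comment> \<open>A single edge of \<open>R\<close> is enough: it meets \<open>J\<close>, and so
      does its image. Hence \<phi> maps \<open>J\<close> to itself, and \<open>R\<close> and
      \<open>R'\<close> are already equivalent under \<open>Stab J\<close>.\<close>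
    obtain x where x: "{p J, x} \<in> R" using C(4)[OF J R(1)] by blast
    then have i1: "{p J, x} \<inter> J \<noteq> {}" using RF(1) by (auto simp: free_edges_def)
    have "\<phi> ` {p J, x} \<in> R'" unfolding f(2) using x by (rule imageI)
    then have i2: "\<phi> ` {p J, x} \<in> ED" "\<phi> ` {p J, x} \<inter> J \<noteq> {}" using RF(2) by (auto simp: free_edges_def)
    have i3: "\<phi> ` {p J, x} \<inter> \<phi> ` J \<noteq> {}" using i1 by blast
    have "\<phi> ` J = J"
      using edge_meets_one_comp[OF i2(1) Stab_comps[OF f(1) JH] JH i3 i2(2)] .
    then have "restrict_to J \<phi> \<in> Stab J" "act (restrict_to J \<phi>) R = R'"
      using restrict_to_Stab[OF f(1) JH] act_restrict_to[OF f(1) JH RF(1)] f(2) by simp_all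
    then show "R = R'" using C(5)[OF J R(1,2)] by blast
  qed
  define A where "A J = lab ` C J" for J
  have A: "finite (A J)" "card (A J) = n J" if "J \<in> I" for J
    using C(1,2)[OF that] lab_inj[OF that] by (simp_all add: A_def card_image)
  have irr: "\<not> twin_comps H J J" for J by (simp add: twin_comps_def)
  have "\<exists>S. finite S \<and> card S = t \<and> (\<forall>s\<in>S. \<exists>f. proper_choice I (twin_comps H) A f \<and> sum f I = s)"
    using n
  proof
    \<comment> \<open>For a single colouring no sums are compared, so one list entry more than the
      number of conflicts suffices.\<close>
    assume n: "t = 1 \<and> (\<forall>J\<in>comps H. card {J' \<in> comps H. twin_comps H J J'} + 1 \<le> n J)"
    have "\<exists>f. proper_choice I (twin_comps H) A f"
    proof (rule proper_choice_exists[OF finI twin_comps_sym irr A(1)])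
      fix J assume J: "J \<in> I"
      then show "card {J' \<in> I. twin_comps H J J'} + 1 \<le> card (A J)"
        using n A(2)[OF J] by (simp add: I_def)
    qed
    then obtain f where "proper_choice I (twin_comps H) A f" by blast
    then show ?thesis using n by (intro exI[of _ "{sum f I}"]) auto
  next
    assume n: "\<forall>J\<in>comps H. card {J' \<in> comps H. twin_comps H J J'} + 2 \<le> n J \<and> t \<le> n J"
    show ?thesis
    proof (rule many_choice_sums[OF finI \<open>I \<noteq> {}\<close> twin_comps_sym irr A(1)])
      fix J assume J: "J \<in> I"
      then show "card {J' \<in> I. twin_comps H J J'} + 2 \<le> card (A J)" "t \<le> card (A J)"
        using n A(2)[OF J] by (simp_all add: I_def)
    qed
  qed
  then obtain S where S: "finite S" "card S = t"
    "\<forall>s\<in>S. \<exists>f. proper_choice I (twin_comps H) A f \<and> sum f I = s" by blast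
  define part where "part f J = (SOME R. R \<in> C J \<and> lab R = f J)" for f J
  have part: "part f J \<in> C J" "lab (part f J) = f J"
    if "proper_choice I (twin_comps H) A f" "J \<in> I" for f J
  proof -
    have "f J \<in> lab ` C J" using that by (simp add: proper_choice_def A_def)
    then have "\<exists>R. R \<in> C J \<and> lab R = f J" by (metis imageE)
    from someI_ex[OF this] show "part f J \<in> C J" "lab (part f J) = f J" by (simp_all add: part_def)
  qed
  define tot where "tot f = (\<Union>J\<in>I. part f J)" for f
  have tot_part: "{e \<in> tot f. e \<inter> J \<noteq> {}} = part f J"
    if f: "proper_choice I (twin_comps H) A f" and J: "J \<in> I" for f J
  proof (intro equalityI subsetI)
    fix e assume "e \<in> {e \<in> tot f. e \<inter> J \<noteq> {}}"
    then obtain J' where J': "J' \<in> I" "e \<in> part f J'" "e \<inter> J \<noteq> {}" by (auto simp: tot_def)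
    then have "e \<in> free_edges J' M" using CF[OF J'(1) part(1)[OF f J'(1)]] by blast
    then have "J' = J" using edge_meets_one_comp[of e J' H J] J J' by (simp add: free_edges_def I_def)
    then show "e \<in> part f J" using J' by simp
  next
    fix e assume e: "e \<in> part f J"
    then have "e \<in> free_edges J M" using CF[OF J part(1)[OF f J]] by blast
    then show "e \<in> {e \<in> tot f. e \<inter> J \<noteq> {}}" using e J by (auto simp: tot_def free_edges_def)
  qed
  have move: "act \<phi> (part f J) = part g (\<phi> ` J)"
    if f: "proper_choice I (twin_comps H) A f" and g: "proper_choice I (twin_comps H) A g"
      and ph: "\<phi> \<in> Stab H" "act \<phi> (tot f) = tot g" and J: "J \<in> I" for f g \<phi> J
  proof -
    have J': "\<phi> ` J \<in> I" using Stab_comps[OF ph(1)] J by (simp add: I_def)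
    have m: "\<phi> ` e \<inter> \<phi> ` J \<noteq> {} \<longleftrightarrow> e \<inter> J \<noteq> {}" for e
      by (simp add: image_Int[OF Stab_inj[OF ph(1)], symmetric])
    have "act \<phi> {e \<in> tot f. e \<inter> J \<noteq> {}} = {e \<in> act \<phi> (tot f). e \<inter> \<phi> ` J \<noteq> {}}"
    proof (intro equalityI subsetI)
      fix e assume "e \<in> act \<phi> {e \<in> tot f. e \<inter> J \<noteq> {}}"
      then obtain d where "d \<in> tot f" "d \<inter> J \<noteq> {}" "e = \<phi> ` d" by blast
      then show "e \<in> {e \<in> act \<phi> (tot f). e \<inter> \<phi> ` J \<noteq> {}}" using m[of d] by simp
    next
      fix e assume e: "e \<in> {e \<in> act \<phi> (tot f). e \<inter> \<phi> ` J \<noteq> {}}"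
      then obtain d where d: "d \<in> tot f" "e = \<phi> ` d" by blast
      then have "d \<inter> J \<noteq> {}" using e m[of d] by simp
      then show "e \<in> act \<phi> {e \<in> tot f. e \<inter> J \<noteq> {}}" using d by simp
    qed
    then show ?thesis using tot_part[OF f J] tot_part[OF g J'] ph(2) by simp
  qed
  have lab_move: "f J = g (\<phi> ` J)"
    if f: "proper_choice I (twin_comps H) A f" and g: "proper_choice I (twin_comps H) A g"
      and ph: "\<phi> \<in> Stab H" "act \<phi> (tot f) = tot g" and J: "J \<in> I" for f g \<phi> J
  proof -
    have J': "\<phi> ` J \<in> I" using Stab_comps[OF ph(1)] J by (simp add: I_def)
    have "f J = lab (act \<phi> (part f J))" using part(2)[OF f J] lab_act[OF ph(1)] by simp
    then show ?thesis using part(2)[OF g J'] move[OF f g ph J] by simp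
  qed
  \<comment> \<open>\<phi> permutes the components and carries their labels along, so the second sum
    is a reindexing of the first.\<close>
  have sums: "sum f I = sum g I"
    if f: "proper_choice I (twin_comps H) A f" and g: "proper_choice I (twin_comps H) A g"
      and ph: "\<phi> \<in> Stab H" "act \<phi> (tot f) = tot g" for f g \<phi>
  proof -
    have "inj_on ((`) \<phi>) I"
      by (rule inj_onI) (use Stab_inj[OF ph(1)] in \<open>simp add: inj_image_eq_iff\<close>)
    moreover have "(`) \<phi> ` I \<subseteq> I" using Stab_comps[OF ph(1)] by (auto simp: I_def)
    ultimately have "bij_betw ((`) \<phi>) I I"
      using finI by (simp add: bij_betw_def endo_inj_surj)
    then have "sum (\<lambda>J. g (\<phi> ` J)) I = sum g I" by (rule sum.reindex_bij_betw)
    moreover have "sum f I = sum (\<lambda>J. g (\<phi> ` J)) I"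
      by (rule sum.cong[OF refl]) (rule lab_move[OF f g ph])
    ultimately show ?thesis by simp
  qed
  have rig: "rigid W H M (tot f)" and par: "\<forall>J\<in>comps H. \<exists>x\<in>J. {p J, x} \<in> tot f"
    if f: "proper_choice I (twin_comps H) A f" for f
  proof -
    have 1: "tot f \<subseteq> free_edges H M"
    proof
      fix e assume "e \<in> tot f"
      then obtain J where J: "J \<in> I" "e \<in> part f J" by (auto simp: tot_def)
      then have "e \<in> free_edges J M" using CF[OF J(1) part(1)[OF f J(1)]] by blast
      then show "e \<in> free_edges H M" using comps_sub[of J H] J by (auto simp: free_edges_def I_def)
    qed
    have 2: "\<phi> = id" if ph: "\<phi> \<in> Stab H" "act \<phi> (tot f) = tot f" for \<phi>
    proof
      fix x
      show "\<phi> x = id x"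
      proof (cases "x \<in> H")
        case True
        define J where "J = comp H x"
        have J: "J \<in> I" "x \<in> J" using True comp_in_comps comp_self by (simp_all add: J_def I_def)
        have JH: "J \<in> comps H" using J by (simp add: I_def)
        have J': "\<phi> ` J \<in> I" using Stab_comps[OF ph(1) JH] by (simp add: I_def)
        \<comment> \<open>Twin components have different labels because \<open>f\<close> is proper,
          so equal labels force \<phi> to map \<open>J\<close> to itself.\<close>
        have "f J = f (\<phi> ` J)" using lab_move[OF f f ph J(1)] .
        then have "\<not> twin_comps H J (\<phi> ` J)" using f J J' by (auto simp: proper_choice_def)
        then have fx: "\<phi> ` J = J" using ph(1) by (auto simp: twin_comps_def)
        have "act (restrict_to J \<phi>) (part f J) = part f J"
          using act_restrict_to[OF ph(1) JH CF[OF J(1) part(1)[OF f J(1)]]] move[OF f f ph J(1)] fx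
          by simp
        moreover have "restrict_to J \<phi> \<in> Stab J" using restrict_to_Stab[OF ph(1) JH fx] .
        ultimately have "restrict_to J \<phi> = id"
          using C(3)[OF J(1) part(1)[OF f J(1)]] by (simp add: rigid_def)
        then have "restrict_to J \<phi> x = id x" by simp
        then show ?thesis using J(2) by (simp add: restrict_to_def)
      next
        case False
        then show ?thesis using Stab_fix[OF ph(1)] by simp
      qed
    qed
    have 3: "1 \<le> incidence (tot f) w \<and> (w \<in> W \<longrightarrow> 2 \<le> incidence (tot f) w)" if w: "w \<in> H" for w
    proof -
      define J where "J = comp H w"
      have J: "J \<in> I" "w \<in> J" using w comp_in_comps comp_self by (simp_all add: J_def I_def)
      have "{e \<in> tot f. w \<in> e} = {e \<in> part f J. w \<in> e}"
        unfolding tot_part[OF f J(1), symmetric] using J(2) by blast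
      then have "incidence (tot f) w = incidence (part f J) w" by (simp add: incidence_def)
      then show ?thesis using C(3)[OF J(1) part(1)[OF f J(1)]] J by (simp add: rigid_def)
    qed
    show "rigid W H M (tot f)" using 1 2 3 by (simp add: rigid_def)
    show "\<forall>J\<in>comps H. \<exists>x\<in>J. {p J, x} \<in> tot f"
    proof
      fix J assume "J \<in> comps H"
      then have J: "J \<in> I" by (simp add: I_def)
      then show "\<exists>x\<in>J. {p J, x} \<in> tot f" using C(4)[OF J part(1)[OF f J]] by (auto simp: tot_def)
    qed
  qed
  obtain F where F: "\<And>s. s \<in> S \<Longrightarrow> proper_choice I (twin_comps H) A (F s)" "\<And>s. s \<in> S \<Longrightarrow> sum (F s) I = s"
    using S(3) by metis
  have eq: "s = s'" if "s \<in> S" "s' \<in> S" "\<phi> \<in> Stab H" "act \<phi> (tot (F s)) = tot (F s')" for s s' \<phi>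
    using sums[OF F(1)[OF that(1)] F(1)[OF that(2)] that(3,4)] F(2) that by simp
  have "inj_on (\<lambda>s. tot (F s)) S"
    by (rule inj_onI) (rule eq[OF _ _ Stab_id], simp_all)
  then have "card ((\<lambda>s. tot (F s)) ` S) = t" using S by (simp add: card_image)
  moreover have "\<forall>R\<in>(\<lambda>s. tot (F s)) ` S. \<forall>R'\<in>(\<lambda>s. tot (F s)) ` S. \<forall>\<phi>\<in>Stab H. act \<phi> R = R' \<longrightarrow> R = R'"
  proof (intro ballI impI)
    fix R R' \<phi> assume a: "R \<in> (\<lambda>s. tot (F s)) ` S" "R' \<in> (\<lambda>s. tot (F s)) ` S" "\<phi> \<in> Stab H" "act \<phi> R = R'"
    then obtain s s' where "s \<in> S" "s' \<in> S" "R = tot (F s)" "R' = tot (F s')" by blast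
    then show "R = R'" using eq[of s s' \<phi>] a by simp
  qed
  moreover have "\<forall>R\<in>(\<lambda>s. tot (F s)) ` S. rigid W H M R \<and> (\<forall>J\<in>comps H. \<exists>x\<in>J. {p J, x} \<in> R)"
    using F(1) rig par by auto
  ultimately show ?thesis
    unfolding many_rigid_def using S(1) by (intro exI[of _ "(\<lambda>s. tot (F s)) ` S"]) simp
qed

section \<open>The invariant of the recursion\<close>

text \<open>Bounds \<open>t\<close> times the orbit size at a vertex of \<open>W\<close> with
  \<open>q\<close> decided edges. For \<open>q >= 2\<close> the value is the number of free edges
  besides the one to the attaching vertex; n edges have at least n nonempty subsets, which is what a
  part with a single vertex needs. For \<open>q <= 1\<close> the value \<open>k - 1\<close> admits
  orbits as large as a neighbourhood with one vertex missing, and it is still below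
  \<open>2 ^ (k - 2)\<close>. The drop from \<open>q = 1\<close> to \<open>q = 2\<close> is 2 and
  not 1; the covering clause of \<open>state\<close> compensates for this.\<close>

definition load_bound :: "nat \<Rightarrow> nat" where
  "load_bound q = (if q \<le> 1 then k - 1 else k - 1 - q)"

text \<open>Here \<open>H\<close> is the part still to be coloured, \<open>t\<close> the number of inequivalent colourings wanted, and \<open>W\<close>
  the set of neighbours of \<open>v\<^sub>0\<close> other than \<open>v\<^sub>1\<close>, which need two red edges. The bounds keep enough free
  edges at each vertex of \<open>H\<close> to colour all components equivalent to its own differently.\<close>

definition state :: "'a set \<Rightarrow> 'a set \<Rightarrow> 'a set set \<Rightarrow> nat \<Rightarrow> bool" where
  "state W H M t \<longleftrightarrow> H \<subseteq> V \<and> M \<subseteq> ED \<and> (\<forall>e\<in>M. \<not> e \<subseteq> H) \<and>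
     (\<forall>\<phi>\<in>Stab H. act \<phi> M = M) \<and> (\<forall>\<phi>\<in>Stab H. \<forall>w\<in>W. \<phi> w \<in> W) \<and> 1 \<le> t \<and>
     (\<forall>w\<in>H \<inter> W. t * card (orb H w) \<le> load_bound (incidence M w) \<and>
        (incidence M w \<le> 1 \<longrightarrow>
          (\<forall>x. orb H w \<subseteq> nb x \<longrightarrow> {x, w} \<notin> M \<longrightarrow> card (orb H w) \<le> k - 2))) \<and>
     (\<forall>w\<in>H - W. t + incidence M w \<le> k \<and>
        (1 \<le> incidence M w \<longrightarrow> card (orb H w) + incidence M w \<le> k - 1))"

lemma load_bound_le: "load_bound q \<le> k - 1"
  by (simp add: load_bound_def diff_le_mono2)

lemma stateD:
  assumes "state W H M t"
  shows "H \<subseteq> V" "M \<subseteq> ED" "\<And>e. e \<in> M \<Longrightarrow> \<not> e \<subseteq> H" "\<And>\<phi>. \<phi> \<in> Stab H \<Longrightarrow> act \<phi> M = M"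
    "\<And>\<phi> w. \<phi> \<in> Stab H \<Longrightarrow> w \<in> W \<Longrightarrow> \<phi> w \<in> W" "1 \<le> t"
    "\<And>w. w \<in> H \<Longrightarrow> w \<in> W \<Longrightarrow> t * card (orb H w) \<le> load_bound (incidence M w)"
    "\<And>w x. w \<in> H \<Longrightarrow> w \<in> W \<Longrightarrow> incidence M w \<le> 1 \<Longrightarrow> orb H w \<subseteq> nb x \<Longrightarrow> {x, w} \<notin> M \<Longrightarrow> card (orb H w) \<le> k - 2"
    "\<And>w. w \<in> H \<Longrightarrow> w \<notin> W \<Longrightarrow> t + incidence M w \<le> k"
    "\<And>w. w \<in> H \<Longrightarrow> w \<notin> W \<Longrightarrow> 1 \<le> incidence M w \<Longrightarrow> card (orb H w) + incidence M w \<le> k - 1"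
  using assms by (simp_all add: state_def)

lemma card_orb_pos:
  assumes "w \<in> H" "H \<subseteq> V" shows "1 \<le> card (orb H w)"
proof -
  have "orb H w \<noteq> {}" using orb_self[of w H] by blast
  with finite_orb[OF assms] have "0 < card (orb H w)" by (simp only: card_gt_0_iff simp_thms)
  then show ?thesis by simp
qed

lemma card_orb_mono: "w \<in> H \<Longrightarrow> H \<subseteq> K \<Longrightarrow> K \<subseteq> V \<Longrightarrow> card (orb H w) \<le> card (orb K w)"
  by (rule card_mono[OF finite_orb orb_mono]) auto

text \<open>Either the orbit does not change and the bound is inherited, or it loses one of at most
  \<open>k - 1\<close> vertices. The second case needs no covering vertex, so the bound survives
  although a smaller orbit is covered by more vertices.\<close>

lemma cover_bound_mono:
  assumes w: "w \<in> H" "w \<in> W" and HK: "H \<subseteq> K" and K: "state W K M t"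
    and inc: "incidence M w \<le> 1" and cov: "orb H w \<subseteq> nb x" "{x, w} \<notin> M"
  shows "card (orb H w) \<le> k - 2"
proof -
  have wK: "w \<in> K" using w HK by blast
  show ?thesis
  proof (cases "orb H w = orb K w")
  case True
  then show ?thesis using stateD(8)[OF K wK w(2) inc _ cov(2)] cov(1) by simp
next
  case False
  have "orb H w \<subset> orb K w" using False orb_mono[OF HK] by blast
  then have "card (orb H w) < card (orb K w)"
    using psubset_card_mono[OF finite_orb[OF wK stateD(1)[OF K]]] by blast
  moreover have "card (orb K w) \<le> t * card (orb K w)" using stateD(6)[OF K] by simp
  ultimately show ?thesis using stateD(7)[OF K wK w(2)] load_bound_le[of "incidence M w"] by linarith
qed
qed

lemma state_mono:
  assumes K: "state W K M t" and HK: "H \<subseteq> K"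
  shows "state W H M t"
  unfolding state_def
proof (intro conjI ballI allI impI)
  note s = stateD[OF K]
  show "H \<subseteq> V" "M \<subseteq> ED" "1 \<le> t" using s HK by auto
  show "\<not> e \<subseteq> H" if "e \<in> M" for e using s(3)[OF that] HK by blast
  show "act \<phi> M = M" if "\<phi> \<in> Stab H" for \<phi> using s(4)[OF Stab_mono[OF HK that]] .
  show "\<phi> w \<in> W" if "\<phi> \<in> Stab H" "w \<in> W" for \<phi> w using s(5)[OF Stab_mono[OF HK that(1)] that(2)] .
  show "t * card (orb H w) \<le> load_bound (incidence M w)" if "w \<in> H \<inter> W" for w
    using s(7)[of w] that HK card_orb_mono[OF _ HK s(1), of w]
    by (meson IntD1 IntD2 le_trans mult_le_mono2 subsetD)
  show "card (orb H w) \<le> k - 2"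
    if "w \<in> H \<inter> W" "incidence M w \<le> 1" "orb H w \<subseteq> nb x" "{x, w} \<notin> M" for w x
    using cover_bound_mono[OF _ _ HK K] that by blast
  show "t + incidence M w \<le> k" if "w \<in> H - W" for w using s(9) that HK by blast
  show "card (orb H w) + incidence M w \<le> k - 1" if "w \<in> H - W" "1 \<le> incidence M w" for w
    using s(10)[of w] that HK card_orb_mono[OF _ HK s(1), of w] by fastforce
qed

text \<open>Automorphisms that move \<open>J\<close> to its twins carry \<open>orb J w\<close> to
  disjoint subsets of \<open>orb H w\<close>. Extra demand for colourings of \<open>J\<close> is
  thus paid for by a smaller orbit.\<close>

lemma twin_count_orb:
  assumes HV: "H \<subseteq> V" and J: "J \<in> comps H" and w: "w \<in> J"
  shows "(card {J' \<in> comps H. twin_comps H J J'} + 1) * card (orb J w) \<le> card (orb H w)"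
proof -
  define T where "T = insert J {J' \<in> comps H. twin_comps H J J'}"
  have finT: "finite T" using finite_comps[OF HV] by (simp add: T_def)
  have ex: "\<forall>J'\<in>T. \<exists>\<phi>. \<phi> \<in> Stab H \<and> \<phi> ` J = J'"
  proof
    fix J' assume "J' \<in> T"
    then consider "J' = J" | "twin_comps H J J'" by (auto simp: T_def)
    then show "\<exists>\<phi>. \<phi> \<in> Stab H \<and> \<phi> ` J = J'"
    proof cases
      case 1
      then show ?thesis using Stab_id by (intro exI[of _ id]) simp
    next
      case 2
      then show ?thesis unfolding twin_comps_def by blast
    qed
  qed
  obtain f where f0: "\<forall>J'\<in>T. f J' \<in> Stab H \<and> f J' ` J = J'"
    using bchoice[OF ex] by (rule exE)
  have f: "f J' \<in> Stab H" "f J' ` J = J'" if "J' \<in> T" for J' using f0 that by simp_all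
  have JH: "J \<subseteq> H" using comps_sub[OF J] .
  have sub: "f J' ` orb J w \<subseteq> orb H w" if "J' \<in> T" for J'
    using orb_image[OF f(1)[OF that], of w] orb_mono[OF JH, of w] by blast
  have sub2: "f J' ` orb J w \<subseteq> J'" if "J' \<in> T" for J'
    using f(2)[OF that] orb_sub[OF w] by blast
  have fin: "finite (orb J w)" using finite_orb[OF w] JH HV by blast
  have disj: "f J1 ` orb J w \<inter> f J2 ` orb J w = {}" if "J1 \<in> T" "J2 \<in> T" "J1 \<noteq> J2" for J1 J2
  proof -
    have "J1 \<in> comps H" "J2 \<in> comps H" using that J by (auto simp: T_def)
    then have "J1 \<inter> J2 = {}" using comps_disj that(3) by blast
    then show ?thesis using sub2[OF that(1)] sub2[OF that(2)] by blast
  qed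
  have "card (\<Union>J'\<in>T. f J' ` orb J w) = (\<Sum>J'\<in>T. card (f J' ` orb J w))"
    by (rule card_UN_disjoint) (use finT fin disj in auto)
  also have "\<dots> = (\<Sum>J'\<in>T. card (orb J w))"
    by (rule sum.cong[OF refl]) (use f(1) Stab_inj in \<open>meson card_image inj_on_subset subset_UNIV\<close>)
  also have "\<dots> = card T * card (orb J w)" by simp
  finally have "card T * card (orb J w) \<le> card (orb H w)"
    using card_mono[of "orb H w" "\<Union>J'\<in>T. f J' ` orb J w"] sub finite_orb[of w H] w JH HV
    by (metis (no_types, lifting) UN_least subsetD)
  moreover have "card T = card {J' \<in> comps H. twin_comps H J J'} + 1"
    using finite_comps[OF HV] by (simp add: T_def twin_comps_def)
  ultimately show ?thesis by simp
qed

text \<open>The vertex \<open>s\<close> is fixed, so it has a neighbour in every twin of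
  \<open>J\<close>; these differ from each other and from \<open>y\<close>.\<close>

lemma twin_count_nb:
  assumes HV: "H \<subseteq> V" and J: "J \<in> comps H" and s: "s \<notin> H" "x \<in> J" "adj s x" "y \<notin> H" "adj s y"
  shows "card {J' \<in> comps H. twin_comps H J J'} + 1 \<le> k - 1"
proof -
  define T where "T = insert J {J' \<in> comps H. twin_comps H J J'}"
  have TH: "T \<subseteq> comps H" using J by (auto simp: T_def)
  have ex: "\<forall>J'\<in>T. \<exists>z. z \<in> J' \<and> adj s z"
  proof
    fix J' assume "J' \<in> T"
    then consider "J' = J" | "twin_comps H J J'" by (auto simp: T_def)
    then show "\<exists>z. z \<in> J' \<and> adj s z"
    proof cases
      case 1
      then show ?thesis using s by blast
    next
      case 2
      then obtain \<phi> where f: "\<phi> \<in> Stab H" "\<phi> ` J = J'" unfolding twin_comps_def by blast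
      have "adj (\<phi> s) (\<phi> x)" using s(3) Stab_adj[OF f(1)] by simp
      then have "adj s (\<phi> x)" using Stab_fix[OF f(1) s(1)] by simp
      then show ?thesis using f(2) s(2) by blast
    qed
  qed
  obtain g where g: "\<forall>J'\<in>T. g J' \<in> J' \<and> adj s (g J')"
    using bchoice[OF ex] by (rule exE)
  have "inj_on g T"
  proof (rule inj_onI)
    fix J1 J2 assume a: "J1 \<in> T" "J2 \<in> T" "g J1 = g J2"
    then have "g J1 \<in> J1" "g J1 \<in> J2" using g by auto
    then show "J1 = J2" using comps_disj a TH by blast
  qed
  moreover have "g ` T \<subseteq> nb s - {y}"
  proof
    fix z assume "z \<in> g ` T"
    then obtain J1 where J1: "J1 \<in> T" "z = g J1" by blast
    then have "z \<in> J1" "adj s z" using g by auto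
    then show "z \<in> nb s - {y}" using comps_sub J1 TH s(4) by auto
  qed
  ultimately have "card T \<le> card (nb s - {y})"
    by (meson card_inj_on_le finite_Diff finite_nb)
  also have "\<dots> = card (nb s) - 1" using s(5) by (simp add: card_Diff_singleton)
  also have "\<dots> \<le> k - 1" using card_nb_le[of s] by simp
  finally show ?thesis
    using finite_comps[OF HV] by (simp add: T_def twin_comps_def)
qed

text \<open>\<open>t'\<close> is the demand of \<open>many_rigid_glue\<close>: one list entry more
  than conflicts for one colouring, two more for several. On \<open>W\<close> the factor
  \<open>m\<close>, or \<open>m + 1 <= 2 * m\<close> if \<open>t >= 2\<close>, is absorbed by
  \<open>twin_count_orb\<close>. Elsewhere \<open>m\<close> is at most the orbit size, which is
  bounded as soon as one edge is decided; with no decided edge \<open>m <= k - 1\<close>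
  suffices.\<close>

lemma state_comp:
  assumes H: "state W H M t" and J: "J \<in> comps H"
    and m: "m = card {J' \<in> comps H. twin_comps H J J'} + 1" "m \<le> k - 1"
    and t': "t' = (if t = 1 then m else max t (m + 1))"
  shows "state W J M t'"
proof -
  note s = stateD[OF H]
  have JH: "J \<subseteq> H" using comps_sub[OF J] .
  have sJ: "state W J M t" using state_mono[OF H JH] .
  note sj = stateD[OF sJ]
  have mo: "m * card (orb J w) \<le> card (orb H w)" if "w \<in> J" for w
    using twin_count_orb[OF s(1) J that] m(1) by simp
  have op: "1 \<le> card (orb J w)" if "w \<in> J" for w using card_orb_pos[OF that] JH s(1) by blast
  have W: "t' * card (orb J w) \<le> load_bound (incidence M w)" if w: "w \<in> J" "w \<in> W" for w
  proof -
    have wH: "t * card (orb H w) \<le> load_bound (incidence M w)" using s(7)[of w] w JH by blast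
    show ?thesis
    proof (cases "t = 1")
      case True
      then show ?thesis using mo[OF w(1)] wH t' by simp
    next
      case False
      then have t2: "2 \<le> t" using s(6) by simp
      have "(m + 1) * card (orb J w) \<le> 2 * (m * card (orb J w))"
        using m(1) by (simp add: algebra_simps)
      also have "\<dots> \<le> t * card (orb H w)" using mo[OF w(1)] t2 by (rule mult_le_mono[rotated])
      finally have "(m + 1) * card (orb J w) \<le> load_bound (incidence M w)" using wH by simp
      moreover have "t * card (orb J w) \<le> load_bound (incidence M w)" using sj(7)[OF w] .
      ultimately show ?thesis using False t' by (simp add: max_def)
    qed
  qed
  have nW: "t' + incidence M w \<le> k" if w: "w \<in> J" "w \<notin> W" for w
  proof -
    have wH: "w \<in> H" using w JH by blast
    have "m + 1 + incidence M w \<le> k"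
    proof (cases "1 \<le> incidence M w")
      case True
      have "m \<le> m * card (orb J w)" using op[OF w(1)] by simp
      then show ?thesis using s(10)[OF wH w(2) True] mo[OF w(1)] k5 by linarith
    next
      case False
      then show ?thesis using m(2) k5 by simp
    qed
    then show ?thesis using s(9)[OF wH w(2)] t' by (simp add: max_def)
  qed
  have "1 \<le> t'" using t' m(1) by (auto simp: max_def)
  then show ?thesis using sj W nW unfolding state_def by auto
qed

text \<open>\<open>u\<close> is the fixed vertex to which \<open>K\<close> is attached. Its further
  neighbour outside \<open>K\<close> limits orbits in its neighbourhood to \<open>k - 1\<close>
  vertices. \<open>t\<close> is quantified inside because the parts of \<open>K\<close> have demands
  of their own.\<close>

definition part_colourable :: "'a set \<Rightarrow> 'a set \<Rightarrow> 'a set set \<Rightarrow> bool" where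
  "part_colourable W K M \<longleftrightarrow> (\<forall>u t. state W K M t \<longrightarrow> conn K \<longrightarrow> u \<notin> K \<longrightarrow>
     (\<exists>x\<in>K. adj u x) \<longrightarrow> (\<exists>y. y \<notin> K \<and> adj u y) \<longrightarrow> (\<forall>x\<in>K. {u, x} \<notin> M) \<longrightarrow>
     many_rigid W K M t (\<lambda>R. \<exists>x\<in>K. {u, x} \<in> R))"

lemma many_rigid_comps:
  assumes H: "state W H M t" and ne: "H \<noteq> {}"
    and core: "\<And>J. J \<in> comps H \<Longrightarrow> part_colourable W J M"
    and p: "\<And>J. J \<in> comps H \<Longrightarrow> p J \<notin> H" "\<And>J. J \<in> comps H \<Longrightarrow> \<exists>x\<in>J. adj (p J) x"
      "\<And>J. J \<in> comps H \<Longrightarrow> \<exists>y. y \<notin> H \<and> adj (p J) y" "\<And>J x. J \<in> comps H \<Longrightarrow> x \<in> J \<Longrightarrow> {p J, x} \<notin> M"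
  shows "many_rigid W H M t (\<lambda>R. \<forall>J\<in>comps H. \<exists>x\<in>J. {p J, x} \<in> R)"
proof -
  define m where "m J = card {J' \<in> comps H. twin_comps H J J'} + 1" for J
  define n where "n J = (if t = 1 then m J else max t (m J + 1))" for J
  show ?thesis
  proof (rule many_rigid_glue[of _ _ _ n])
    show "H \<subseteq> V" using stateD(1)[OF H] .
    show "H \<noteq> {}" by fact
    fix J assume J: "J \<in> comps H"
    have JH: "J \<subseteq> H" using comps_sub[OF J] .
    obtain x where x: "x \<in> J" "adj (p J) x" using p(2)[OF J] by blast
    obtain y where y: "y \<notin> H" "adj (p J) y" using p(3)[OF J] by blast
    have "m J \<le> k - 1"
      using twin_count_nb[OF stateD(1)[OF H] J p(1)[OF J] x y] by (simp add: m_def)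
    then have "state W J M (n J)" using state_comp[OF H J m_def _ n_def] by blast
    then show "many_rigid W J M (n J) (\<lambda>R. \<exists>x\<in>J. {p J, x} \<in> R)"
      using core[OF J] comps_conn[OF J] p(1)[OF J] JH x y p(4)[OF J] unfolding part_colourable_def by blast
  next
    show "(t = 1 \<and> (\<forall>J\<in>comps H. card {J' \<in> comps H. twin_comps H J J'} + 1 \<le> n J)) \<or>
      (\<forall>J\<in>comps H. card {J' \<in> comps H. twin_comps H J J'} + 2 \<le> n J \<and> t \<le> n J)"
      by (cases "t = 1") (auto simp: n_def m_def)
  qed
qed

section \<open>Removing an orbit\<close>

lemma incidence_mono: "R \<subseteq> R' \<Longrightarrow> finite R' \<Longrightarrow> incidence R w \<le> incidence R' w"
  unfolding incidence_def by (rule card_mono) auto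

lemma incidence_ge1: "finite R \<Longrightarrow> e \<in> R \<Longrightarrow> w \<in> e \<Longrightarrow> 1 \<le> incidence R w"
  unfolding incidence_def by (simp add: Suc_le_eq card_gt_0_iff) blast

lemma incidence_ge2:
  assumes "finite R" "e \<in> R" "w \<in> e" "e' \<in> R" "w \<in> e'" "e \<noteq> e'"
  shows "2 \<le> incidence R w"
proof -
  have "card {e, e'} \<le> card {e \<in> R. w \<in> e}" by (rule card_mono) (use assms in auto)
  then show ?thesis using assms(6) by (simp add: incidence_def)
qed

lemma many_rigid_weaken:
  assumes "many_rigid W H M t P" "t' \<le> t" "\<And>R. rigid W H M R \<Longrightarrow> P R \<Longrightarrow> P' R"
  shows "many_rigid W H M t' P'"
proof -
  obtain C where C: "finite C" "card C = t" "\<forall>R\<in>C. rigid W H M R \<and> P R"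
     "\<forall>R\<in>C. \<forall>R'\<in>C. \<forall>\<phi>\<in>Stab H. act \<phi> R = R' \<longrightarrow> R = R'"
    using assms(1) unfolding many_rigid_def by blast
  obtain D where D: "D \<subseteq> C" "card D = t'" "finite D"
    using obtain_subset_with_card_n[of t' C] assms(2) C(2) by blast
  have r: "rigid W H M R \<and> P' R" if "R \<in> D" for R
  proof -
    have "rigid W H M R" "P R" using that D(1) C(3) by auto
    then show ?thesis using assms(3) by simp
  qed
  have e: "R = R'" if "R \<in> D" "R' \<in> D" "\<phi> \<in> Stab H" "act \<phi> R = R'" for R R' \<phi>
    using C(4) D(1) that by blast
  show ?thesis unfolding many_rigid_def
    by (intro exI[of _ D]) (use D r e in simp)
qed

lemma many_rigid_union:
  assumes 1: "many_rigid W H M t1 P1" and 2: "many_rigid W H M t2 P2"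
    and ne: "\<And>\<phi> R R'. \<phi> \<in> Stab H \<Longrightarrow> P1 R \<Longrightarrow> P2 R' \<Longrightarrow> act \<phi> R \<noteq> R' \<and> act \<phi> R' \<noteq> R"
    and P: "\<And>R. P1 R \<Longrightarrow> P R" "\<And>R. P2 R \<Longrightarrow> P R"
  shows "many_rigid W H M (t1 + t2) P"
proof -
  obtain C where C0: "finite C" "card C = t1" "\<forall>R\<in>C. rigid W H M R \<and> P1 R"
     "\<forall>R\<in>C. \<forall>R'\<in>C. \<forall>\<phi>\<in>Stab H. act \<phi> R = R' \<longrightarrow> R = R'"
    using 1 unfolding many_rigid_def by (elim exE conjE)
  have C3: "rigid W H M R" "P1 R" if "R \<in> C" for R using C0(3) that by simp_all
  have C5: "R = R'" if "R \<in> C" "R' \<in> C" "\<phi> \<in> Stab H" "act \<phi> R = R'" for R R' \<phi>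
    using C0(4) that by blast
  note C = C0(1,2) C3 C5
  obtain D where D0: "finite D" "card D = t2" "\<forall>R\<in>D. rigid W H M R \<and> P2 R"
     "\<forall>R\<in>D. \<forall>R'\<in>D. \<forall>\<phi>\<in>Stab H. act \<phi> R = R' \<longrightarrow> R = R'"
    using 2 unfolding many_rigid_def by (elim exE conjE)
  have D3: "rigid W H M R" "P2 R" if "R \<in> D" for R using D0(3) that by simp_all
  have D5: "R = R'" if "R \<in> D" "R' \<in> D" "\<phi> \<in> Stab H" "act \<phi> R = R'" for R R' \<phi>
    using D0(4) that by blast
  note D = D0(1,2) D3 D5
  have "C \<inter> D = {}"
  proof (rule ccontr)
    assume "C \<inter> D \<noteq> {}"
    then obtain R where "R \<in> C" "R \<in> D" by blast
    then show False using ne[OF Stab_id C(4)[of R] D(4)[of R]] by simp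
  qed
  then have card: "card (C \<union> D) = t1 + t2" using C(1,2) D(1,2) by (simp add: card_Un_disjoint)
  have eq: "R = R'" if "R \<in> C \<union> D" "R' \<in> C \<union> D" "\<phi> \<in> Stab H" "act \<phi> R = R'" for R R' \<phi>
    using that(1)
  proof
    assume R: "R \<in> C"
    then have "R' \<notin> D" using ne[OF that(3) C(4) D(4)] that(4) by blast
    then show ?thesis using C(5)[OF R _ that(3,4)] that(2) by blast
  next
    assume R: "R \<in> D"
    then have "R' \<notin> C" using ne[OF that(3) C(4) D(4)] that(4) by blast
    then show ?thesis using D(5)[OF R _ that(3,4)] that(2) by blast
  qed
  have r: "rigid W H M R \<and> P R" if "R \<in> C \<union> D" for R
    using that C(3,4) D(3,4) P by blast
  show ?thesis unfolding many_rigid_def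
    by (intro exI[of _ "C \<union> D"]) (use card eq r C(1) D(1) in simp)
qed

text \<open>\<tau> is meant to pin down \<open>S\<close>: an equivalence between two extended
  colourings fixes \<open>S\<close>, hence lies in \<open>Stab (K - S)\<close>, preserves the edges
  still free there, and is an equivalence of the restricted colourings.\<close>

lemma many_rigid_extend:
  assumes fam: "many_rigid W (K - S) M' t P'" and S: "S \<subseteq> K"
    and M': "\<And>\<phi>. \<phi> \<in> Stab (K - S) \<Longrightarrow> act \<phi> M' = M'"
    and tau: "\<tau> \<subseteq> free_edges K M" "\<tau> \<inter> free_edges (K - S) M' = {}"
    and sub: "free_edges (K - S) M' \<subseteq> free_edges K M"
    and fixS: "\<And>\<phi> R R' s. \<phi> \<in> Stab K \<Longrightarrow> R \<subseteq> free_edges (K - S) M' \<Longrightarrow> R' \<subseteq> free_edges (K - S) M' \<Longrightarrow>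
      act \<phi> (\<tau> \<union> R) = \<tau> \<union> R' \<Longrightarrow> s \<in> S \<Longrightarrow> \<phi> s = s"
    and inc: "\<And>R s. R \<subseteq> free_edges (K - S) M' \<Longrightarrow> P' R \<Longrightarrow> s \<in> S \<Longrightarrow>
      1 \<le> incidence (\<tau> \<union> R) s \<and> (s \<in> W \<longrightarrow> 2 \<le> incidence (\<tau> \<union> R) s)"
    and P: "\<And>R. R \<subseteq> free_edges (K - S) M' \<Longrightarrow> P' R \<Longrightarrow> P (\<tau> \<union> R)"
  shows "many_rigid W K M t P"
proof -
  let ?H = "K - S"
  let ?F = "free_edges (K - S) M'"
  obtain C where C0: "finite C" "card C = t" "\<forall>R\<in>C. rigid W (K - S) M' R \<and> P' R"
     "\<forall>R\<in>C. \<forall>R'\<in>C. \<forall>\<phi>\<in>Stab (K - S). act \<phi> R = R' \<longrightarrow> R = R'"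
    using fam unfolding many_rigid_def by (elim exE conjE)
  have C3: "rigid W (K - S) M' R" "P' R" if "R \<in> C" for R using C0(3) that by simp_all
  have C5: "R = R'" if "R \<in> C" "R' \<in> C" "\<phi> \<in> Stab (K - S)" "act \<phi> R = R'" for R R' \<phi>
    using C0(4) that by blast
  note C = C0(1,2) C3 C5
  have CF: "R \<subseteq> ?F" if "R \<in> C" for R using C(3)[OF that] by (simp add: rigid_def)
  have cut: "(\<tau> \<union> R) \<inter> ?F = R" if "R \<subseteq> ?F" for R using tau(2) that by blast
  have key: "\<phi> \<in> Stab ?H \<and> act \<phi> R = R'"
    if "\<phi> \<in> Stab K" "R \<subseteq> ?F" "R' \<subseteq> ?F" "act \<phi> (\<tau> \<union> R) = \<tau> \<union> R'" for \<phi> R R'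
  proof -
    have f: "\<phi> \<in> Stab ?H"
    proof (rule Stab_shrink[OF that(1)])
      fix x assume "x \<in> K - (K - S)"
      then have "x \<in> S" by blast
      then show "\<phi> x = x" by (rule fixS[OF that])
    qed blast
    have inj: "inj ((`) \<phi>)" by (rule injI) (use Stab_inj[OF f] in \<open>simp add: inj_image_eq_iff\<close>)
    have "act \<phi> R = act \<phi> ((\<tau> \<union> R) \<inter> ?F)" using cut[OF that(2)] by simp
    also have "\<dots> = act \<phi> (\<tau> \<union> R) \<inter> act \<phi> ?F" by (rule image_Int[OF inj])
    also have "\<dots> = (\<tau> \<union> R') \<inter> ?F" by (simp only: that(4) act_free_edges[OF f M'[OF f]])
    also have "\<dots> = R'" using cut[OF that(3)] .
    finally show ?thesis using f by simp
  qed
  have inj: "inj_on (\<lambda>R. \<tau> \<union> R) C"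
  proof (rule inj_onI)
    fix R R' assume a: "R \<in> C" "R' \<in> C" "\<tau> \<union> R = \<tau> \<union> R'"
    have "R = (\<tau> \<union> R) \<inter> ?F" using cut[OF CF[OF a(1)]] by simp
    also have "\<dots> = R'" using cut[OF CF[OF a(2)]] a(3) by simp
    finally show "R = R'" .
  qed
  have rig: "rigid W K M (\<tau> \<union> R)" if R: "R \<in> C" for R
    unfolding rigid_def
  proof (intro conjI ballI impI)
    show "\<tau> \<union> R \<subseteq> free_edges K M" using tau(1) sub CF[OF R] by blast
    have fin: "finite (\<tau> \<union> R)" using \<open>\<tau> \<union> R \<subseteq> free_edges K M\<close> finite_subset finite_free by blast
    show "\<phi> = id" if "\<phi> \<in> Stab K" "act \<phi> (\<tau> \<union> R) = \<tau> \<union> R" for \<phi>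
      using key[OF that(1) CF[OF R] CF[OF R] that(2)] C(3)[OF R] by (simp add: rigid_def)
    fix w assume w: "w \<in> K"
    have "1 \<le> incidence (\<tau> \<union> R) w \<and> (w \<in> W \<longrightarrow> 2 \<le> incidence (\<tau> \<union> R) w)"
    proof (cases "w \<in> S")
      case True
      then show ?thesis using inc[OF CF[OF R] C(4)[OF R]] by blast
    next
      case False
      then have "1 \<le> incidence R w \<and> (w \<in> W \<longrightarrow> 2 \<le> incidence R w)"
        using C(3)[OF R] w by (simp add: rigid_def)
      moreover have "incidence R w \<le> incidence (\<tau> \<union> R) w" by (rule incidence_mono[OF _ fin]) simp
      ultimately show ?thesis by linarith
    qed
    then show "1 \<le> incidence (\<tau> \<union> R) w" "w \<in> W \<Longrightarrow> 2 \<le> incidence (\<tau> \<union> R) w" by auto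
  qed
  have eq: "X = X'" if X: "X \<in> (\<lambda>R. \<tau> \<union> R) ` C" "X' \<in> (\<lambda>R. \<tau> \<union> R) ` C" and f: "\<phi> \<in> Stab K" "act \<phi> X = X'" for X X' \<phi>
  proof -
    obtain R R' where R: "R \<in> C" "X = \<tau> \<union> R" "R' \<in> C" "X' = \<tau> \<union> R'" using X by blast
    have "act \<phi> (\<tau> \<union> R) = \<tau> \<union> R'" using f(2) R by simp
    from key[OF f(1) CF[OF R(1)] CF[OF R(3)] this] have "R = R'" using C(5)[OF R(1,3)] by blast
    then show ?thesis using R by simp
  qed
  have "card ((\<lambda>R. \<tau> \<union> R) ` C) = t" using card_image[OF inj] C(2) by simp
  moreover have "\<forall>X\<in>(\<lambda>R. \<tau> \<union> R) ` C. rigid W K M X \<and> P X" using rig P CF C(4) by blast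
  ultimately show ?thesis unfolding many_rigid_def
    by (intro exI[of _ "(\<lambda>R. \<tau> \<union> R) ` C"]) (use eq C(1) in simp)
qed

text \<open>The star from \<open>u\<close> to the orbit of \<open>c\<close> is invariant under
  \<open>Stab K\<close>, so its only red edge, or its only non-red edge, is mapped to
  itself.\<close>

lemma fix_unique_red:
  assumes f: "\<phi> \<in> Stab K" and u: "u \<notin> K" and c: "c \<in> K"
    and star: "star = {{u, y} | y. y \<in> orb K c}"
    and a: "act \<phi> X = X'" "X \<inter> star = \<sigma>" "X' \<inter> star = \<sigma>"
    and s: "\<sigma> = {{u, c}} \<or> \<sigma> = star - {{u, c}}"
  shows "\<phi> c = c"
proof (rule ccontr)
  assume ne: "\<phi> c \<noteq> c"
  have fu: "\<phi> u = u" using Stab_fix[OF f u] .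
  have pc: "\<phi> c \<in> orb K c" using orb_I[OF f] .
  have uc: "{u, c} \<in> star" "{u, \<phi> c} \<in> star" using pc unfolding star by (auto intro: orb_self)
  have ne2: "{u, \<phi> c} \<noteq> {u, c}" using ne u c Stab_in[OF f, of c] by (auto simp: doubleton_eq_iff)
  have im: "\<phi> ` {u, c} = {u, \<phi> c}" using fu by simp
  have inj: "inj \<phi>" using Stab_inj[OF f] .
  show False
    using s
  proof
    assume s: "\<sigma> = {{u, c}}"
    then have "{u, c} \<in> X" using a(2) by blast
    then have "\<phi> ` {u, c} \<in> act \<phi> X" by (rule imageI)
    then have "{u, \<phi> c} \<in> X' \<inter> star" using uc(2) im a(1) by simp
    then have "{u, \<phi> c} \<in> \<sigma>" by (simp only: a(3))
    then show False using s ne2 by simp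
  next
    assume s: "\<sigma> = star - {{u, c}}"
    have "{u, \<phi> c} \<in> \<sigma>" using uc(2) ne2 by (simp only: s Diff_iff singleton_iff simp_thms)
    then have "{u, \<phi> c} \<in> X' \<inter> star" by (simp only: a(3))
    then have "{u, \<phi> c} \<in> act \<phi> X" by (simp only: a(1) Int_iff)
    then obtain e where e: "{u, \<phi> c} = \<phi> ` e" "e \<in> X" by (rule imageE)
    then have "\<phi> ` e = \<phi> ` {u, c}" by (simp only: im)
    then have "e = {u, c}" by (simp only: inj_image_eq_iff[OF inj])
    then have "{u, c} \<in> X \<inter> star" using e(2) uc(1) by (simp only: Int_iff simp_thms)
    then have "{u, c} \<in> \<sigma>" by (simp only: a(2))
    then show False by (simp only: s Diff_iff singleton_iff simp_thms)
  qed
qed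

lemma card_orb_nb:
  assumes "u \<notin> K" "adj u c" "y \<notin> K" "adj u y" "c \<in> K"
  shows "card (orb K c) \<le> k - 1"
proof -
  have "orb K c \<subseteq> nb u - {y}"
    using orb_nb[OF assms(1,2)] orb_sub[OF assms(5)] assms(3) by blast
  then have "card (orb K c) \<le> card (nb u - {y})" by (intro card_mono) auto
  also have "\<dots> = card (nb u) - 1" using assms(4) by (simp add: card_Diff_singleton)
  finally show ?thesis using card_nb_le[of u] by linarith
qed

text \<open>Every other vertex in the orbit of \<open>c\<close> gains one decided edge, but its own
  orbit loses at least \<open>c\<close>; the two changes balance. Where the demand falls to
  \<open>t0 - 1\<close>, both ways of singling out \<open>c\<close> are available and make up for
  the loss later. The edge from \<open>u\<close> to \<open>c\<close> does not meet
  \<open>K - {c}\<close> and need not enter \<open>M'\<close>.\<close>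

lemma state_remove:
  assumes K: "state W K M t0" and u: "u \<notin> K" "adj u c" "y \<notin> K" "adj u y" "\<And>x. x \<in> K \<Longrightarrow> {u, x} \<notin> M"
    and c: "c \<in> K"
    and M': "M' = M \<union> {{u, z} | z. z \<in> orb K c - {c}}"
    and t: "t = (if c \<in> W \<or> orb K c = {c} then t0 else max 1 (t0 - 1))"
  shows "state W (K - {c}) M' t"
proof -
  note s = stateD[OF K]
  let ?H = "K - {c}"
  let ?Y = "orb K c"
  have HK: "?H \<subseteq> K" by blast
  note sH = stateD[OF state_mono[OF K HK]]
  have tt: "1 \<le> t" "t \<le> t0" using t s(6) by (auto simp: max_def)
  have Yu: "?Y \<subseteq> nb u" using orb_nb[OF u(1,2)] .
  have YK: "?Y \<subseteq> K" using orb_sub[OF c] .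
  have finY: "finite ?Y" using finite_orb[OF c s(1)] .
  have cY: "card (?Y - {c}) = card ?Y - 1" using orb_self[of c K] by (rule card_Diff_singleton)
  have Yk: "card ?Y \<le> k - 1" using card_orb_nb[OF u(1-4) c] .
  have finM: "finite M" using s(2) finite_ED by (rule finite_subset)
  have inc: "incidence M' w = incidence M w + (if w \<in> ?Y then 1 else 0)" if w: "w \<in> ?H" for w
  proof (cases "w \<in> ?Y")
    case True
    have "{e \<in> M'. w \<in> e} = insert {u, w} {e \<in> M. w \<in> e}"
      using True w u(1) by (auto simp: M')
    then show ?thesis using True w u(5)[of w] finM by (simp add: incidence_def)
  next
    case False
    have "{e \<in> M'. w \<in> e} = {e \<in> M. w \<in> e}" using False w u(1) by (auto simp: M')
    then show ?thesis using False by (simp add: incidence_def)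
  qed
  have orbH: "orb ?H w \<subseteq> ?Y - {c}" if w: "w \<in> ?H" "w \<in> ?Y" for w
    using orb_mono[OF HK, of w] orb_eq[OF w(2)] orb_sub[OF w(1)] by blast
  have orbHc: "card (orb ?H w) \<le> card ?Y - 1" if w: "w \<in> ?H" "w \<in> ?Y" for w
    using card_mono[OF _ orbH[OF w]] finY cY by simp
  have two: "2 \<le> card ?Y" if w: "w \<in> ?H" "w \<in> ?Y" for w
  proof -
    have "card {c, w} \<le> card ?Y" by (rule card_mono[OF finY]) (use w orb_self in auto)
    then show ?thesis using w(1) by auto
  qed
  have Ycard: "card (orb K w) = card ?Y" if "w \<in> ?Y" for w using orb_eq[OF that] by simp
  have cW: "c \<in> W" if w: "w \<in> ?Y" "w \<in> W" for w
  proof -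
    obtain \<phi> where f: "\<phi> \<in> Stab K" "w = \<phi> c" using w(1) by (rule orbE)
    have "inv \<phi> w \<in> W" by (rule s(5)[OF Stab_inv[OF f(1)] w(2)])
    then show ?thesis using f by simp
  qed
  have cW': "w \<in> W" if w: "w \<in> ?Y" "c \<in> W" for w
  proof -
    obtain \<phi> where f: "\<phi> \<in> Stab K" "w = \<phi> c" using w(1) by (rule orbE)
    then show ?thesis using s(5)[OF f(1) w(2)] by simp
  qed
  show ?thesis
    unfolding state_def
  proof (intro conjI ballI allI impI)
    show "?H \<subseteq> V" using s(1) by blast
    show "M' \<subseteq> ED" using s(2) Yu by (auto simp: M')
    show "\<not> e \<subseteq> ?H" if "e \<in> M'" for e using that s(3)[of e] u(1) by (auto simp: M')
    show "1 \<le> t" using tt by simp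
    show "act \<phi> M' = M'" if f: "\<phi> \<in> Stab ?H" for \<phi>
    proof -
      have fK: "\<phi> \<in> Stab K" using Stab_mono[OF HK f] .
      have fu: "\<phi> u = u" using Stab_fix[OF fK u(1)] .
      have fc: "\<phi> c = c" using Stab_fix[OF f, of c] by simp
      have Y: "\<phi> ` (?Y - {c}) = ?Y - {c}"
        using orb_image[OF fK, of c] Stab_inj[OF fK] fc by (simp add: image_set_diff)
      have M2: "M' = M \<union> (\<lambda>z. {u, z}) ` (?Y - {c})" unfolding M' by blast
      have "act \<phi> ((\<lambda>z. {u, z}) ` (?Y - {c})) = (\<lambda>z. {u, z}) ` \<phi> ` (?Y - {c})"
        by (simp add: image_image fu)
      then show ?thesis by (simp only: M2 image_Un s(4)[OF fK] Y)
    qed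
    show "\<phi> w \<in> W" if "\<phi> \<in> Stab ?H" "w \<in> W" for \<phi> w using s(5)[OF Stab_mono[OF HK that(1)] that(2)] .
  next
    fix w assume w: "w \<in> ?H \<inter> W"
    then have w1: "w \<in> ?H" "w \<in> W" "w \<in> K" by auto
    show "t * card (orb ?H w) \<le> load_bound (incidence M' w)"
    proof (cases "w \<in> ?Y")
      case False
      have "t * card (orb ?H w) \<le> t0 * card (orb ?H w)" using tt(2) by simp
      also have "\<dots> \<le> load_bound (incidence M w)" using sH(7)[OF w1(1,2)] .
      finally show ?thesis using inc[OF w1(1)] False by simp
    next
      case True
      have t0: "t = t0" using t cW[OF True w1(2)] by simp
      have b: "t0 * card ?Y \<le> load_bound (incidence M w)" using s(7)[OF w1(3,2)] Ycard[OF True] by simp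
      have y2: "2 \<le> card ?Y" using two[OF w1(1) True] .
      have "t * card (orb ?H w) \<le> t0 * (card ?Y - 1)"
        using orbHc[OF w1(1) True] t0 by simp
      also have "\<dots> = t0 * card ?Y - t0" by (simp add: diff_mult_distrib2)
      finally have le: "t * card (orb ?H w) \<le> t0 * card ?Y - t0" .
      have q': "incidence M' w = incidence M w + 1" using inc[OF w1(1)] True by simp
      consider "incidence M w = 0" | "incidence M w = 1" | "2 \<le> incidence M w" by linarith
      then show ?thesis
      proof cases
        case 1
        then show ?thesis using le b s(6) q' by (simp add: load_bound_def)
      next
        case 2
        \<comment> \<open>Going from one decided edge to two lowers \<open>load_bound\<close> by 2,
          but the smaller orbit saves only \<open>t0\<close>. For \<open>t0 = 1\<close> the missing
          unit comes from the covering clause with \<open>x = u\<close>.\<close>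
        have "card (orb K w) \<le> k - 2"
          using s(8)[OF w1(3,2) _ _ u(5)[OF w1(3)]] 2 Yu orb_eq[OF True] by simp
        then have "card ?Y - 1 \<le> k - 3" using Ycard[OF True] by simp
        moreover have "t0 * card ?Y - t0 \<le> k - 3" if "2 \<le> t0"
          using b 2 that by (simp add: load_bound_def)
        moreover have "t0 = 1 \<or> 2 \<le> t0" using s(6) by linarith
        ultimately have "t0 * card ?Y - t0 \<le> k - 3" by auto
        then show ?thesis using le q' 2 by (simp add: load_bound_def)
      next
        case 3
        then show ?thesis using le b s(6) q' by (simp add: load_bound_def)
      qed
    qed
    fix x assume i: "incidence M' w \<le> 1" "orb ?H w \<subseteq> nb x" "{x, w} \<notin> M'"
    have i': "incidence M w \<le> 1" "{x, w} \<notin> M" using i inc[OF w1(1)] by (auto simp: M')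
    show "card (orb ?H w) \<le> k - 2"
      using cover_bound_mono[OF w1(1,2) HK K i'(1) i(2) i'(2)] .
  next
    fix w assume w: "w \<in> ?H - W"
    then have w1: "w \<in> ?H" "w \<notin> W" "w \<in> K" by auto
    have I: "card (orb ?H w) + incidence M' w \<le> k - 1" if "1 \<le> incidence M' w"
    proof (cases "w \<in> ?Y")
      case False
      then show ?thesis using sH(10)[OF w1(1,2)] inc[OF w1(1)] that by simp
    next
      case True
      show ?thesis
      proof (cases "1 \<le> incidence M w")
        case True': True
        then show ?thesis
          using s(10)[OF w1(3,2) True'] Ycard[OF True] orbHc[OF w1(1) True] two[OF w1(1) True] inc[OF w1(1)] True
          by simp
      next
        case False
        then show ?thesis
          using Yk orbHc[OF w1(1) True] two[OF w1(1) True] inc[OF w1(1)] True by simp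
      qed
    qed
    then show "card (orb ?H w) + incidence M' w \<le> k - 1" if "1 \<le> incidence M' w" using that .
    show "t + incidence M' w \<le> k"
    proof (cases "w \<in> ?Y")
      case False
      then show ?thesis using s(9)[OF w1(3,2)] inc[OF w1(1)] tt(2) by simp
    next
      case True
      have ne: "c \<notin> W" "?Y \<noteq> {c}" using cW'[OF True] w1(2) True w1(1) by auto
      have t': "t = max 1 (t0 - 1)" using ne t by simp
      have q': "incidence M' w = incidence M w + 1" using inc[OF w1(1)] True by simp
      have "1 \<le> card (orb ?H w)" using card_orb_pos[OF w1(1)] s(1) by blast
      then have "1 + incidence M' w \<le> k - 1" using I q' by simp
      moreover have "t0 + incidence M w \<le> k" using s(9)[OF w1(3,2)] .
      ultimately show ?thesis using t' q' by (simp add: max_def) linarith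
    qed
  qed
qed

text \<open>Once fixed, \<open>c\<close> is the attaching vertex of all components of
  \<open>K - {c}\<close>, with \<open>u\<close> as its neighbour outside. A vertex \<open>c\<close>
  of \<open>W\<close> takes one red edge from \<open>u\<close> and one from a component; therefore
  the second form of \<tau>, in which the edge to \<open>u\<close> is not red, is reserved for
  \<open>c\<close> outside \<open>W\<close>. It also needs a nontrivial orbit, or \<open>u\<close>
  would have no red edge into \<open>K\<close>.\<close>

lemma many_rigid_remove:
  assumes K: "state W K M t0" "conn K" and u: "u \<notin> K" "adj u c" "y \<notin> K" "adj u y" "\<And>x. x \<in> K \<Longrightarrow> {u, x} \<notin> M"
    and c: "c \<in> K" "K \<noteq> {c}"
    and M': "M' = M \<union> {{u, z} | z. z \<in> orb K c - {c}}"
    and t: "t = (if c \<in> W \<or> orb K c = {c} then t0 else max 1 (t0 - 1))"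
    and core: "\<And>J. J \<in> comps (K - {c}) \<Longrightarrow> part_colourable W J M'"
    and star: "star = {{u, z} | z. z \<in> orb K c}"
    and tau: "\<tau> = {{u, c}} \<or> \<tau> = star - {{u, c}} \<and> c \<notin> W \<and> orb K c \<noteq> {c}"
  shows "many_rigid W K M t (\<lambda>R. (\<exists>x\<in>K. {u, x} \<in> R) \<and> R \<inter> star = \<tau>)"
proof -
  let ?H = "K - {c}"
  let ?Y = "orb K c"
  note s = stateD[OF K(1)]
  have st: "state W ?H M' t" using state_remove[OF K(1) u c(1) M' t] .
  note s' = stateD[OF st]
  have Hne: "?H \<noteq> {}" using c by blast
  have Yu: "?Y \<subseteq> nb u" using orb_nb[OF u(1,2)] .
  have YK: "?Y \<subseteq> K" using orb_sub[OF c(1)] .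
  have starF: "star \<subseteq> free_edges K M" using Yu YK u(5) by (auto simp: star free_edges_def)
  have starH: "star \<inter> free_edges ?H M' = {}" using u(1) by (auto simp: star free_edges_def M')
  have tausub: "\<tau> \<subseteq> star" using tau orb_self[of c K] by (auto simp: star)
  have sub: "free_edges ?H M' \<subseteq> free_edges K M" by (auto simp: free_edges_def M')
  have tot: "(\<tau> \<union> R) \<inter> star = \<tau>" if "R \<subseteq> free_edges ?H M'" for R
    using tausub starH that by blast
  have ucs: "{u, c} \<in> star" using orb_self[of c K] by (auto simp: star)
  have fam: "many_rigid W ?H M' t (\<lambda>R. \<forall>J\<in>comps ?H. \<exists>x\<in>J. {c, x} \<in> R)"
  proof (rule many_rigid_comps[OF st Hne core])
    fix J assume J: "J \<in> comps ?H"
    show "c \<notin> ?H" by blast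
    obtain x z where "x \<in> J" "z \<in> {c}" "adj z x" by (rule comp_has_nb[OF K(2) _ _ J]) (use c in auto)
    then show "\<exists>x\<in>J. adj c x" by blast
    show "\<exists>y. y \<notin> ?H \<and> adj c y" using u(1) adj_sym[OF u(2)] by blast
    fix x assume "x \<in> J"
    then have x: "x \<in> K" using comps_sub[OF J] by blast
    then have "{c, x} \<notin> M" using s(3)[of "{c, x}"] c by blast
    moreover have "{c, x} \<noteq> {u, z}" for z using x c(1) u(1) by (auto simp: doubleton_eq_iff)
    ultimately show "{c, x} \<notin> M'" by (auto simp: M')
  qed
  show ?thesis
  proof (rule many_rigid_extend[OF fam _ s'(4) _ _ sub])
    show "{c} \<subseteq> K" using c by blast
    show "\<tau> \<subseteq> free_edges K M" using tausub starF by blast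
    show "\<tau> \<inter> free_edges ?H M' = {}" using tausub starH by blast
    fix \<phi> R R' z
    assume a: "\<phi> \<in> Stab K" "R \<subseteq> free_edges ?H M'" "R' \<subseteq> free_edges ?H M'" "act \<phi> (\<tau> \<union> R) = \<tau> \<union> R'" "z \<in> {c}"
    have "\<phi> c = c"
      by (rule fix_unique_red[OF a(1) u(1) c(1) star a(4) tot[OF a(2)] tot[OF a(3)]]) (use tau in blast)
    then show "\<phi> z = z" using a(5) by simp
  next
    fix R z assume R: "R \<subseteq> free_edges ?H M'" "\<forall>J\<in>comps ?H. \<exists>x\<in>J. {c, x} \<in> R" and z: "z \<in> {c}"
    have fin: "finite (\<tau> \<union> R)"
      using tausub starF sub R(1) by (meson finite_free finite_subset finite_Un)
    obtain h where "h \<in> ?H" using Hne by blast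
    then have "comp ?H h \<in> comps ?H" by (rule comp_in_comps)
    then obtain x where x: "x \<in> comp ?H h" "{c, x} \<in> R" using R(2) by blast
    have xK: "x \<in> K" using x(1) by (simp add: comp_def)
    have one: "1 \<le> incidence (\<tau> \<union> R) c" by (rule incidence_ge1[OF fin, of "{c, x}"]) (use x in auto)
    have two: "2 \<le> incidence (\<tau> \<union> R) c" if "c \<in> W"
    proof (rule incidence_ge2[OF fin])
      show "{c, x} \<in> \<tau> \<union> R" "c \<in> {c, x}" "c \<in> {u, c}" using x by auto
      show "{u, c} \<in> \<tau> \<union> R" using tau that by auto
      show "{c, x} \<noteq> {u, c}" using xK u(1) by (auto simp: doubleton_eq_iff)
    qed
    show "1 \<le> incidence (\<tau> \<union> R) z \<and> (z \<in> W \<longrightarrow> 2 \<le> incidence (\<tau> \<union> R) z)"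
      using one two z by simp
  next
    fix R assume R: "R \<subseteq> free_edges ?H M'"
    have "\<exists>x\<in>K. {u, x} \<in> \<tau>"
      using tau
    proof
      assume "\<tau> = {{u, c}}"
      then show ?thesis using c(1) by blast
    next
      assume a: "\<tau> = star - {{u, c}} \<and> c \<notin> W \<and> orb K c \<noteq> {c}"
      then obtain z where z: "z \<in> ?Y" "z \<noteq> c" using orb_self[of c K] by blast
      then have "{u, z} \<in> star" "{u, z} \<noteq> {u, c}" by (auto simp: star doubleton_eq_iff)
      then show ?thesis using a z(1) YK by blast
    qed
    then show "(\<exists>x\<in>K. {u, x} \<in> \<tau> \<union> R) \<and> (\<tau> \<union> R) \<inter> star = \<tau>" using tot[OF R] by blast
  qed
qed

section \<open>Parts with one or two vertices\<close>

lemma many_rigidI: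
  assumes fin: "finite C" and t: "t \<le> card C"
    and sub: "\<And>R. R \<in> C \<Longrightarrow> R \<subseteq> free_edges K M"
    and inc: "\<And>R w. R \<in> C \<Longrightarrow> w \<in> K \<Longrightarrow> 1 \<le> incidence R w \<and> (w \<in> W \<longrightarrow> 2 \<le> incidence R w)"
    and P: "\<And>R. R \<in> C \<Longrightarrow> P R"
    and triv: "\<And>\<phi> R R'. R \<in> C \<Longrightarrow> R' \<in> C \<Longrightarrow> \<phi> \<in> Stab K \<Longrightarrow> act \<phi> R = R' \<Longrightarrow> \<phi> = id"
  shows "many_rigid W K M t P"
proof -
  have rig: "rigid W K M R \<and> P R" if "R \<in> C" for R
    unfolding rigid_def using sub[OF that] inc[OF that] P[OF that] triv[OF that that] by simp
  have eq: "R = R'" if "R \<in> C" "R' \<in> C" "\<phi> \<in> Stab K" "act \<phi> R = R'" for R R' \<phi>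
    using triv[OF that] that(4) by simp
  have "many_rigid W K M (card C) P"
    unfolding many_rigid_def by (intro exI[of _ C]) (use fin rig eq in simp)
  then show ?thesis by (rule many_rigid_weaken[OF _ t])
qed

lemma card_edges_at_minus:
  assumes "M \<subseteq> ED" "w \<in> V" "A \<subseteq> {e \<in> ED. w \<in> e}" "A \<inter> M = {}"
  shows "card ({e \<in> ED. w \<in> e} - M - A) = k - incidence M w - card A"
proof -
  have 1: "{e \<in> ED. w \<in> e} - M - A = ({e \<in> ED. w \<in> e} - {e \<in> M. w \<in> e}) - A" by blast
  have fin: "finite {e \<in> ED. w \<in> e}" by simp
  have "card ({e \<in> ED. w \<in> e} - {e \<in> M. w \<in> e}) = k - incidence M w"
    using assms(1) card_edges_at[OF assms(2)] fin
    by (subst card_Diff_subset) (auto simp: incidence_def intro: finite_subset[OF _ fin])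
  moreover have "A \<subseteq> {e \<in> ED. w \<in> e} - {e \<in> M. w \<in> e}" using assms(3,4) by blast
  ultimately show ?thesis unfolding 1
    by (subst card_Diff_subset) (auto intro: finite_subset[OF assms(3) fin])
qed

lemma Suc_le_two_power: "n + 1 \<le> 2 ^ n" for n :: nat
  by (induction n) auto

lemma add_two_le_two_power: "2 \<le> n \<Longrightarrow> n + 2 \<le> 2 ^ n" for n :: nat
  by (induction n rule: nat_induct_at_least) auto

text \<open>\<open>Stab {c}\<close> is trivial, so only the number of colourings matters. The edge
  to \<open>u\<close> is red and the other free edges are arbitrary, except that one of them must be
  red if \<open>c\<close> is in \<open>W\<close>.\<close>

lemma many_rigid_singleton:
  assumes K: "state W {c} M t" and u: "u \<noteq> c" "adj u c" "{u, c} \<notin> M"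
  shows "many_rigid W {c} M t (\<lambda>R. \<exists>x\<in>{c}. {u, x} \<in> R)"
proof -
  note s = stateD[OF K]
  have cV: "c \<in> V" using s(1) by simp
  define F where "F = {e \<in> ED. c \<in> e} - M - {{u, c}}"
  define N where "N = Pow F - (if c \<in> W then {{}} else {})"
  define C where "C = insert {u, c} ` N"
  have finF: "finite F" by (simp add: F_def)
  have cF: "card F = k - incidence M c - 1"
    unfolding F_def using card_edges_at_minus[OF s(2) cV, of "{{u, c}}"] u by simp
  have o1: "1 \<le> card (orb {c} c)" using card_orb_pos[of c "{c}"] s(1) by simp
  have "t \<le> t * card (orb {c} c)" using o1 by simp
  have "t \<le> card N"
  proof (cases "c \<in> W")
    case True
    have "t \<le> load_bound (incidence M c)" using order_trans[OF \<open>t \<le> t * card (orb {c} c)\<close>] s(7)[of c] True by simp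
    have "load_bound (incidence M c) + 1 \<le> 2 ^ card F"
    proof (cases "incidence M c \<le> 1")
      case le: True
      then have "k - 2 \<le> card F" using cF by simp
      then have p: "2 ^ (k - 2) \<le> (2::nat) ^ card F" by (rule power_increasing) simp
      have "k - 2 + 2 \<le> 2 ^ (k - 2)" by (rule add_two_le_two_power) (use k5 in simp)
      then have "k - 2 + 2 \<le> 2 ^ card F" using p by (rule order_trans)
      then show ?thesis using le k5 by (simp add: load_bound_def)
    next
      case False
      then have "load_bound (incidence M c) = card F" using cF by (simp add: load_bound_def)
      then show ?thesis using Suc_le_two_power[of "card F"] by simp
    qed
    moreover have "card N = 2 ^ card F - 1"
      using True finF by (simp add: N_def card_Pow card_Diff_singleton)
    ultimately show ?thesis using \<open>t \<le> load_bound (incidence M c)\<close> by simp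
  next
    case False
    then have "t + incidence M c \<le> k" using s(9)[of c] by simp
    then have "t \<le> card F + 1" using cF by simp
    moreover have "card N = 2 ^ card F" using False finF by (simp add: N_def card_Pow)
    ultimately show ?thesis using Suc_le_two_power[of "card F"] by simp
  qed
  moreover have "inj_on (insert {u, c}) N"
  proof (rule inj_onI)
    fix A B assume a: "A \<in> N" "B \<in> N" "insert {u, c} A = insert {u, c} B"
    then have "{u, c} \<notin> A" "{u, c} \<notin> B" by (auto simp: N_def F_def)
    then show "A = B" using a(3) by (simp add: insert_ident)
  qed
  ultimately have tC: "t \<le> card C" by (simp add: C_def card_image)
  have ucE: "{u, c} \<in> free_edges {c} M" using u by (simp add: free_edges_def)
  have FE: "F \<subseteq> free_edges {c} M" by (auto simp: F_def free_edges_def)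
  show ?thesis
  proof (rule many_rigidI[OF _ tC])
    show "finite C" using finF by (simp add: C_def N_def)
    fix R assume "R \<in> C"
    then obtain T where T: "T \<in> N" "R = insert {u, c} T" by (auto simp: C_def)
    then have TF: "T \<subseteq> F" by (auto simp: N_def)
    show RF: "R \<subseteq> free_edges {c} M" using T TF ucE FE by blast
    show "\<exists>x\<in>{c}. {u, x} \<in> R" using T by simp
    have finR: "finite R" using RF finite_free by (rule finite_subset)
    fix w assume "w \<in> {c}"
    then have w: "w = c" by simp
    have "1 \<le> incidence R c" by (rule incidence_ge1[OF finR, of "{u, c}"]) (use T in auto)
    moreover have "2 \<le> incidence R c" if cW: "c \<in> W"
    proof -
      obtain e where e: "e \<in> T" using T(1) cW by (auto simp: N_def)
      then have "c \<in> e" "e \<noteq> {u, c}" using TF by (auto simp: F_def)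
      then show ?thesis using incidence_ge2[OF finR, of "{u, c}" c e] e T by auto
    qed
    ultimately show "1 \<le> incidence R w \<and> (w \<in> W \<longrightarrow> 2 \<le> incidence R w)" using w by simp
  next
    fix \<phi> :: "'a \<Rightarrow> 'a" and R R' assume f: "\<phi> \<in> Stab {c}"
    have "\<phi> x = x" for x
      using Stab_fix[OF f, of x] Stab_in[OF f, of c] by (cases "x = c") simp_all
    then show "\<phi> = id" by (intro ext) simp
  qed
qed

text \<open>Red \<open>{u, c}\<close> with non-red \<open>{u, w}\<close> breaks the symmetry, and
  red \<open>{c, w}\<close> serves both vertices. The demand \<open>t\<close> may exceed the number
  of remaining free edges at \<open>c\<close> by two, which is too much for their subsets if there
  is only one such edge; so one free edge \<open>f\<close> at \<open>w\<close> is left variable as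
  well.\<close>

lemma many_rigid_pair:
  assumes K: "state W {c, w} M t" and ne: "c \<noteq> w" "adj c w" and cW: "c \<notin> W"
    and orb: "orb {c, w} c = {c, w}"
    and u: "u \<notin> {c, w}" "adj u c" "adj u w" "{u, c} \<notin> M" "{u, w} \<notin> M"
  shows "many_rigid W {c, w} M t (\<lambda>R. \<exists>x\<in>{c, w}. {u, x} \<in> R)"
proof -
  note s = stateD[OF K]
  have V: "c \<in> V" "w \<in> V" using s(1) by auto
  have wW: "w \<notin> W"
  proof
    assume "w \<in> W"
    have "w \<in> orb {c, w} c" using orb by simp
    then obtain \<phi> where f: "\<phi> \<in> Stab {c, w}" "w = \<phi> c" by (rule orbE)
    have "inv \<phi> w \<in> W" by (rule s(5)[OF Stab_inv[OF f(1)] \<open>w \<in> W\<close>])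
    then show False using f cW by simp
  qed
  have cwM: "{c, w} \<notin> M" using s(3)[of "{c, w}"] by blast
  have orbw: "orb {c, w} w = {c, w}" using orb_eq[of w "{c, w}" c] orb by simp
  have three: "incidence M x + 3 \<le> k" if x: "x \<in> {c, w}" for x
  proof (cases "1 \<le> incidence M x")
    case True
    have "card (orb {c, w} x) = 2" using x orb orbw ne by auto
    moreover have "x \<notin> W" using x cW wW by blast
    ultimately show ?thesis using s(10)[OF x _ True] k5 by simp
  qed (use k5 in simp)
  define F where "F = {e \<in> ED. c \<in> e} - M - {{u, c}, {c, w}}"
  have dis: "{u, c} \<noteq> {c, w}" "{u, w} \<noteq> {c, w}" "{u, c} \<noteq> {u, w}" using u(1) ne by (auto simp: doubleton_eq_iff)
  have cF: "card F = k - incidence M c - 2"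
    unfolding F_def using card_edges_at_minus[OF s(2) V(1), of "{{u, c}, {c, w}}"] u ne cwM dis by simp
  have "card ({e \<in> ED. w \<in> e} - M - {{u, w}, {c, w}}) = k - incidence M w - 2"
    using card_edges_at_minus[OF s(2) V(2), of "{{u, w}, {c, w}}"] u ne cwM dis by simp
  then have "card ({e \<in> ED. w \<in> e} - M - {{u, w}, {c, w}}) \<noteq> 0" using three[of w] by simp
  then have "{e \<in> ED. w \<in> e} - M - {{u, w}, {c, w}} \<noteq> {}" by (metis card.empty)
  then obtain f where f: "f \<in> ED" "w \<in> f" "f \<notin> M" "f \<noteq> {u, w}" "f \<noteq> {c, w}" by blast
  obtain z where z: "f = {w, z}" "adj w z" using edge_at[OF f(1,2)] .
  have cf: "c \<notin> f" using z f(5) ne by auto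
  have fF: "f \<notin> F" using cf by (auto simp: F_def)
  define G where "G = insert f F"
  have finG: "finite G" by (simp add: G_def F_def)
  have cG: "card G = k - incidence M c - 1"
    using fF cF three[of c] by (simp add: G_def F_def)
  define C where "C = (\<union>) {{u, c}, {c, w}} ` Pow G"
  have GG: "{u, c} \<notin> G" "{c, w} \<notin> G" "{u, w} \<notin> G"
    using f cf dis u(1) ne by (auto simp: G_def F_def)
  have "inj_on ((\<union>) {{u, c}, {c, w}}) (Pow G)"
  proof (rule inj_onI)
    fix A B assume a: "A \<in> Pow G" "B \<in> Pow G" "{{u, c}, {c, w}} \<union> A = {{u, c}, {c, w}} \<union> B"
    then have "A \<inter> {{u, c}, {c, w}} = {}" "B \<inter> {{u, c}, {c, w}} = {}" using GG by auto
    then show "A = B" using a(3) by blast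
  qed
  then have "card C = 2 ^ card G" unfolding C_def by (simp only: card_image card_Pow[OF finG])
  moreover have "t \<le> card G + 1" using s(9)[of c] cW cG three[of c] by simp
  ultimately have tC: "t \<le> card C" using Suc_le_two_power[of "card G"] by simp
  have GE: "G \<subseteq> free_edges {c, w} M" using f by (auto simp: G_def F_def free_edges_def)
  define star where "star = {{u, y} | y. y \<in> orb {c, w} c}"
  have star: "star = {{u, c}, {u, w}}" using orb by (auto simp: star_def)
  show ?thesis
  proof (rule many_rigidI[OF _ tC])
    show "finite C" using finG by (simp add: C_def)
    fix R assume "R \<in> C"
    then obtain T where T: "T \<subseteq> G" "R = {{u, c}, {c, w}} \<union> T" by (auto simp: C_def)
    show RF: "R \<subseteq> free_edges {c, w} M"
      using T GE u ne cwM by (auto simp: free_edges_def)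
    show "\<exists>x\<in>{c, w}. {u, x} \<in> R" using T by blast
    have finR: "finite R" using RF finite_free by (rule finite_subset)
    fix x assume "x \<in> {c, w}"
    then have "x \<in> {c, w}" "{c, w} \<in> R" "x \<notin> W" using T cW wW by auto
    then show "1 \<le> incidence R x \<and> (x \<in> W \<longrightarrow> 2 \<le> incidence R x)"
      using incidence_ge1[OF finR, of "{c, w}" x] by blast
  next
    fix \<phi> R R' assume a: "R \<in> C" "R' \<in> C" and f: "\<phi> \<in> Stab {c, w}" "act \<phi> R = R'"
    have cut: "X \<inter> star = {{u, c}}" if "X \<in> C" for X
      using that GG dis by (auto simp: C_def star)
    have fc: "\<phi> c = c"
      by (rule fix_unique_red[OF f(1) u(1) _ star_def f(2) cut[OF a(1)] cut[OF a(2)]]) auto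
    have fw: "\<phi> w = w" using Stab_in[OF f(1), of w] Stab_eq[OF f(1), of w c] fc ne by auto
    have "\<phi> x = x" for x using Stab_fix[OF f(1), of x] fc fw by blast
    then show "\<phi> = id" by (intro ext) simp
  qed
qed

section \<open>Connected parts\<close>

text \<open>In an orbit of two, the two ways to single out \<open>c\<close> are exchanged by an
  automorphism that swaps \<open>c\<close> and \<open>w\<close>, so they cannot be combined.
  Instead, fixing \<open>c\<close> fixes \<open>w\<close> at the same time: both are deleted, no
  edge of the rest becomes decided, and the demand stays \<open>t\<close>.\<close>

lemma many_rigid_orbit_of_two:
  assumes K: "state W K M t" "conn K" and u: "u \<notin> K" "adj u c" "\<And>x. x \<in> K \<Longrightarrow> {u, x} \<notin> M"
    and c: "c \<in> K" "c \<notin> W" and orb: "orb K c = {c, w}" "w \<noteq> c" and ne: "K - {c, w} \<noteq> {}"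
    and core: "\<And>J. J \<in> comps (K - {c, w}) \<Longrightarrow> part_colourable W J M"
  shows "many_rigid W K M t (\<lambda>R. \<exists>x\<in>K. {u, x} \<in> R)"
proof -
  let ?H = "K - {c, w}"
  \<comment> \<open>Components are attached to \<open>w\<close> whenever possible, because the edge
    from \<open>u\<close> to \<open>w\<close> is not red and \<open>w\<close> has to get its red
    edge from a component.\<close>
  define p where "p J = (if \<exists>x\<in>J. adj w x then w else c)" for J
  note s = stateD[OF K(1)]
  have wK: "w \<in> K" using orb orb_sub[OF c(1)] by blast
  have st: "state W ?H M t" using state_mono[OF K(1)] by blast
  note s' = stateD[OF st]
  obtain \<sigma> where f: "\<sigma> \<in> Stab K" "w = \<sigma> c" using orb(1) by (metis insertCI orbE)
  have uw: "adj u w" using orb_nb[OF u(1,2)] orb(1) by auto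
  have wW: "w \<notin> W"
  proof
    assume "w \<in> W"
    then have "inv \<sigma> w \<in> W" by (rule s(5)[OF Stab_inv[OF f(1)]])
    then show False using f c(2) by simp
  qed
  \<comment> \<open>If a component touches only \<open>c\<close>, an automorphism that takes
    \<open>c\<close> to \<open>w\<close> provides a neighbour of \<open>w\<close>.\<close>
  have adjS: "\<exists>x\<in>?H. adj w x"
  proof -
    obtain h where h: "h \<in> ?H" using ne by blast
    obtain x z where xz: "x \<in> comp ?H h" "z \<in> {c, w}" "adj z x"
      by (rule comp_has_nb[OF K(2) _ _ comp_in_comps[OF h]]) (use c wK in auto)
    have x: "x \<in> ?H" using xz(1) by (simp add: comp_def)
    show ?thesis
    proof (cases "z = w")
      case True
      then show ?thesis using x xz by blast
    next
      case False
      then have "adj c x" using xz by blast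
      then have "adj w (\<sigma> x)" using Stab_adj[OF f(1), of c x] f(2) by simp
      moreover have "\<sigma> x \<in> K" using Stab_in[OF f(1)] x by blast
      moreover have "\<sigma> x \<notin> {c, w}"
      proof
        assume a: "\<sigma> x \<in> {c, w}"
        have "\<sigma> ` {c, w} = {c, w}" using orb_image[OF f(1), of c] orb(1) by simp
        then obtain z where "z \<in> {c, w}" "\<sigma> x = \<sigma> z" using a by (metis imageE)
        then show False using Stab_eq[OF f(1)] x by simp
      qed
      ultimately show ?thesis by blast
    qed
  qed
  define star where "star = {{u, z} | z. z \<in> orb K c}"
  have star: "star = {{u, c}, {u, w}}" using orb by (auto simp: star_def)
  have starH: "star \<inter> free_edges ?H M = {}" using u(1) by (auto simp: star free_edges_def)
  have dis: "{u, c} \<noteq> {u, w}" using orb(2) u(1) wK by (auto simp: doubleton_eq_iff)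
  have ucF: "{u, c} \<in> free_edges K M" using u c by (simp add: free_edges_def)
  have sub: "free_edges ?H M \<subseteq> free_edges K M" by (auto simp: free_edges_def)
  have tot: "({{u, c}} \<union> R) \<inter> star = {{u, c}}" if "R \<subseteq> free_edges ?H M" for R
    using starH that by (auto simp: star)
  have pS: "p J \<in> {c, w}" for J by (simp add: p_def)
  have fam: "many_rigid W ?H M t (\<lambda>R. \<forall>J\<in>comps ?H. \<exists>x\<in>J. {p J, x} \<in> R)"
  proof (rule many_rigid_comps[OF st ne core])
    fix J assume J: "J \<in> comps ?H"
    show "p J \<notin> ?H" using pS by blast
    obtain x z where "x \<in> J" "z \<in> {c, w}" "adj z x"
      by (rule comp_has_nb[OF K(2) _ _ J]) (use c wK in auto)
    then show "\<exists>x\<in>J. adj (p J) x" by (auto simp: p_def)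
    have "adj (p J) u" using pS[of J] adj_sym[OF u(2)] adj_sym[OF uw] by auto
    then show "\<exists>y. y \<notin> ?H \<and> adj (p J) y" using u(1) by blast
    fix x assume "x \<in> J"
    then have "x \<in> K" using comps_sub[OF J] by blast
    moreover have "p J \<in> K" using pS[of J] c wK by auto
    ultimately show "{p J, x} \<notin> M" using s(3)[of "{p J, x}"] by blast
  qed
  show ?thesis
  proof (rule many_rigid_extend[OF fam _ s'(4) _ _ sub, where \<tau> = "{{u, c}}"])
    show "{c, w} \<subseteq> K" using c wK by blast
    show "{{u, c}} \<subseteq> free_edges K M" using ucF by blast
    show "{{u, c}} \<inter> free_edges ?H M = {}" using starH star by blast
    fix \<phi> R R' z
    assume a: "\<phi> \<in> Stab K" "R \<subseteq> free_edges ?H M" "R' \<subseteq> free_edges ?H M"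
      "act \<phi> ({{u, c}} \<union> R) = {{u, c}} \<union> R'" "z \<in> {c, w}"
    have fc: "\<phi> c = c"
      by (rule fix_unique_red[OF a(1) u(1) c(1) star_def a(4) tot[OF a(2)] tot[OF a(3)]]) simp
    have "\<phi> w \<in> {c, w}" using orb_image[OF a(1), of c] orb(1) by auto
    then have "\<phi> w = w" using Stab_eq[OF a(1), of w c] fc orb(2) by auto
    then show "\<phi> z = z" using a(5) fc by auto
  next
    fix R z assume R: "R \<subseteq> free_edges ?H M" "\<forall>J\<in>comps ?H. \<exists>x\<in>J. {p J, x} \<in> R" and z: "z \<in> {c, w}"
    have fin: "finite ({{u, c}} \<union> R)"
      using sub R(1) by (meson finite.emptyI finite_insert finite_free finite_subset finite_Un)
    have "1 \<le> incidence ({{u, c}} \<union> R) c" by (rule incidence_ge1[OF fin, of "{u, c}"]) auto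
    moreover have "1 \<le> incidence ({{u, c}} \<union> R) w"
    proof -
      obtain h where h: "h \<in> ?H" "adj w h" using adjS by blast
      have J: "comp ?H h \<in> comps ?H" "h \<in> comp ?H h" using comp_in_comps[OF h(1)] comp_self[OF h(1)] .
      then have "p (comp ?H h) = w" using h(2) unfolding p_def by (metis (full_types))
      then obtain x where "{w, x} \<in> R" using R(2) J(1) by metis
      then show ?thesis using incidence_ge1[OF fin, of "{w, x}" w] by blast
    qed
    ultimately show "1 \<le> incidence ({{u, c}} \<union> R) z \<and> (z \<in> W \<longrightarrow> 2 \<le> incidence ({{u, c}} \<union> R) z)"
      using z c(2) wW by auto
  next
    fix R
    show "\<exists>x\<in>K. {u, x} \<in> {{u, c}} \<union> R" using c(1) by blast
  qed
qed

text \<open>With at least three edges in the star, one red edge and all but one red are inequivalent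
  patterns. Two families of \<open>max 1 (t - 1)\<close> colourings have together at least
  \<open>t\<close> members.\<close>

lemma many_rigid_big_orbit:
  assumes K: "state W K M t" "conn K" and u: "u \<notin> K" "adj u c" "y \<notin> K" "adj u y" "\<And>x. x \<in> K \<Longrightarrow> {u, x} \<notin> M"
    and c: "c \<in> K" "K \<noteq> {c}" "c \<notin> W" and Y3: "3 \<le> card (orb K c)"
    and core: "\<And>J M'. J \<in> comps (K - {c}) \<Longrightarrow> part_colourable W J M'"
  shows "many_rigid W K M t (\<lambda>R. \<exists>x\<in>K. {u, x} \<in> R)"
proof -
  let ?Y = "orb K c"
  define star where "star = {{u, z} | z. z \<in> ?Y}"
  have Yc: "?Y \<noteq> {c}" using Y3 by auto
  have YK: "?Y \<subseteq> K" using orb_sub[OF c(1)] .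
  have cY: "c \<in> ?Y" by simp
  define t' where "t' = (if c \<in> W \<or> ?Y = {c} then t else max 1 (t - 1))"
  have 1: "many_rigid W K M t' (\<lambda>R. (\<exists>x\<in>K. {u, x} \<in> R) \<and> R \<inter> star = {{u, c}})"
    by (rule many_rigid_remove[OF K u c(1,2) refl t'_def core star_def disjI1[OF refl]])
  have tau: "star - {{u, c}} = star - {{u, c}} \<and> c \<notin> W \<and> ?Y \<noteq> {c}" using c(3) Yc by blast
  have 2: "many_rigid W K M t' (\<lambda>R. (\<exists>x\<in>K. {u, x} \<in> R) \<and> R \<inter> star = star - {{u, c}})"
    by (rule many_rigid_remove[OF K u c(1,2) refl t'_def core star_def disjI2[OF tau]])
  have st: "star = (\<lambda>z. {u, z}) ` ?Y" by (auto simp: star_def)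
  have "inj_on (\<lambda>z. {u, z}) ?Y" by (rule inj_onI) (use u(1) YK in \<open>auto simp: doubleton_eq_iff\<close>)
  then have cs: "card star = card ?Y" unfolding st by (rule card_image)
  have uc: "{u, c} \<in> star" using cY by (auto simp: star_def)
  have cs1: "card (star - {{u, c}}) = card ?Y - 1" using uc cs by (simp add: card_Diff_singleton)
  have mv: "card (R \<inter> star) = card (R' \<inter> star)" if f: "\<phi> \<in> Stab K" "act \<phi> R = R'" for \<phi> R R'
  proof -
    have inj: "inj ((`) \<phi>)" by (rule injI) (use Stab_inj[OF f(1)] in \<open>simp add: inj_image_eq_iff\<close>)
    have "act \<phi> star = (\<lambda>z. {u, z}) ` \<phi> ` ?Y"
      unfolding st using Stab_fix[OF f(1) u(1)] by (simp add: image_image)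
    then have "act \<phi> star = star" using orb_image[OF f(1)] st by simp
    then have "act \<phi> (R \<inter> star) = R' \<inter> star" using image_Int[OF inj] f(2) by simp
    moreover have "card (act \<phi> (R \<inter> star)) = card (R \<inter> star)"
      by (rule card_image) (use inj in \<open>meson inj_on_subset subset_UNIV\<close>)
    ultimately show ?thesis by simp
  qed
  have "many_rigid W K M (t' + t') (\<lambda>R. \<exists>x\<in>K. {u, x} \<in> R)"
  proof (rule many_rigid_union[OF 1 2])
    fix \<phi> R R' assume f: "\<phi> \<in> Stab K" and R: "(\<exists>x\<in>K. {u, x} \<in> R) \<and> R \<inter> star = {{u, c}}"
      "(\<exists>x\<in>K. {u, x} \<in> R') \<and> R' \<inter> star = star - {{u, c}}"
    have "card (R \<inter> star) \<noteq> card (R' \<inter> star)" using R cs1 Y3 by simp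
    then show "act \<phi> R \<noteq> R' \<and> act \<phi> R' \<noteq> R" using mv[OF f] by metis
  qed auto
  then show ?thesis
    by (rule many_rigid_weaken) (use c(3) Yc stateD(6)[OF K(1)] in \<open>auto simp: t'_def max_def\<close>)
qed

text \<open>The case split follows what deleting \<open>c\<close> costs: nothing for
  \<open>c\<close> in \<open>W\<close> or a trivial orbit, and otherwise one unit of demand, avoided
  for an orbit of two by deleting it whole and regained for a larger one by colouring the star in
  two ways.\<close>

theorem part_colourable_all: "part_colourable W K M"
proof (induction "card K" arbitrary: K M rule: less_induct)
  case (less K M)
  show ?case
    unfolding part_colourable_def
  proof (intro allI impI)
    fix u t assume K: "state W K M t" "conn K" and uK: "u \<notin> K" and ex: "\<exists>x\<in>K. adj u x"
      and ey: "\<exists>y. y \<notin> K \<and> adj u y" and fr: "\<forall>x\<in>K. {u, x} \<notin> M"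
    note s = stateD[OF K(1)]
    obtain c where c: "c \<in> K" "adj u c" using ex by blast
    obtain y where y: "y \<notin> K" "adj u y" using ey by blast
    have frx: "\<And>x. x \<in> K \<Longrightarrow> {u, x} \<notin> M" using fr by blast
    have finK: "finite K" using s(1) finite_V by (rule finite_subset)
    have IH: "part_colourable W J M'" if "S \<subseteq> K" "S \<noteq> {}" "J \<in> comps (K - S)" for J S M'
    proof (rule less)
      have "J \<subset> K" using comps_sub[OF that(3)] that(1,2) by blast
      then show "card J < card K" by (rule psubset_card_mono[OF finK])
    qed
    let ?Y = "orb K c"
    define star where "star = {{u, z} | z. z \<in> ?Y}"
    have IHc: "\<And>J M'. J \<in> comps (K - {c}) \<Longrightarrow> part_colourable W J M'" using IH[of "{c}"] c by blast
    have cY: "c \<in> ?Y" by simp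
    have YK: "?Y \<subseteq> K" using orb_sub[OF c(1)] .
    have finY: "finite ?Y" using finite_orb[OF c(1) s(1)] .
    show "many_rigid W K M t (\<lambda>R. \<exists>x\<in>K. {u, x} \<in> R)"
    proof (cases "K = {c}")
      case True
      have "u \<noteq> c" "{u, c} \<notin> M" using uK c(1) frx by auto
      with K(1) c(2) show ?thesis unfolding True by (intro many_rigid_singleton)
    next
      case K1: False
      show ?thesis
      proof (cases "c \<in> W \<or> ?Y = {c}")
        case True
        then have t: "t = (if c \<in> W \<or> ?Y = {c} then t else max 1 (t - 1))" by simp
        have "many_rigid W K M t (\<lambda>R. (\<exists>x\<in>K. {u, x} \<in> R) \<and> R \<inter> star = {{u, c}})"
          by (rule many_rigid_remove[OF K uK c(2) y frx c(1) K1 refl t IHc star_def disjI1[OF refl]])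
        then show ?thesis by (rule many_rigid_weaken) auto
      next
        case False
        have Y2: "2 \<le> card ?Y"
        proof -
          obtain w where "w \<in> ?Y" "w \<noteq> c" using False cY by blast
          then have "card {c, w} \<le> card ?Y" by (intro card_mono[OF finY]) auto
          then show ?thesis using \<open>w \<noteq> c\<close> by simp
        qed
        show ?thesis
        proof (cases "card ?Y = 2")
          case True
          then have "card (?Y - {c}) = 1" using cY by (simp add: card_Diff_singleton)
          then obtain w where w0: "?Y - {c} = {w}" by (rule card_1_singletonE)
          then have w: "?Y = {c, w}" "w \<noteq> c" using cY by blast+
          show ?thesis
          proof (cases "K - {c, w} = {}")
            case True
            then have Kcw: "K = {c, w}" using c(1) YK w by blast
            have "adj c w"
            proof (rule ccontr)
              assume "\<not> adj c w"
              then have "{c} = K" using Kcw by (intro conn_closed[OF K(2)]) auto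
              then show False using K1 by simp
            qed
            moreover have "adj u w" using orb_nb[OF uK c(2)] w(1) by auto
            ultimately show ?thesis
              using many_rigid_pair[of W c w M t u] K(1) w False uK c(2) frx unfolding Kcw by simp
          next
            case ne: False
            have "\<And>J. J \<in> comps (K - {c, w}) \<Longrightarrow> part_colourable W J M" using IH[of "{c, w}"] YK w by blast
            with many_rigid_orbit_of_two[OF K uK c(2) frx c(1) _ w ne] False show ?thesis by blast
          qed
        next
          case card: False
          then have "3 \<le> card ?Y" using Y2 by linarith
          with many_rigid_big_orbit[OF K uK c(2) y frx c(1) K1 _ _ IHc] False show ?thesis by blast
        qed
      qed
    qed
  qed
qed

section \<open>Colourings from a root\<close>

lemma incidence_Stab:
  assumes "\<phi> \<in> Stab K" "act \<phi> R = R" shows "incidence R (\<phi> w) = incidence R w"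
  using incidence_act[OF Stab_inj[OF assms(1)], of R w] assms(2) by simp

context
  fixes v0 v1 v2 :: 'a and W H M
  assumes v: "adj v0 v1" "adj v1 v2" "v2 \<noteq> v0"
    and W: "W = nb v0 - {v1}" and H: "H = V - {v0, v1, v2}"
    and M: "M = {e \<in> ED. v0 \<in> e \<or> v1 \<in> e}"
begin

lemma root_distinct: "v0 \<noteq> v1" "v1 \<noteq> v2" "v0 \<in> V" "v1 \<in> V" "v2 \<in> V"
  using v adj_V adj_V2 adj_irrefl by blast+

lemma root_edges_at:
  assumes "w \<in> H"
  shows "{e \<in> M. w \<in> e} = (\<lambda>y. {w, y}) ` ({v0, v1} \<inter> nb w)"
proof -
  have "w \<noteq> v0" "w \<noteq> v1" using assms H by auto
  then have "{e \<in> M. w \<in> e} = {e \<in> {e \<in> ED. w \<in> e}. v0 \<in> e \<or> v1 \<in> e}" by (auto simp: M)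
  also have "\<dots> = (\<lambda>y. {w, y}) ` ({v0, v1} \<inter> nb w)"
    unfolding edges_at using \<open>w \<noteq> v0\<close> \<open>w \<noteq> v1\<close> by auto
  finally show ?thesis .
qed

lemma root_incidence:
  assumes "w \<in> H" shows "incidence M w = card ({v0, v1} \<inter> nb w)"
proof -
  have "inj_on (\<lambda>y. {w, y}) ({v0, v1} \<inter> nb w)"
    by (rule inj_onI) (auto simp: doubleton_eq_iff)
  then show ?thesis by (simp only: incidence_def root_edges_at[OF assms] card_image)
qed

text \<open>A vertex of \<open>W\<close> has one decided edge, or two if it is adjacent to
  \<open>v1\<close> as well. In the latter case its orbit may have only \<open>k - 3\<close>
  vertices, which holds because \<open>v2\<close> is taken away from at most \<open>k - 2\<close>
  common neighbours. Without common neighbours only the covering clause is at stake; it can fail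
  only for an orbit that is all of \<open>W\<close> and lies in the neighbourhood of a vertex other
  than \<open>v0\<close>.\<close>

lemma root_state:
  assumes alt: "adj v0 v2 \<and> card (nb v0 \<inter> nb v1) \<le> k - 2 \<or>
      nb v0 \<inter> nb v1 = {} \<and> ((\<forall>w\<in>W. orb H w \<noteq> W) \<or> (\<forall>x. x \<noteq> v0 \<longrightarrow> \<not> W \<subseteq> nb x))"
  shows "state W H M 1"
  unfolding state_def
proof (intro conjI ballI allI impI)
  note d = root_distinct
  have fx: "\<phi> v0 = v0" "\<phi> v1 = v1" if "\<phi> \<in> Stab H" for \<phi>
    using Stab_fix[OF that] H by auto
  have cW: "card W = k - 1"
    using card_nb[OF d(3)] v(1) by (simp add: W card_Diff_singleton)
  have cW2: "card (W - {v2}) = k - 2" if "adj v0 v2"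
  proof -
    have "v2 \<in> W" using that d by (simp add: W)
    then have "card (W - {v2}) = card W - 1" by (simp add: card_Diff_singleton)
    then show ?thesis using cW by simp
  qed
  have finW: "finite W" by (simp add: W)
  have orbW: "orb H w \<subseteq> W - {v2}" if "w \<in> H" "w \<in> W" for w
  proof -
    have "orb H w \<subseteq> nb v0" by (rule orb_nb) (use that H W in auto)
    moreover have "orb H w \<subseteq> H" using orb_sub that by blast
    ultimately show ?thesis using W H by blast
  qed
  show "H \<subseteq> V" using H by blast
  show "M \<subseteq> ED" using M by blast
  show "(1::nat) \<le> 1" by simp
  show "\<not> e \<subseteq> H" if "e \<in> M" for e using that M H by blast
  show "act \<phi> M = M" if f: "\<phi> \<in> Stab H" for \<phi>
  proof -
    have *: "act \<psi> M \<subseteq> M" if g: "\<psi> \<in> Stab H" for \<psi>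
    proof
      fix e assume "e \<in> act \<psi> M"
      then obtain d where "d \<in> ED" "v0 \<in> d \<or> v1 \<in> d" "e = \<psi> ` d" unfolding M by blast
      moreover have "\<psi> ` d \<in> act \<psi> ED" using \<open>d \<in> ED\<close> by (rule imageI)
      ultimately show "e \<in> M" using fx[OF g] act_ED[OF g]
        unfolding M by (metis (mono_tags, lifting) imageI mem_Collect_eq)
    qed
    show ?thesis
    proof (rule card_subset_eq)
      show "finite M" using M by simp
      show "act \<phi> M \<subseteq> M" using *[OF f] .
      have "inj_on ((`) \<phi>) M" using Stab_inj[OF f] by (meson inj_image_eq_iff inj_onI)
      then show "card (act \<phi> M) = card M" by (rule card_image)
    qed
  qed
  show "\<phi> w \<in> W" if f: "\<phi> \<in> Stab H" and w: "w \<in> W" for \<phi> w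
  proof -
    have "adj (\<phi> v0) (\<phi> w)" using Stab_adj[OF f] w W by simp
    moreover have "\<phi> w \<noteq> \<phi> v1" using Stab_eq[OF f] w W by simp
    ultimately show ?thesis using fx[OF f] W by simp
  qed
  fix w assume w: "w \<in> H \<inter> W"
  have wv: "w \<noteq> v0" "w \<noteq> v1" "w \<noteq> v2" "w \<in> V" "adj w v0" using w H W adj_comm by auto
  have q: "incidence M w = (if adj w v1 then 2 else 1)"
  proof (cases "adj w v1")
    case True
    then have "{v0, v1} \<inter> nb w = {v0, v1}" using wv by auto
    then show ?thesis using root_incidence[of w] w True d by simp
  next
    case False
    then have "{v0, v1} \<inter> nb w = {v0}" using wv by auto
    then show ?thesis using root_incidence[of w] w False by simp
  qed
  have o: "card (orb H w) \<le> k - 1" "adj v0 v2 \<Longrightarrow> card (orb H w) \<le> k - 2"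
  proof -
    show "card (orb H w) \<le> k - 1"
      using card_mono[OF finW, of "orb H w"] orbW w cW by auto
    show "card (orb H w) \<le> k - 2" if "adj v0 v2"
      using card_mono[of "W - {v2}" "orb H w"] orbW w cW2[OF that] finW by auto
  qed
  show "1 * card (orb H w) \<le> load_bound (incidence M w)"
  proof (cases "adj w v1")
    case True
    have c1: "adj v1 w" "adj v0 w" using True wv adj_comm by auto
    then have v02: "adj v0 v2" and cc: "card (nb v0 \<inter> nb v1) \<le> k - 2" using alt by auto
    have "orb H w \<subseteq> nb v1" by (rule orb_nb) (use c1 H in auto)
    then have "orb H w \<subseteq> nb v0 \<inter> nb v1 - {v2}" using orbW[of w] w W by blast
    then have "card (orb H w) \<le> card (nb v0 \<inter> nb v1 - {v2})" by (intro card_mono) auto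
    also have "\<dots> = card (nb v0 \<inter> nb v1) - 1" using v02 v by (simp add: card_Diff_singleton)
    finally show ?thesis using cc k5 True by (simp add: q load_bound_def)
  next
    case False
    then show ?thesis using o by (simp add: q load_bound_def)
  qed
  fix x assume x: "orb H w \<subseteq> nb x" "{x, w} \<notin> M" "incidence M w \<le> 1"
  show "card (orb H w) \<le> k - 2"
  proof (cases "adj v0 v2")
    case True
    then show ?thesis using o by blast
  next
    case False
    \<comment> \<open>\<open>v0\<close> does cover \<open>W\<close>, but its edges are
      decided.\<close>
    have "x \<noteq> v0" using x(2) wv adj_comm by (auto simp: M)
    then have "orb H w \<noteq> W" using alt False x(1) w by auto
    then have "orb H w \<subset> W" using orbW[of w] w by blast
    then have "card (orb H w) < card W" using finW psubset_card_mono by blast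
    then show ?thesis using cW by simp
  qed
next
  note d = root_distinct
  fix w assume w: "w \<in> H - W"
  have wv: "w \<noteq> v0" "w \<noteq> v1" "w \<noteq> v2" "w \<in> V" "\<not> adj w v0" using w H W adj_comm by auto
  have sub: "{v0, v1} \<inter> nb w \<subseteq> {v1}" using wv by auto
  have q: "incidence M w \<le> 1"
    using card_mono[OF _ sub] root_incidence[of w] w by simp
  show "1 + incidence M w \<le> k" using q k5 by simp
  assume "1 \<le> incidence M w"
  then have "{v0, v1} \<inter> nb w \<noteq> {}" using root_incidence[of w] w card.empty by fastforce
  then have "adj v1 w" using wv adj_comm by auto
  then have "orb H w \<subseteq> nb v1" using H by (intro orb_nb) auto
  moreover have "orb H w \<subseteq> H" using orb_sub w by blast
  ultimately have "orb H w \<subseteq> nb v1 - {v0, v2}" using H by blast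
  then have "card (orb H w) \<le> card (nb v1 - {v0, v2})" by (intro card_mono) auto
  also have "\<dots> = k - 2"
    using card_Diff_subset[of "{v0, v2}" "nb v1"] v adj_comm card_nb[OF d(4)] by simp
  finally show "card (orb H w) + incidence M w \<le> k - 1" using q k5 by simp
qed

lemma root_rigid:
  assumes cn: "conn (V - {v0, v1})"
    and alt: "adj v0 v2 \<and> card (nb v0 \<inter> nb v1) \<le> k - 2 \<or>
      nb v0 \<inter> nb v1 = {} \<and> ((\<forall>w\<in>W. orb H w \<noteq> W) \<or> (\<forall>x. x \<noteq> v0 \<longrightarrow> \<not> W \<subseteq> nb x))"
  shows "\<exists>R\<subseteq>ED. \<forall>\<phi>\<in>Stab V. act \<phi> R = R \<longrightarrow> \<phi> = id"
proof -
  note d = root_distinct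
  have Hne: "H \<noteq> {}"
  proof
    assume "H = {}"
    then have "nb v0 \<subseteq> {v1, v2}" using nb_sub[of v0] H adj_irrefl by (auto simp: nb_def)
    then have "card (nb v0) \<le> card {v1, v2}" by (intro card_mono) auto
    also have "\<dots> \<le> 2" by (simp add: card_insert_if)
    finally show False using card_nb[OF d(3)] k5 by simp
  qed
  have HK: "H = (V - {v0, v1}) - {v2}" using H by blast
  have v2H: "{v2} \<subseteq> V - {v0, v1}" "{v2} \<noteq> {}" using d v by auto
  have "many_rigid W H M 1 (\<lambda>R. \<forall>J\<in>comps H. \<exists>x\<in>J. {v2, x} \<in> R)"
  proof (rule many_rigid_comps[where p = "\<lambda>_. v2"])
    show "state W H M 1" by (rule root_state[OF alt])
    show "H \<noteq> {}" by (rule Hne)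
    show "part_colourable W J M" for J by (rule part_colourable_all)
    show "v2 \<notin> H" using H by simp
    show "\<exists>x\<in>J. adj v2 x" if "J \<in> comps H" for J
      using comp_has_nb[OF cn v2H, of J] that unfolding HK by blast
    show "\<exists>y. y \<notin> H \<and> adj v2 y" using v adj_comm H by blast
    show "{v2, x} \<notin> M" if "J \<in> comps H" "x \<in> J" for J x
      using comps_sub[OF that(1)] that(2) H d v(3) by (auto simp: M)
  qed
  then obtain R0 where R0: "rigid W H M R0" "\<forall>J\<in>comps H. \<exists>x\<in>J. {v2, x} \<in> R0"
    unfolding many_rigid_def by (metis card_1_singletonE insertI1)
  have R0f: "R0 \<subseteq> free_edges H M" and R0t: "\<And>\<phi>. \<phi> \<in> Stab H \<Longrightarrow> act \<phi> R0 = R0 \<Longrightarrow> \<phi> = id"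
    and R0i: "\<And>w. w \<in> H \<Longrightarrow> 1 \<le> incidence R0 w" "\<And>w. w \<in> H \<Longrightarrow> w \<in> W \<Longrightarrow> 2 \<le> incidence R0 w"
    using R0(1) by (auto simp: rigid_def)
  have R0n: "v0 \<notin> e" "v1 \<notin> e" if "e \<in> R0" for e
    using that R0f by (auto simp: free_edges_def M)
  have R0E: "R0 \<subseteq> ED" using R0f free_edges_ED by blast
  define R where "R = insert {v1, v2} R0"
  have RE: "R \<subseteq> ED" using R0E v by (simp add: R_def)
  have finR: "finite R" using RE finite_ED finite_subset by blast
  have le: "incidence R0 w \<le> incidence R w" for w
    by (rule incidence_mono[OF _ finR]) (auto simp: R_def)
  have i0: "incidence R v0 = 0"
  proof -
    have "{e \<in> R. v0 \<in> e} = {}" using R0n(1) d v by (auto simp: R_def)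
    then show ?thesis by (simp only: incidence_def card.empty)
  qed
  have i1: "incidence R v1 = 1"
  proof -
    have "{e \<in> R. v1 \<in> e} = {{v1, v2}}" using R0n(2) d v by (auto simp: R_def)
    then show ?thesis by (simp add: incidence_def)
  qed
  \<comment> \<open>\<open>v2\<close> may be a neighbour of \<open>v0\<close>; a second red edge,
    into some component, then distinguishes it from \<open>v1\<close>.\<close>
  have i2: "2 \<le> incidence R v2"
  proof -
    obtain J where "J \<in> comps H" using Hne comp_in_comps by blast
    then obtain x where x: "x \<in> J" "{v2, x} \<in> R0" using R0(2) by blast
    show ?thesis
    proof (rule incidence_ge2[OF finR])
      show "{v1, v2} \<in> R" "{v2, x} \<in> R" using x by (auto simp: R_def)
      show "{v1, v2} \<noteq> {v2, x}" using R0n(2)[OF x(2)] by blast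
    qed auto
  qed
  have "\<phi> = id" if f: "\<phi> \<in> Stab V" and a: "act \<phi> R = R" for \<phi>
  proof -
    note ii = incidence_Stab[OF f a]
    have f0: "\<phi> v0 = v0"
    proof (rule ccontr)
      assume ne: "\<phi> v0 \<noteq> v0"
      have "\<phi> v0 \<in> V" using Stab_in[OF f] d by simp
      then have "\<phi> v0 = v1 \<or> \<phi> v0 = v2 \<or> \<phi> v0 \<in> H" using H ne by blast
      moreover have "incidence R (\<phi> v0) = 0" using ii i0 by simp
      ultimately show False using i1 i2 R0i(1)[of "\<phi> v0"] le[of "\<phi> v0"] by auto
    qed
    have f1: "\<phi> v1 = v1"
    proof (rule ccontr)
      assume ne: "\<phi> v1 \<noteq> v1"
      have "adj v0 (\<phi> v1)" using Stab_adj[OF f, of v0 v1] f0 v by simp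
      then have "\<phi> v1 \<in> W" "\<phi> v1 \<in> V" using ne W adj_V2 by auto
      moreover have "\<phi> v1 \<noteq> v0" using Stab_eq[OF f, of v1 v0] f0 d by simp
      ultimately have "\<phi> v1 = v2 \<or> \<phi> v1 \<in> H \<and> \<phi> v1 \<in> W" using H ne by blast
      moreover have "incidence R (\<phi> v1) = 1" using ii i1 by simp
      ultimately show False using i2 R0i(2)[of "\<phi> v1"] le[of "\<phi> v1"] by auto
    qed
    have f2: "\<phi> v2 = v2"
    proof -
      have "\<phi> ` {v1, v2} \<in> act \<phi> R" by (rule imageI) (simp add: R_def)
      then have "{v1, \<phi> v2} \<in> R" using a f1 by simp
      then have "{v1, \<phi> v2} = {v1, v2}" using R0n(2)[of "{v1, \<phi> v2}"] by (auto simp: R_def)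
      then show ?thesis by (auto simp: doubleton_eq_iff)
    qed
    have fH: "\<phi> \<in> Stab H"
      by (rule Stab_shrink[OF f]) (use H f0 f1 f2 in auto)
    have R0R: "R0 = R - {{v1, v2}}" using R0n(2) by (auto simp: R_def)
    have inj: "inj ((`) \<phi>)" by (rule injI) (use Stab_inj[OF f] in \<open>simp add: inj_image_eq_iff\<close>)
    have "act \<phi> R0 = act \<phi> R - act \<phi> {{v1, v2}}" unfolding R0R by (rule image_set_diff[OF inj])
    then have "act \<phi> R0 = R0" using a f1 f2 R0R by simp
    then show ?thesis by (rule R0t[OF fH])
  qed
  then show ?thesis using RE by blast
qed

end

section \<open>Deleting an edge without disconnecting the graph\<close>

text \<open>Adjacent vertices with equal closed neighbourhoods are twins. They have
  \<open>k - 1\<close> common neighbours, one more than a root edge may have.\<close>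

definition clnb :: "'a \<Rightarrow> 'a set" where
  "clnb x = insert x (nb x)"

lemma clnb_iff [simp]: "y \<in> clnb x \<longleftrightarrow> y = x \<or> adj x y"
  by (simp add: clnb_def)

lemma card_clnb: "x \<in> V \<Longrightarrow> card (clnb x) = k + 1"
  by (simp add: clnb_def card_nb)

lemma clnb_const:
  assumes D: "conn D" and tw: "\<And>a b. a \<in> D \<Longrightarrow> b \<in> D \<Longrightarrow> adj a b \<Longrightarrow> clnb a = clnb b"
    and d: "d \<in> D" "d' \<in> D"
  shows "clnb d' = clnb d"
proof -
  have "{e \<in> D. clnb e = clnb d} = D"
  proof (rule conn_closed[OF D])
    fix a b assume a: "a \<in> {e \<in> D. clnb e = clnb d}" and b: "b \<in> D" "adj a b"
    then have "clnb a = clnb b" using tw by blast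
    then show "b \<in> {e \<in> D. clnb e = clnb d}" using a b by simp
  qed (use d in auto)
  then show ?thesis using d by blast
qed

section \<open>A component of least size left by deleting one vertex\<close>

context
  fixes x D
  assumes cV: "conn V" and x: "x \<in> V" and D: "D \<in> comps (V - {x})"
    and least: "\<And>x' D'. x' \<in> V \<Longrightarrow> D' \<in> comps (V - {x'}) \<Longrightarrow> card D \<le> card D'"
begin

lemma least_sub: "D \<subseteq> V" "x \<notin> D" "finite D"
  using comps_sub[OF D] finite_V finite_subset by blast+

text \<open>Such a set \<open>A\<close> would contain a component of \<open>V - {y}\<close> smaller
  than \<open>D\<close>. Thus no single vertex cuts off a proper part of \<open>D\<close>, which
  behaves like an end block of the graph.\<close>

lemma least_closed:
  assumes y: "y \<in> V" and A: "A \<noteq> {}" "A \<subset> D" "y \<notin> A"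
    and cl: "\<And>p q. p \<in> A \<Longrightarrow> q \<in> V \<Longrightarrow> q \<noteq> y \<Longrightarrow> adj p q \<Longrightarrow> q \<in> A"
  shows False
proof -
  obtain p where p: "p \<in> A" using A by blast
  have pV: "p \<in> V - {y}" using p A least_sub by blast
  have "comp (V - {y}) p \<subseteq> A"
  proof
    fix q assume "q \<in> comp (V - {y}) p"
    then have "reach (V - {y}) p q" by (simp add: comp_def)
    then show "q \<in> A" using p by (rule reach_closed) (use cl in blast)
  qed
  then have "card (comp (V - {y}) p) < card D"
    using A(2) least_sub(3) by (meson psubset_card_mono psubset_subset_trans subset_psubset_trans)
  then show False using least[OF y comp_in_comps[OF pV]] by simp
qed

text \<open>Every component other than \<open>D\<close> hangs on \<open>x\<close>, so deletions
  inside \<open>D\<close> cannot separate anything outside \<open>D\<close> from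
  \<open>x\<close>.\<close>

lemma least_outside:
  assumes H: "V - D \<subseteq> H" shows "V - D \<subseteq> comp H x"
proof
  fix y assume y: "y \<in> V - D"
  have "reach (V - D) x y"
  proof (cases "y = x")
    case False
    define J where "J = comp (V - {x}) y"
    have J: "J \<in> comps (V - {x})" "y \<in> J"
      using y False comp_in_comps comp_self by (auto simp: J_def)
    have "J \<noteq> D" using J y by blast
    then have JD: "J \<subseteq> V - D" using comps_disj[OF J(1) D] comps_sub[OF J(1)] by blast
    obtain z where z: "z \<in> J" "adj x z"
      using comp_has_nb[OF cV _ _ J(1)] x by blast
    have "reach J z y" using comps_conn[OF J(1)] z J(2) by (simp add: conn_def)
    then have "reach (V - D) z y" using JD by (rule reach_mono)
    moreover have "reach (V - D) x z" using z JD x least_sub by (intro reach_step) auto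
    ultimately show ?thesis using reach_trans by blast
  qed simp
  then have "reach H x y" using H by (rule reach_mono)
  then show "y \<in> comp H x" using y H by (auto simp: comp_def)
qed

text \<open>All vertices of \<open>D\<close> then share one closed neighbourhood, which must be
  \<open>D\<close> together with \<open>x\<close>. It has \<open>k + 1\<close> elements, so
  \<open>x\<close> has no further neighbour and connectedness leaves no other vertex.\<close>

lemma complete_if_twins:
  assumes tw: "\<And>a b. a \<in> D \<Longrightarrow> b \<in> D \<Longrightarrow> adj a b \<Longrightarrow> clnb a = clnb b"
  shows "\<forall>v\<in>V. clnb v = V"
proof -
  obtain d where d: "d \<in> D" "adj x d"
    using comp_has_nb[OF cV _ _ D] x by blast
  have c: "clnb e = clnb d" if "e \<in> D" for e
    using clnb_const[OF comps_conn[OF D] tw] d that by blast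
  have dx: "clnb d = insert x D"
  proof
    show "clnb d \<subseteq> insert x D"
    proof
      fix e assume "e \<in> clnb d"
      then have "e = d \<or> adj d e" by simp
      then show "e \<in> insert x D" using comps_adj[OF D d(1), of e] d(1) adj_V2[of d e] by blast
    qed
    show "insert x D \<subseteq> clnb d"
    proof
      fix e assume e: "e \<in> insert x D"
      show "e \<in> clnb d"
      proof (cases "e = x")
        case True
        then show ?thesis using adj_sym[OF d(2)] by simp
      next
        case False
        have "e \<in> clnb e" by simp
        moreover have "clnb e = clnb d" using c e False by simp
        ultimately show ?thesis by (simp only:)
      qed
    qed
  qed
  have "insert x D = V"
  proof (rule conn_closed[OF cV])
    have eq: "clnb e = insert x D" if "e \<in> insert x D" for e
    proof (cases "e = x")
      case True
      have "adj x e'" if "e' \<in> D" for e'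
        using c[OF that] dx adj_comm[of x e'] that least_sub clnb_iff[of x e'] by auto
      then have "insert x D \<subseteq> clnb x" by auto
      moreover have "card (clnb x) = card (insert x D)"
        using dx card_clnb d least_sub x by (metis subsetD)
      moreover have "finite (clnb x)" by (simp add: clnb_def)
      ultimately show ?thesis using True card_subset_eq by metis
    next
      case False
      then show ?thesis using that c dx by blast
    qed
    show "b \<in> insert x D" if "a \<in> insert x D" "b \<in> V" "adj a b" for a b
      using eq[OF that(1)] that(3) by (metis clnb_iff)
  qed (use x least_sub in auto)
  moreover have "clnb e = insert x D" if "e \<in> D" for e using c[OF that] dx by simp
  moreover have "clnb x = insert x D"
  proof (rule card_subset_eq[symmetric, THEN sym])
    show "finite (insert x D)" using least_sub by simp
    show "clnb x \<subseteq> insert x D" using calculation(1) x nb_sub by (auto simp: clnb_def)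
    show "card (clnb x) = card (insert x D)"
      using dx card_clnb d least_sub x by (metis subsetD)
  qed
  ultimately show ?thesis by blast
qed

text \<open>Among the edges in \<open>D\<close> whose ends are not twins, take one that maximizes the component of \<open>x\<close> left
  after deleting its ends.\<close>

lemma connected_pair:
  assumes "\<not> (\<forall>v\<in>V. clnb v = V)"
  obtains a b where "a \<in> D" "b \<in> D" "adj a b" "clnb a \<noteq> clnb b" "conn (V - {a, b})"
proof -
  define P where "P e \<longleftrightarrow> (case e of (a, b) \<Rightarrow> a \<in> D \<and> b \<in> D \<and> adj a b \<and> clnb a \<noteq> clnb b)" for e
  define f where "f e = (case e of (a, b) \<Rightarrow> card (comp (V - {a, b}) x))" for e
  obtain e0 where e0: "P e0"
  proof -
    have "\<exists>a b. a \<in> D \<and> b \<in> D \<and> adj a b \<and> clnb a \<noteq> clnb b"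
      using complete_if_twins assms by blast
    then show ?thesis using that by (auto simp: P_def)
  qed
  have "f e \<le> card V" if "P e" for e
    using finite_V by (auto simp: f_def comp_def split: prod.split intro!: card_mono)
  then have "\<exists>e. P e \<and> (\<forall>e'. P e' \<longrightarrow> f e' \<le> f e)"
    by (intro ex_has_greatest_nat[of P e0 f "Suc (card V)", OF e0]) (simp add: less_Suc_eq_le)
  then obtain e1 where e1: "P e1" "\<And>e. P e \<Longrightarrow> f e \<le> f e1" by blast
  obtain a b where e1ab: "e1 = (a, b)" by (rule prod.exhaust)
  have ab: "a \<in> D" "b \<in> D" "adj a b" "clnb a \<noteq> clnb b" using e1(1) e1ab by (auto simp: P_def)
  have big: "card (comp (V - {c, d}) x) \<le> card (comp (V - {a, b}) x)"
    if "c \<in> D" "d \<in> D" "adj c d" "clnb c \<noteq> clnb d" for c d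
    using e1(2)[of "(c, d)"] that e1ab by (simp add: P_def f_def)
  have abV: "a \<in> V" "b \<in> V" "a \<noteq> b" using ab least_sub by auto
  define C0 where "C0 = comp (V - {a, b}) x"
  have xab: "x \<in> V - {a, b}" using x ab least_sub by auto
  have C0: "C0 \<in> comps (V - {a, b})" "x \<in> C0"
    using comp_in_comps[OF xab] comp_self[OF xab] by (auto simp: C0_def)
  have out: "V - D \<subseteq> C0" unfolding C0_def by (rule least_outside) (use ab in auto)
  have "C0 = V - {a, b}"
  proof (rule ccontr)
    assume ne: "C0 \<noteq> V - {a, b}"
    then obtain p where p: "p \<in> V - {a, b}" "p \<notin> C0" using comps_sub[OF C0(1)] by blast
    define D' where "D' = comp (V - {a, b}) p"
    have D': "D' \<in> comps (V - {a, b})" "p \<in> D'"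
      using comp_in_comps[OF p(1)] comp_self[OF p(1)] by (auto simp: D'_def)
    have disj: "D' \<inter> C0 = {}" using comps_disj[OF D'(1) C0(1)] D'(2) p(2) by blast
    have subD: "D' \<subseteq> D - {a, b}" using disj out comps_sub[OF D'(1)] by blast
    have nD': "q \<in> D' \<or> q = a \<or> q = b" if "r \<in> D'" "adj r q" for r q
      using comps_adj[OF D'(1) that(1) _ that(2)] adj_V2[OF that(2)] by blast
    \<comment> \<open>Otherwise the other one of \<open>a\<close> and \<open>b\<close> would cut off
      \<open>D'\<close> alone, against the minimality of \<open>D\<close>.\<close>
    have touch: "\<exists>r\<in>D'. adj r s" if st: "{s, t} = {a, b}" "s \<noteq> t" for s t
    proof (rule ccontr)
      assume no: "\<not> (\<exists>r\<in>D'. adj r s)"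
      show False
      proof (rule least_closed)
        show "t \<in> V" using st abV by (auto simp: doubleton_eq_iff)
        show "D' \<noteq> {}" using D' by blast
        show "D' \<subset> D" "t \<notin> D'" using subD st ab by blast+
        show "q \<in> D'" if "r \<in> D'" "q \<in> V" "q \<noteq> t" "adj r q" for r q
        proof -
          have "q \<noteq> s" using no that by blast
          then show ?thesis using nD'[OF that(1,4)] that(3) st by blast
        qed
      qed
    qed
    have ta: "\<exists>r\<in>D'. adj r a" and tb: "\<exists>r\<in>D'. adj r b"
      using touch[of a b] touch[of b a] abV by auto
    have C0n: "\<exists>r\<in>C0. adj r a \<or> adj r b"
    proof -
      obtain r s where "r \<in> C0" "s \<in> {a, b}" "adj s r"
        using comp_has_nb[OF cV, of "{a, b}" C0] C0 abV by blast
      moreover have "adj r s" by (rule adj_sym) fact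
      ultimately show ?thesis by blast
    qed
    show False
    proof (cases "\<exists>c d. c \<in> D' \<and> d \<in> D' \<and> adj c d \<and> clnb c \<noteq> clnb d")
      case True
      then obtain c d where cd: "c \<in> D'" "d \<in> D'" "adj c d" "clnb c \<noteq> clnb d" by blast
      \<comment> \<open>Deleting \<open>c\<close> and \<open>d\<close> instead of \<open>a\<close>
        and \<open>b\<close> would leave \<open>C0\<close>, \<open>a\<close> and \<open>b\<close>
        together in the component of \<open>x\<close>, against the maximal choice.\<close>
      have cab: "conn ({a} \<union> {b})" by (rule conn_Un[of _ _ a b]) (use ab in auto)
      obtain r s where "r \<in> C0" "s \<in> {a} \<union> {b}" "adj r s" using C0n by blast
      then have "conn (C0 \<union> ({a} \<union> {b}))"
        using conn_Un[OF comps_conn[OF C0(1)] cab] by blast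
      then have cn: "conn (C0 \<union> {a, b})" by (simp only: insert_is_Un[symmetric])
      have "C0 \<union> {a, b} \<subseteq> comp (V - {c, d}) x"
      proof
        fix y assume y: "y \<in> C0 \<union> {a, b}"
        then have "reach (C0 \<union> {a, b}) x y" using cn C0(2) unfolding conn_def by blast
        moreover have sub: "C0 \<union> {a, b} \<subseteq> V - {c, d}"
          using comps_sub[OF C0(1)] cd disj subD abV by blast
        ultimately have "reach (V - {c, d}) x y" by (rule reach_mono)
        then show "y \<in> comp (V - {c, d}) x" using y sub by (auto simp: comp_def)
      qed
      moreover have "finite (comp (V - {c, d}) x)"
        using finite_V by (auto simp: comp_def)
      ultimately have "card (C0 \<union> {a, b}) \<le> card (comp (V - {c, d}) x)" by (intro card_mono)
      also have "\<dots> \<le> card C0" unfolding C0_def by (rule big) (use cd subD in auto)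
      finally have "card (C0 \<union> {a, b}) \<le> card C0" .
      moreover have finC: "finite C0" using comps_sub[OF C0(1)] finite_V finite_subset by blast
      moreover have "C0 \<subset> C0 \<union> {a, b}" using comps_sub[OF C0(1)] by blast
      ultimately show False using psubset_card_mono[of "C0 \<union> {a, b}" C0] by simp
    next
      case False
      \<comment> \<open>If all edges inside \<open>D'\<close> join twins, their common closed
        neighbourhood is \<open>D'\<close> with \<open>a\<close> and \<open>b\<close>. By counting,
        \<open>a\<close> and \<open>b\<close> then have all their neighbours in \<open>D'\<close>
        and each other, and none in \<open>C0\<close>.\<close>
      have c: "clnb e = clnb p" if "e \<in> D'" for e
        using clnb_const[OF comps_conn[OF D'(1)] _ D'(2) that] False by blast
      have ap: "adj p a" "adj p b"
        using ta tb c subD p by (metis clnb_iff DiffD2 insertI1 insertCI)+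
      have all: "adj e a" "adj e b" if "e \<in> D'" for e
      proof -
        have "a \<in> clnb e" "b \<in> clnb e" using c[OF that] ap by simp_all
        then show "adj e a" "adj e b" using that subD by auto
      qed
      have "clnb p = insert a (insert b D')"
      proof
        show "clnb p \<subseteq> insert a (insert b D')"
        proof
          fix e assume "e \<in> clnb p"
          then have "e = p \<or> adj p e" by simp
          then show "e \<in> insert a (insert b D')" using nD'[OF D'(2), of e] D'(2) by blast
        qed
        show "insert a (insert b D') \<subseteq> clnb p"
        proof
          fix e assume e: "e \<in> insert a (insert b D')"
          have "e \<in> clnb p" if "e \<in> D'"
          proof -
            have "e \<in> clnb e" by simp
            then show ?thesis by (simp only: c[OF that])
          qed
          then show "e \<in> clnb p" using e ap by auto
        qed
      qed
      moreover have finD': "finite D'" using subD least_sub finite_subset by blast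
      moreover have "a \<notin> insert b D'" "b \<notin> D'" using subD abV by auto
      ultimately have "card D' + 2 = k + 1" using card_clnb[of p] p by simp
      then have cD: "card (insert a D') = k" "card (insert b D') = k"
        using finD' \<open>b \<notin> D'\<close> \<open>a \<notin> insert b D'\<close> by simp_all
      have "insert b D' \<subseteq> nb a" "insert a D' \<subseteq> nb b"
        using adj_sym[OF all(1)] adj_sym[OF all(2)] ab(3) adj_sym[OF ab(3)] by auto
      then have "insert b D' = nb a" "insert a D' = nb b"
        using card_subset_eq[OF finite_nb] cD card_nb abV by metis+
      then have "\<not> adj a r" "\<not> adj b r" if "r \<in> C0" for r
        using that disj comps_sub[OF C0(1)] nb_iff[of r a] nb_iff[of r b] by auto
      then show False using C0n adj_sym by blast
    qed
  qed
  then have "conn (V - {a, b})" using comps_conn[OF C0(1)] by simp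
  then show ?thesis using that ab by blast
qed

text \<open>For all but at most one \<open>w\<close>, the remaining neighbours of \<open>a\<close>
  lie in one component of \<open>V - {a, w}\<close>: those other than \<open>b\<close> are adjacent
  to \<open>u\<close>, and \<open>b\<close> reaches \<open>u\<close>. If there were a second
  component, \<open>w\<close> alone would cut off a proper part of \<open>D\<close>.\<close>

lemma swap_pair:
  assumes ab: "a \<in> D" "b \<in> D" "adj a b" "conn (V - {a, b})"
    and u: "u \<in> V" "u \<noteq> a" "u \<noteq> b" "nb a - {b} \<subseteq> nb u"
    and tri: "nb a \<inter> nb b = {}"
  obtains w where "w \<in> nb a - {b}" "conn (V - {a, w})"
proof -
  have abV: "a \<in> V" "b \<in> V" "a \<noteq> b" using ab least_sub by auto
  let ?W = "nb a - {b}"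
  have cW: "card ?W = k - 1" using card_nb[OF abV(1)] ab(3) by (simp add: card_Diff_singleton)
  have dv: "\<And>w. w \<in> ?W \<Longrightarrow> w \<noteq> a \<and> w \<noteq> b \<and> w \<in> V \<and> adj u w \<and> w \<noteq> u"
    using u(4) adj_V2 by (auto simp: subset_iff)
  have cVa: "conn (V - {a})"
  proof -
    have "card (nb b - {a}) = k - 1"
      using card_nb[OF abV(2)] adj_sym[OF ab(3)] by (simp add: card_Diff_singleton)
    then have "nb b - {a} \<noteq> {}" using k5 by (intro notI) simp
    then have "\<exists>y. y \<in> nb b - {a}" by blast
    then obtain y where "y \<in> nb b - {a}" by (rule exE)
    then have y: "adj b y" "y \<noteq> a" by simp_all
    then have "y \<in> V - {a, b}" using adj_V2 by auto
    moreover have "V - {a} = (V - {a, b}) \<union> {b}" using abV by blast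
    ultimately show ?thesis using conn_Un[OF ab(4) conn_single, of y b b] adj_sym[OF y(1)] by simp
  qed
  define B where "B = comp (V - {a} - ?W) b"
  have bB: "b \<in> B" unfolding B_def by (rule comp_self) (use abV in auto)
  \<comment> \<open>If \<open>u\<close> cannot be reached without using \<open>?W\<close>, leave the
    component of \<open>b\<close> through some \<open>q\<close> in \<open>?W\<close>. As
    \<open>q\<close> is adjacent to \<open>u\<close>, only \<open>w = q\<close> is harmful.\<close>
  have "\<exists>w0. \<forall>w\<in>?W. w \<noteq> w0 \<longrightarrow> reach (V - {a, w}) b u"
  proof (cases "u \<in> B")
    case True
    then have "reach (V - {a} - ?W) b u" by (simp add: B_def comp_def)
    then have "reach (V - {a, w}) b u" if "w \<in> ?W" for w
      by (rule reach_mono) (use that in blast)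
    then show ?thesis by blast
  next
    case False
    have "B \<subseteq> V - {a}" by (auto simp: B_def comp_def)
    moreover have "B \<noteq> V - {a}" using False u by blast
    ultimately obtain p q where pq: "p \<in> B" "q \<in> V - {a}" "adj p q" "q \<notin> B"
      using conn_closed[OF cVa, of B] bB by blast
    have BJ: "B \<in> comps (V - {a} - ?W)"
      unfolding B_def by (rule comp_in_comps) (use abV in auto)
    have qW: "q \<in> ?W" using comps_adj[OF BJ pq(1) _ pq(3)] pq by blast
    have "reach (V - {a, w}) b u" if w: "w \<in> ?W" "w \<noteq> q" for w
    proof -
      have "reach (V - {a} - ?W) b p" using pq(1) by (simp add: B_def comp_def)
      then have "reach (V - {a, w}) b p" by (rule reach_mono) (use w in blast)
      moreover have "p \<in> V - {a, w}" using comps_sub[OF BJ] pq(1) w by blast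
      then have "reach (V - {a, w}) p q" using pq w by (intro reach_step) auto
      moreover have "reach (V - {a, w}) q u"
        using dv[OF qW] dv[OF w(1)] w u pq adj_comm by (intro reach_step) auto
      ultimately show ?thesis using reach_trans by blast
    qed
    then show ?thesis by blast
  qed
  then obtain w0 where w0: "\<And>w. w \<in> ?W \<Longrightarrow> w \<noteq> w0 \<Longrightarrow> reach (V - {a, w}) b u" by blast
  \<comment> \<open>Besides \<open>w0\<close>, the vertex \<open>x\<close> must be avoided to keep
    \<open>w\<close> inside \<open>D\<close>; there are \<open>k - 1\<close> candidates, more than
    two.\<close>
  have "\<not> ?W \<subseteq> {w0, x}"
  proof
    assume "?W \<subseteq> {w0, x}"
    then have "card ?W \<le> card {w0, x}" by (intro card_mono) auto
    also have "\<dots> \<le> 2" by (simp add: card_insert_if)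
    finally show False using cW k5 by simp
  qed
  then obtain w where w: "w \<in> ?W" "w \<noteq> w0" "w \<noteq> x" by blast
  have bu: "reach (V - {a, w}) b u" by (rule w0[OF w(1,2)])
  have wV: "w \<in> V" "w \<noteq> a" "w \<noteq> b" "adj a w" using dv[OF w(1)] w by auto
  have wD: "w \<in> D" using comps_adj[OF D ab(1) _ wV(4)] w wV by blast
  have na: "reach (V - {a, w}) u y" if y: "adj a y" "y \<noteq> w" for y
  proof (cases "y = b")
    case True
    then show ?thesis using reach_sym[OF bu] by simp
  next
    case False
    then have "y \<in> ?W" using y by simp
    then show ?thesis using dv[of y] dv[OF w(1)] u y by (intro reach_step) auto
  qed
  let ?H = "V - {a, w}"
  have "conn ?H"
  proof -
    have xH: "x \<in> ?H" using x w ab least_sub by auto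
    define C where "C = comp ?H x"
    have C: "C \<in> comps ?H" "x \<in> C"
      using comp_in_comps[OF xH] comp_self[OF xH] by (auto simp: C_def)
    have out: "V - D \<subseteq> C" unfolding C_def by (rule least_outside) (use ab wD in auto)
    have "C = ?H"
    proof (rule ccontr)
      assume "C \<noteq> ?H"
      then obtain p where p: "p \<in> ?H" "p \<notin> C" using comps_sub[OF C(1)] by blast
      define D' where "D' = comp ?H p"
      have D': "D' \<in> comps ?H" "p \<in> D'"
        using comp_in_comps[OF p(1)] comp_self[OF p(1)] by (auto simp: D'_def)
      have disj: "D' \<inter> C = {}" using comps_disj[OF D'(1) C(1)] D'(2) p(2) by blast
      have subD: "D' \<subseteq> D - {a, w}" using disj out comps_sub[OF D'(1)] by blast
      show False
      proof (cases "\<exists>r\<in>D'. adj a r")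
        case False
        show False
        proof (rule least_closed[OF wV(1)])
          show "D' \<noteq> {}" using D' by blast
          show "D' \<subset> D" "w \<notin> D'" using subD ab by blast+
          show "q \<in> D'" if "r \<in> D'" "q \<in> V" "q \<noteq> w" "adj r q" for r q
          proof -
            have "q \<noteq> a" using False that adj_comm by blast
            then show ?thesis using comps_adj[OF D'(1) that(1) _ that(4)] that by blast
          qed
        qed
      next
        case True
        then obtain r where r: "r \<in> D'" "adj a r" by blast
        have noC: "\<not> adj a y" if "y \<in> C" for y
        proof
          assume "adj a y"
          moreover have "y \<noteq> w" "r \<noteq> w" using that comps_sub[OF C(1)] r subD by auto
          ultimately have "reach ?H r y" using na[of y] na[of r] r reach_sym reach_trans by meson
          then have "y \<in> comp ?H r" using that comps_sub[OF C(1)] by (auto simp: comp_def)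
          then have "y \<in> D'" using comps_eq[OF D'(1) r(1)] by simp
          then show False using disj that by blast
        qed
        \<comment> \<open>Since \<open>C\<close> contains no neighbour of \<open>a\<close>, the
          vertex \<open>a\<close> belongs to the part that \<open>w\<close> cuts off from
          \<open>C\<close>.\<close>
        show False
        proof (rule least_closed[OF wV(1), of "V - C - {w}"])
          show "V - C - {w} \<noteq> {}" using p by blast
          show "V - C - {w} \<subset> D" using out wD by blast
          show "w \<notin> V - C - {w}" by simp
          show "q \<in> V - C - {w}" if "s \<in> V - C - {w}" "q \<in> V" "q \<noteq> w" "adj s q" for s q
          proof -
            have "q \<notin> C"
            proof
              assume q: "q \<in> C"
              then have "s \<noteq> a" using noC that by blast
              then have "s \<in> C" using comps_adj[OF C(1) q _ adj_sym[OF that(4)]] that by blast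
              then show False using that by blast
            qed
            then show ?thesis using that by blast
          qed
        qed
      qed
    qed
    then show ?thesis using comps_conn[OF C(1)] by simp
  qed
  then show ?thesis using that w by blast
qed

end

section \<open>Finding a root\<close>

definition asymmetric_subset :: "bool" where
  "asymmetric_subset \<longleftrightarrow> (\<exists>R\<subseteq>ED. \<forall>\<phi>\<in>Stab V. act \<phi> R = R \<longrightarrow> \<phi> = id)"

lemma asymmetric_from_root:
  assumes "adj v0 v1" "adj v1 v2" "v2 \<noteq> v0" "conn (V - {v0, v1})"
    "adj v0 v2 \<and> card (nb v0 \<inter> nb v1) \<le> k - 2 \<or>
      nb v0 \<inter> nb v1 = {} \<and> ((\<forall>w\<in>nb v0 - {v1}. orb (V - {v0, v1, v2}) w \<noteq> nb v0 - {v1}) \<or>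
        (\<forall>x. x \<noteq> v0 \<longrightarrow> \<not> nb v0 - {v1} \<subseteq> nb x))"
  shows asymmetric_subset
  unfolding asymmetric_subset_def by (rule root_rigid[OF assms(1-3) refl refl refl assms(4,5)])

text \<open>If the edge fails as a root, both obstructions to the covering clause occur together,
  and they do so for every choice of the third root vertex.\<close>

lemma root_no_common:
  assumes ab: "adj a b" "conn (V - {a, b})" "nb a \<inter> nb b = {}" and no: "\<not> asymmetric_subset"
    and y: "y \<in> nb b - {a}"
  shows "\<exists>w\<in>nb a - {b}. orb (V - {a, b, y}) w = nb a - {b}"
    and "\<exists>x. x \<noteq> a \<and> nb a - {b} \<subseteq> nb x"
  using asymmetric_from_root[of a b y] assms by auto

text \<open>The vertex \<open>y\<close> is fixed while all of \<open>nb a - {b}\<close> forms one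
  orbit, so one adjacency between them implies all.\<close>

lemma root_no_common_adj:
  assumes ab: "adj a b" "conn (V - {a, b})" "nb a \<inter> nb b = {}" and no: "\<not> asymmetric_subset"
    and y: "y \<in> nb b - {a}" and w: "w \<in> nb a - {b}" "adj y w"
  shows "nb a - {b} \<subseteq> nb y"
proof -
  let ?H = "V - {a, b, y}"
  obtain w' where w': "w' \<in> nb a - {b}" "orb ?H w' = nb a - {b}"
    using root_no_common(1)[OF ab no y] by blast
  then have "orb ?H w = nb a - {b}" using orb_eq[of w ?H w'] w(1) by simp
  moreover have "orb ?H w \<subseteq> nb y" by (rule orb_nb) (use w in auto)
  ultimately show ?thesis by simp
qed

text \<open>\<open>root_no_common_adj\<close> applies to the edge in both directions: one edge
  between the two neighbourhoods spreads to all of \<open>nb a - {b}\<close> and from there to all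
  of \<open>nb b - {a}\<close>. Regularity turns the resulting inclusions into equalities.\<close>

lemma complete_bipartite:
  assumes cV: "conn V" and ab: "adj a b" "conn (V - {a, b})" "nb a \<inter> nb b = {}"
    and no: "\<not> asymmetric_subset"
    and wy: "w \<in> nb a - {b}" "y \<in> nb b - {a}" "adj w y"
  shows "V = nb a \<union> nb b \<and> (\<forall>p\<in>nb a. nb p = nb b) \<and> (\<forall>q\<in>nb b. nb q = nb a)"
proof -
  have ba: "adj b a" "conn (V - {b, a})" "nb b \<inter> nb a = {}"
    using ab adj_sym by (auto simp: insert_commute)
  have yw: "adj y w" using wy adj_sym by blast
  have abV: "a \<in> V" "b \<in> V" using ab(1) adj_V adj_V2 by auto
  have "nb a - {b} \<subseteq> nb y" by (rule root_no_common_adj[OF ab no wy(2,1) yw])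
  then have A: "nb b - {a} \<subseteq> nb p" if "p \<in> nb a - {b}" for p
  proof -
    have "p \<in> nb y" using \<open>nb a - {b} \<subseteq> nb y\<close> that by blast
    then have "adj p y" using adj_sym by simp
    then show ?thesis by (rule root_no_common_adj[OF ba no that wy(2)])
  qed
  have B: "nb a - {b} \<subseteq> nb q" if "q \<in> nb b - {a}" for q
  proof
    fix p assume "p \<in> nb a - {b}"
    then have "q \<in> nb p" using A that by blast
    then show "p \<in> nb q" using adj_sym by simp
  qed
  have "nb p = nb b" if p: "p \<in> nb a" for p
  proof (cases "p = b")
    case False
    then have "nb b \<subseteq> nb p" using A[of p] p adj_sym[of a p] by auto
    moreover have "card (nb b) = card (nb p)" using card_nb abV adj_V2[of a p] p by simp
    ultimately show ?thesis using card_subset_eq[OF finite_nb] by metis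
  qed simp
  moreover have "nb q = nb a" if q: "q \<in> nb b" for q
  proof (cases "q = a")
    case False
    then have "nb a \<subseteq> nb q" using B[of q] q adj_sym[of b q] by auto
    moreover have "card (nb a) = card (nb q)" using card_nb abV adj_V2[of b q] q by simp
    ultimately show ?thesis using card_subset_eq[OF finite_nb] by metis
  qed simp
  moreover have "nb a \<union> nb b = V"
  proof (rule conn_closed[OF cV])
    show "nb a \<union> nb b \<subseteq> V" using nb_sub by blast
    show "nb a \<union> nb b \<noteq> {}" using ab by auto
    show "q \<in> nb a \<union> nb b" if "p \<in> nb a \<union> nb b" "q \<in> V" "adj p q" for p q
      using calculation that nb_iff[of q p] by blast
  qed
  ultimately show ?thesis by simp
qed

text \<open>An edge with non-twin ends and connected remainder would be a root if its ends had a
  common neighbour. Without one, an edge between the two remaining neighbourhoods forces the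
  complete bipartite graph; if there is none, a vertex \<open>u\<close> covering
  \<open>nb a - {b}\<close> permits an exchange of \<open>b\<close> for another neighbour of
  \<open>a\<close>, and the new edge is a root.\<close>

theorem root_cases:
  assumes cV: "conn V" and no: "\<not> asymmetric_subset" and nc: "\<not> (\<forall>v\<in>V. clnb v = V)"
  obtains a b where "adj a b" "nb a \<inter> nb b = {}" "V = nb a \<union> nb b"
    "\<And>p. p \<in> nb a \<Longrightarrow> nb p = nb b" "\<And>q. q \<in> nb b \<Longrightarrow> nb q = nb a"
proof -
  define P where "P e \<longleftrightarrow> (case e of (x, D) \<Rightarrow> x \<in> V \<and> D \<in> comps (V - {x}))" for e
  obtain v where v: "v \<in> V" "clnb v \<noteq> V" using nc by blast
  have "clnb v \<subseteq> V" using v nb_sub by (auto simp: clnb_def)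
  then have "\<exists>v'. v' \<in> V \<and> v' \<notin> clnb v" using v by blast
  then obtain v' where "v' \<in> V \<and> v' \<notin> clnb v" by (rule exE)
  then have v': "v' \<in> V" "v' \<noteq> v" by auto
  have "P (v, comp (V - {v}) v')" using v v' comp_in_comps by (simp add: P_def)
  then have "\<exists>e. P e \<and> (\<forall>e'. P e' \<longrightarrow> card (snd e) \<le> card (snd e'))"
    by (rule ex_has_least_nat)
  then obtain e where e: "P e" "\<And>e'. P e' \<Longrightarrow> card (snd e) \<le> card (snd e')" by blast
  obtain x D where xD: "e = (x, D)" by (rule prod.exhaust)
  have x: "x \<in> V" and D: "D \<in> comps (V - {x})" using e(1) xD by (auto simp: P_def)
  have least: "card D \<le> card D'" if "x' \<in> V" "D' \<in> comps (V - {x'})" for x' D'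
    using e(2)[of "(x', D')"] that xD by (simp add: P_def)
  obtain a b where ab: "a \<in> D" "b \<in> D" "adj a b" "clnb a \<noteq> clnb b" "conn (V - {a, b})"
    by (rule connected_pair[OF cV x D _ nc], erule (1) least)
  have abV: "a \<in> V" "b \<in> V" using ab(3) adj_V adj_V2 by auto
  have disj: "nb a \<inter> nb b = {}"
  proof (rule ccontr)
    assume "nb a \<inter> nb b \<noteq> {}"
    then obtain v2 where v2: "adj a v2" "adj b v2" by auto
    have ca: "card (nb a - {b}) = k - 1"
      using card_nb[OF abV(1)] ab(3) by (simp add: card_Diff_singleton)
    have cb: "card (nb b - {a}) = k - 1"
      using card_nb[OF abV(2)] adj_sym[OF ab(3)] by (simp add: card_Diff_singleton)
    \<comment> \<open>Equality would make \<open>a\<close> and \<open>b\<close> twins; strictness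
      leaves at most \<open>k - 2\<close> common neighbours.\<close>
    have "nb a \<inter> nb b \<subset> nb a - {b}"
    proof
      show "nb a \<inter> nb b \<subseteq> nb a - {b}" by auto
      show "nb a \<inter> nb b \<noteq> nb a - {b}"
      proof
        assume eq: "nb a \<inter> nb b = nb a - {b}"
        moreover have "a \<notin> nb a" by simp
        ultimately have "nb a - {b} \<subseteq> nb b - {a}" by blast
        then have "nb a - {b} = nb b - {a}" using ca cb by (intro card_subset_eq) auto
        moreover have "clnb a = insert a (insert b (nb a - {b}))"
          using ab(3) by (auto simp: clnb_def)
        moreover have "clnb b = insert a (insert b (nb b - {a}))"
          using adj_sym[OF ab(3)] by (auto simp: clnb_def)
        ultimately show False using ab(4) by simp
      qed
    qed
    then have "card (nb a \<inter> nb b) < k - 1" using psubset_card_mono[of "nb a - {b}"] ca by simp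
    then have "card (nb a \<inter> nb b) \<le> k - 2" by simp
    then have asymmetric_subset
      using asymmetric_from_root[OF ab(3) v2(2) _ ab(5)] v2 adj_irrefl by blast
    then show False using no by blast
  qed
  have ne: "\<exists>y. y \<in> nb b - {a}"
  proof -
    have "card (nb b - {a}) = k - 1"
      using card_nb[OF abV(2)] adj_sym[OF ab(3)] by (simp add: card_Diff_singleton)
    then have "nb b - {a} \<noteq> {}" using k5 by (intro notI) simp
    then show ?thesis by blast
  qed
  have "\<exists>w y. w \<in> nb a - {b} \<and> y \<in> nb b - {a} \<and> adj w y"
  proof (rule ccontr)
    assume none: "\<not> ?thesis"
    obtain y where y: "y \<in> nb b - {a}" using ne by blast
    obtain u where u: "u \<noteq> a" "nb a - {b} \<subseteq> nb u"
      using root_no_common(2)[OF ab(3,5) disj no y] by blast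
    have cW: "card (nb a - {b}) = k - 1"
      using card_nb[OF abV(1)] ab(3) by (simp add: card_Diff_singleton)
    then have "nb a - {b} \<noteq> {}" using k5 by (intro notI) simp
    then have "\<exists>w1. w1 \<in> nb a - {b}" by blast
    then obtain w1 where w1: "w1 \<in> nb a - {b}" by (rule exE)
    have uw1: "adj u w1" using subsetD[OF u(2) w1] by simp
    have uV: "u \<in> V" by (rule adj_V[OF uw1])
    have ub: "u \<noteq> b"
    proof
      assume "u = b"
      then have "w1 \<in> nb a \<inter> nb b" using uw1 w1 by simp
      then show False using disj by simp
    qed
    have nub: "\<not> adj b u"
    proof
      assume "adj b u"
      then have "w1 \<in> nb a - {b} \<and> u \<in> nb b - {a} \<and> adj w1 u"
        using u(1) w1 adj_sym[OF uw1] by simp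
      then show False using none by blast
    qed
    \<comment> \<open>The new root vertices are \<open>a\<close>, \<open>w\<close>,
      \<open>u\<close>. If \<open>a\<close> and \<open>w\<close> have no common neighbour, no orbit
      can fill \<open>nb a - {w}\<close>: the fixed vertex \<open>u\<close> is adjacent to all of it
      except \<open>b\<close>.\<close>
    obtain w where w: "w \<in> nb a - {b}" "conn (V - {a, w})"
      by (rule swap_pair[OF cV x D _ ab(1-3,5) uV u(1) ub u(2) disj], erule (1) least)
    have aw: "adj a w" "w \<noteq> b" "adj u w" "adj w u" using w(1) u(2) adj_sym by auto
    have nbw: "\<not> adj w b" "\<not> adj b w" using disj w(1) adj_sym[of w b] by auto
    have asymmetric_subset
    proof (cases "nb a \<inter> nb w = {}")
      case False
      then obtain v2 where v2: "adj a v2" "adj w v2" by auto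
      have "nb a \<inter> nb w \<subseteq> nb a - {b, w}" using nbw by auto
      then have "card (nb a \<inter> nb w) \<le> card (nb a - {b, w})" by (intro card_mono) auto
      also have "\<dots> = k - 2"
        using card_Diff_subset[of "{b, w}" "nb a"] ab(3) aw card_nb[OF abV(1)] by simp
      finally show ?thesis using asymmetric_from_root[OF aw(1) v2(2) _ w(2)] v2 adj_irrefl by blast
    next
      case True
      let ?W = "nb a - {w}"
      have "orb (V - {a, w, u}) w' \<noteq> ?W" if w': "w' \<in> ?W" for w'
      proof
        assume eq: "orb (V - {a, w, u}) w' = ?W"
        have "\<not> nb a \<subseteq> {b, w}"
        proof
          assume "nb a \<subseteq> {b, w}"
          then have "card (nb a) \<le> card {b, w}" by (intro card_mono) auto
          also have "\<dots> \<le> 2" by (simp add: card_insert_if)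
          finally show False using card_nb[OF abV(1)] k5 by simp
        qed
        then obtain w'' where w'': "w'' \<in> nb a" "w'' \<noteq> b" "w'' \<noteq> w" by blast
        then have "orb (V - {a, w, u}) w'' = ?W" using orb_eq[of w'' _ w'] eq by auto
        moreover have "orb (V - {a, w, u}) w'' \<subseteq> nb u"
          by (rule orb_nb) (use w'' u in auto)
        moreover have "b \<in> ?W" using ab(3) aw by simp
        ultimately have "adj u b" by auto
        then show False using nub adj_sym by blast
      qed
      then show ?thesis using asymmetric_from_root[OF aw(1,4) u(1) w(2)] True by blast
    qed
    then show False using no by blast
  qed
  then obtain w y where "w \<in> nb a - {b}" "y \<in> nb b - {a}" "adj w y" by blast
  from complete_bipartite[OF cV ab(3,5) disj no this] show ?thesis using that[OF ab(3) disj] by blast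
qed

end

section \<open>Complete and complete bipartite graphs\<close>

text \<open>In a path \<open>0, \<dots>, k\<close> with the additional edge \<open>13\<close>, the vertices 1 and 3 are the only ones of degree 3,
  and 0 is the only end of the path next to one of them.\<close>

definition path_chord :: "nat \<Rightarrow> nat \<Rightarrow> bool" where
  "path_chord i j \<longleftrightarrow> j = Suc i \<or> i = Suc j \<or> i = 1 \<and> j = 3 \<or> i = 3 \<and> j = 1"

lemma path_chord_rigid:
  assumes k: "5 \<le> k" and bij: "bij_betw \<psi> {..k} {..k}"
    and pres: "\<And>i j. i \<le> k \<Longrightarrow> j \<le> k \<Longrightarrow> path_chord (\<psi> i) (\<psi> j) \<longleftrightarrow> path_chord i j"
    and i: "i \<le> k"
  shows "\<psi> i = i"
proof -
  have le: "\<psi> i \<le> k" if "i \<le> k" for i using bij that by (auto simp: bij_betw_def)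
  have inj: "i = j" if "\<psi> i = \<psi> j" "i \<le> k" "j \<le> k" for i j
    using bij that by (auto simp: bij_betw_def inj_on_def)
  define N where "N i = {j. j \<le> k \<and> path_chord i j}" for i
  have "\<psi> ` N i = N (\<psi> i)" if "i \<le> k" for i
  proof (intro equalityI subsetI)
    fix j assume "j \<in> N (\<psi> i)"
    then have j: "j \<le> k" "path_chord (\<psi> i) j" by (auto simp: N_def)
    then have "j \<in> \<psi> ` {..k}" using bij by (simp add: bij_betw_def)
    then obtain j' where "j' \<le> k" "j = \<psi> j'" by auto
    then show "j \<in> \<psi> ` N i" using j pres[OF that] by (auto simp: N_def)
  qed (use that pres le in \<open>auto simp: N_def\<close>)
  moreover have "inj_on \<psi> (N i)" for i
    using inj by (auto simp: inj_on_def N_def)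
  ultimately have card: "card (N (\<psi> i)) = card (N i)" if "i \<le> k" for i
    using that by (metis card_image)
  have N0: "N 0 = {1}" and N1: "N 1 = {0, 2, 3}" and N2: "N 2 = {1, 3}" and N3: "N 3 = {1, 2, 4}"
    using k by (auto simp: N_def path_chord_def)
  have Nk: "N k = {k - 1}" using k by (auto simp: N_def path_chord_def)
  have Ni: "N i = {i - 1, Suc i}" if "4 \<le> i" "i < k" for i
    using that by (auto simp: N_def path_chord_def)
  have cN: "card (N i) = (if i = 0 \<or> i = k then 1 else if i = 1 \<or> i = 3 then 3 else 2)"
    if ik: "i \<le> k" for i
  proof -
    consider "i = 0" | "i = 1" | "i = 2" | "i = 3" | "i = k" | "4 \<le> i" "i < k"
      using ik by linarith
    then show ?thesis
      by cases (use k N0 N1 N2 N3 Nk Ni in auto)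
  qed
  have c: "(if \<psi> i = 0 \<or> \<psi> i = k then 1 else if \<psi> i = 1 \<or> \<psi> i = 3 then 3 else 2) =
      (if i = 0 \<or> i = k then 1 else if i = 1 \<or> i = 3 then 3 else (2::nat))" if "i \<le> k" for i
    using card[OF that] cN[OF that] cN[OF le[OF that]] by simp
  have p0: "\<psi> 0 = 0 \<or> \<psi> 0 = k" using c[of 0] by (auto split: if_splits)
  have p1: "\<psi> 1 = 1 \<or> \<psi> 1 = 3" using c[of 1] k by (auto split: if_splits)
  \<comment> \<open>Excludes \<open>\<psi> 0 = k\<close>: the only neighbour of \<open>k\<close> is
    \<open>k - 1\<close>, which is at least 4 and hence neither 1 nor 3.\<close>
  have p01: "path_chord (\<psi> 0) (\<psi> 1)" using pres[of 0 1] k by (simp add: path_chord_def)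
  have q0: "\<psi> 0 = 0" "\<psi> 1 = 1"
    using p0 p1 p01 k by (auto simp: path_chord_def)
  have p3: "\<psi> 3 = 1 \<or> \<psi> 3 = 3" using c[of 3] k by (auto split: if_splits)
  then have q3: "\<psi> 3 = 3" using q0 inj[of 3 1] k by auto
  have "path_chord (\<psi> 1) (\<psi> 2)" using pres[of 1 2] k by (simp add: path_chord_def)
  then have "\<psi> 2 = 2 \<or> \<psi> 2 = 0 \<or> \<psi> 2 = 3" using q0 by (auto simp: path_chord_def)
  then have q2: "\<psi> 2 = 2" using q0 q3 inj[of 2 0] inj[of 2 3] k by auto
  \<comment> \<open>Beyond 3, each vertex is the only neighbour of its predecessor that is not yet
    known to be fixed.\<close>
  show ?thesis using i
  proof (induction i rule: less_induct)
    case (less i)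
    show ?case
    proof (cases "i \<le> 3")
      case True
      then have "i = 0 \<or> i = 1 \<or> i = 2 \<or> i = 3" by linarith
      then show ?thesis using q0 q2 q3 by auto
    next
      case False
      then have i: "4 \<le> i" by simp
      have IH: "\<psi> j = j" if "j < i" for j using less that by simp
      have "path_chord (\<psi> (i - 1)) (\<psi> i)" using pres[of "i - 1" i] less i by (simp add: path_chord_def)
      then have "path_chord (i - 1) (\<psi> i)" using IH[of "i - 1"] i by simp
      then have "\<psi> i = i \<or> \<psi> i < i" using i by (auto simp: path_chord_def)
      moreover have "\<not> \<psi> i < i"
      proof
        assume l: "\<psi> i < i"
        then have "\<psi> (\<psi> i) = \<psi> i" by (rule IH)
        then show False using inj[of "\<psi> i" i] l less(2) by simp
      qed
      ultimately show ?thesis by simp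
    qed
  qed
qed

text \<open>Row \<open>i\<close> has \<open>i\<close> entries, but no column has \<open>k - 1\<close> entries, so that an automorphism of \<open>K\<^bsub>k,k\<^esub>\<close> cannot
  exchange the two sides.\<close>

definition staircase :: "nat \<Rightarrow> nat \<Rightarrow> bool" where
  "staircase i j \<longleftrightarrow> (if i \<le> 3 then (i, j) \<in> {(1, 0), (2, 1), (2, 2), (3, 0), (3, 1), (3, 3)} else j < i)"

lemma staircase_row:
  assumes "5 \<le> k" "i < k" shows "card {j. j < k \<and> staircase i j} = i"
proof -
  consider "i = 0" | "i = 1" | "i = 2" | "i = 3" | "4 \<le> i" by linarith
  then show ?thesis
  proof cases
    case 1
    then show ?thesis by (simp add: staircase_def)
  next
    case 2
    then have "{j. j < k \<and> staircase i j} = {0}" using assms by (auto simp: staircase_def)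
    then show ?thesis using 2 by simp
  next
    case 3
    then have "{j. j < k \<and> staircase i j} = {1, 2}" using assms by (auto simp: staircase_def)
    then show ?thesis using 3 by simp
  next
    case 4
    then have "{j. j < k \<and> staircase i j} = {0, 1, 3}" using assms by (auto simp: staircase_def)
    then show ?thesis using 4 by simp
  next
    case 5
    then have "{j. j < k \<and> staircase i j} = {..<i}" using assms by (auto simp: staircase_def)
    then show ?thesis by simp
  qed
qed

text \<open>Row 0 is empty, and every column is missed by row 1 or, in the case of column 0, by row
  2. In the plain staircase \<open>j < i\<close> column 0 would have \<open>k - 1\<close> entries;
  this is why rows 1 to 3 are modified.\<close>

lemma staircase_column:
  assumes "5 \<le> k" shows "card {i. i < k \<and> staircase i j} \<le> k - 2"
proof -
  define r :: nat where "r = (if j = 0 then 2 else 1)"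
  have "{i. i < k \<and> staircase i j} \<subseteq> {..<k} - {0, r}"
    by (auto simp: staircase_def r_def)
  then have "card {i. i < k \<and> staircase i j} \<le> card ({..<k} - {0, r})" by (intro card_mono) auto
  also have "\<dots> = k - 2"
    using assms by (subst card_Diff_subset) (auto simp: r_def)
  finally show ?thesis .
qed

text \<open>For \<open>p < q\<close> with \<open>q >= 4\<close>, row \<open>q\<close> contains
  \<open>p\<close> but not \<open>q\<close>. Columns 0 to 3 are separated by rows 1, 2, 3, where
  they show the patterns 101, 011, 010 and 001.\<close>

lemma staircase_columns_distinct:
  assumes k: "5 \<le> k" and j: "j < k" "j' < k" and eq: "\<And>i. i < k \<Longrightarrow> staircase i j \<longleftrightarrow> staircase i j'"
  shows "j = j'"
proof -
  have *: "\<not> p < q" if q: "q < k" and e: "\<And>i. i < k \<Longrightarrow> staircase i p \<longleftrightarrow> staircase i q" for p q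
  proof
    assume pq: "p < q"
    consider "4 \<le> q" | "q \<le> 3" by linarith
    then show False
    proof cases
      case 1
      then show False using e[OF q] pq by (simp add: staircase_def)
    next
      case 2
      then have "p = 0 \<and> q = 1 \<or> p = 0 \<and> q = 2 \<or> p = 0 \<and> q = 3 \<or> p = 1 \<and> q = 2 \<or> p = 1 \<and> q = 3 \<or> p = 2 \<and> q = 3"
        using pq by linarith
      moreover have "staircase 1 p \<longleftrightarrow> staircase 1 q" "staircase 2 p \<longleftrightarrow> staircase 2 q"
        "staircase 3 p \<longleftrightarrow> staircase 3 q"
        using k by (auto intro!: e)
      ultimately show False by (elim disjE) (simp_all add: staircase_def)
    qed
  qed
  show ?thesis using *[OF j(2) eq] *[OF j(1) eq[symmetric]] by simp
qed

context regular_graph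
begin

lemma Stab_edge_iff:
  assumes f: "\<phi> \<in> Stab H" and a: "act \<phi> R = R"
  shows "{\<phi> x, \<phi> y} \<in> R \<longleftrightarrow> {x, y} \<in> R"
proof -
  have inj: "inj ((`) \<phi>)" by (rule injI) (use Stab_inj[OF f] in \<open>simp add: inj_image_eq_iff\<close>)
  have "\<phi> ` {x, y} \<in> act \<phi> R \<longleftrightarrow> {x, y} \<in> R" by (rule inj_image_mem_iff[OF inj])
  then show ?thesis using a by simp
qed

lemma asymmetric_complete:
  assumes ne: "V \<noteq> {}" and compl: "\<And>v. v \<in> V \<Longrightarrow> clnb v = V"
  shows asymmetric_subset
proof -
  obtain v where v: "v \<in> V" using ne by blast
  have cV: "card V = Suc k" using card_clnb[OF v] compl[OF v] by simp
  have adj: "adj x y" if "x \<in> V" "y \<in> V" "x \<noteq> y" for x y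
    using compl[OF that(1)] that clnb_iff[of y x] by simp
  obtain f where "bij_betw f {0..<card V} V" using ex_bij_betw_nat_finite[OF finite_V] by blast
  then have f: "bij_betw f {..k} V" using cV by (simp add: atLeast0LessThan lessThan_Suc_atMost)
  have fV: "f i \<in> V" if "i \<le> k" for i using f that by (auto simp: bij_betw_def)
  have finj: "f i = f j \<longleftrightarrow> i = j" if "i \<le> k" "j \<le> k" for i j
    using f that by (auto simp: bij_betw_def inj_on_def)
  define R where "R = {{f i, f j} | i j. i \<le> k \<and> j \<le> k \<and> path_chord i j}"
  have sym: "path_chord i j \<longleftrightarrow> path_chord j i" for i j by (auto simp: path_chord_def)
  have R_iff: "{f i, f j} \<in> R \<longleftrightarrow> path_chord i j" if "i \<le> k" "j \<le> k" for i j
  proof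
    assume "{f i, f j} \<in> R"
    then obtain i' j' where "{f i, f j} = {f i', f j'}" "i' \<le> k" "j' \<le> k" "path_chord i' j'"
      by (auto simp: R_def)
    then show "path_chord i j" using finj that sym[of i j] by (auto simp: doubleton_eq_iff)
  qed (use that in \<open>auto simp: R_def\<close>)
  have "R \<subseteq> ED"
  proof
    fix e assume "e \<in> R"
    then obtain i j where "e = {f i, f j}" "i \<le> k" "j \<le> k" "path_chord i j" by (auto simp: R_def)
    moreover have "i \<noteq> j" using calculation by (auto simp: path_chord_def)
    ultimately show "e \<in> ED" using adj fV finj by simp
  qed
  moreover have "\<phi> = id" if p: "\<phi> \<in> Stab V" and a: "act \<phi> R = R" for \<phi>
  proof -
    define \<psi> where "\<psi> = inv_into {..k} f \<circ> \<phi> \<circ> f"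
    have bp: "bij_betw \<phi> V V" using Stab_permutes[OF p] by (rule permutes_imp_bij)
    have bij: "bij_betw \<psi> {..k} {..k}" unfolding \<psi>_def comp_assoc
      by (rule bij_betw_trans[OF bij_betw_trans[OF f bp] bij_betw_inv_into[OF f]])
    have fp: "f (\<psi> i) = \<phi> (f i)" if "i \<le> k" for i
    proof -
      have "\<phi> (f i) \<in> f ` {..k}" using Stab_in[OF p] fV[OF that] f by (simp add: bij_betw_def)
      then show ?thesis by (simp add: \<psi>_def f_inv_into_f)
    qed
    have le: "\<psi> i \<le> k" if "i \<le> k" for i using bij that by (auto simp: bij_betw_def)
    have "path_chord (\<psi> i) (\<psi> j) \<longleftrightarrow> path_chord i j" if "i \<le> k" "j \<le> k" for i j
      using R_iff[OF that] R_iff[OF le[OF that(1)] le[OF that(2)]] Stab_edge_iff[OF p a]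
      by (simp add: fp that)
    then have "\<psi> i = i" if "i \<le> k" for i using path_chord_rigid[OF k5 bij _ that] by blast
    then have "\<phi> (f i) = f i" if "i \<le> k" for i using fp that by metis
    then have "\<phi> x = x" if "x \<in> V" for x
    proof -
      have "x \<in> f ` {..k}" using f that by (simp add: bij_betw_def)
      then show ?thesis using \<open>\<And>i. i \<le> k \<Longrightarrow> \<phi> (f i) = f i\<close> by auto
    qed
    then show ?thesis using Stab_fix[OF p] by (intro ext) (metis id_apply)
  qed
  ultimately show ?thesis unfolding asymmetric_subset_def by blast
qed

text \<open>The vertex of row \<open>k - 1\<close> has more red edges than any column vertex, so the
  two sides are not exchanged. Then the rows are fixed by their numbers of red edges and the columns
  by their sets of red neighbours.\<close>

lemma asymmetric_complete_bipartite:
  assumes ab: "adj a b" "nb a \<inter> nb b = {}" "V = nb a \<union> nb b"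
    and A: "\<And>p. p \<in> nb a \<Longrightarrow> nb p = nb b" and B: "\<And>q. q \<in> nb b \<Longrightarrow> nb q = nb a"
  shows asymmetric_subset
proof -
  have abV: "a \<in> V" "b \<in> V" using adj_V[OF ab(1)] adj_V2[OF ab(1)] by auto
  obtain f where "bij_betw f {0..<card (nb a)} (nb a)" using ex_bij_betw_nat_finite[OF finite_nb] by blast
  then have f: "bij_betw f {..<k} (nb a)" using card_nb[OF abV(1)] by (simp add: atLeast0LessThan)
  obtain g where "bij_betw g {0..<card (nb b)} (nb b)" using ex_bij_betw_nat_finite[OF finite_nb] by blast
  then have g: "bij_betw g {..<k} (nb b)" using card_nb[OF abV(2)] by (simp add: atLeast0LessThan)
  have fA: "f i \<in> nb a" if "i < k" for i using bij_betwE[OF f] that by blast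
  have gB: "g i \<in> nb b" if "i < k" for i using bij_betwE[OF g] that by blast
  have Af: "\<exists>i<k. x = f i" if "x \<in> nb a" for x
  proof -
    have "x \<in> f ` {..<k}" using that f by (simp only: bij_betw_def)
    then show ?thesis by blast
  qed
  have Bg: "\<exists>i<k. x = g i" if "x \<in> nb b" for x
  proof -
    have "x \<in> g ` {..<k}" using that g by (simp only: bij_betw_def)
    then show ?thesis by blast
  qed
  have finj: "f i = f j \<longleftrightarrow> i = j" if "i < k" "j < k" for i j
    using inj_onD[OF bij_betw_imp_inj_on[OF f]] that by blast
  have ginj: "g i = g j \<longleftrightarrow> i = j" if "i < k" "j < k" for i j
    using inj_onD[OF bij_betw_imp_inj_on[OF g]] that by blast
  have fg: "f i \<noteq> g j" if "i < k" "j < k" for i j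
    using fA[OF that(1)] gB[OF that(2)] ab(2) by (metis disjoint_iff)
  define R where "R = {{f i, g j} | i j. i < k \<and> j < k \<and> staircase i j}"
  have R_iff: "{f i, g j} \<in> R \<longleftrightarrow> staircase i j" if "i < k" "j < k" for i j
  proof
    assume "{f i, g j} \<in> R"
    then obtain i' j' where "{f i, g j} = {f i', g j'}" "i' < k" "j' < k" "staircase i' j'"
      by (auto simp: R_def)
    then show "staircase i j" using finj ginj fg that by (metis doubleton_eq_iff)
  qed (use that in \<open>auto simp: R_def\<close>)
  have RE: "R \<subseteq> ED"
  proof
    fix e assume "e \<in> R"
    then obtain i j where e: "e = {f i, g j}" "i < k" "j < k" by (auto simp: R_def)
    have "g j \<in> nb (f i)" using A[OF fA[OF e(2)]] gB[OF e(3)] by (simp only:)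
    then show "e \<in> ED" using e by simp
  qed
  have row: "incidence R (f i) = i" if i: "i < k" for i
  proof -
    have "{e \<in> R. f i \<in> e} = (\<lambda>j. {f i, g j}) ` {j. j < k \<and> staircase i j}"
    proof (intro equalityI subsetI)
      fix e assume "e \<in> {e \<in> R. f i \<in> e}"
      then obtain i' j where e: "e = {f i', g j}" "i' < k" "j < k" "staircase i' j" "f i \<in> e"
        by (auto simp: R_def)
      then have "i' = i" using finj[OF i e(2)] fg[OF i e(3)] by auto
      then show "e \<in> (\<lambda>j. {f i, g j}) ` {j. j < k \<and> staircase i j}" using e by blast
    qed (use i in \<open>auto simp: R_def\<close>)
    moreover have "inj_on (\<lambda>j. {f i, g j}) {j. j < k \<and> staircase i j}"
      by (rule inj_onI) (use ginj in \<open>auto simp: doubleton_eq_iff\<close>)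
    ultimately show ?thesis
      by (simp only: incidence_def card_image staircase_row[OF k5 i])
  qed
  have col: "incidence R (g j) \<le> k - 2" if j: "j < k" for j
  proof -
    have "{e \<in> R. g j \<in> e} \<subseteq> (\<lambda>i. {f i, g j}) ` {i. i < k \<and> staircase i j}"
    proof
      fix e assume "e \<in> {e \<in> R. g j \<in> e}"
      then obtain i j' where e: "e = {f i, g j'}" "i < k" "j' < k" "staircase i j'" "g j \<in> e"
        by (auto simp: R_def)
      then have "j' = j" using ginj[OF j e(3)] fg[OF e(2) j] by auto
      then show "e \<in> (\<lambda>i. {f i, g j}) ` {i. i < k \<and> staircase i j}" using e by blast
    qed
    then have "incidence R (g j) \<le> card {i. i < k \<and> staircase i j}"
      unfolding incidence_def by (rule surj_card_le[rotated]) simp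
    then show ?thesis using staircase_column[OF k5, of j] by simp
  qed
  have "\<phi> = id" if p: "\<phi> \<in> Stab V" and a: "act \<phi> R = R" for \<phi>
  proof -
    let ?t = "f (k - 1)"
    have t: "?t \<in> nb a" using k5 by (intro fA) simp
    have it: "incidence R (\<phi> ?t) = k - 1" using incidence_Stab[OF p a] row[of "k - 1"] k5 by simp
    have "\<phi> ?t \<in> V" using Stab_in[OF p] t ab(3) by blast
    moreover have "\<phi> ?t \<notin> nb b"
    proof
      assume "\<phi> ?t \<in> nb b"
      then obtain j where "j < k" "\<phi> ?t = g j" using Bg by blast
      then show False using col[of j] it k5 by simp
    qed
    ultimately have pt: "\<phi> ?t \<in> nb a" using ab(3) by blast
    have pB: "\<phi> ` nb b = nb b" using Stab_nb[OF p, of ?t] A[OF t] A[OF pt] by (simp only:)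
    have pb: "b \<in> nb a" using ab(1) by simp
    have ff: "\<phi> (f i) = f i" if i: "i < k" for i
    proof -
      have "\<phi> (f i) \<in> V" using Stab_in[OF p] fA[OF i] ab(3) by blast
      moreover have "\<phi> (f i) \<notin> nb b"
      proof
        assume "\<phi> (f i) \<in> nb b"
        then have "\<phi> (f i) \<in> \<phi> ` nb b" using pB by (simp only:)
        then have "f i \<in> nb b" by (simp only: inj_image_mem_iff[OF Stab_inj[OF p]])
        then show False using fA[OF i] ab(2) by blast
      qed
      ultimately have "\<phi> (f i) \<in> nb a" using ab(3) by blast
      then obtain i' where i': "i' < k" "\<phi> (f i) = f i'" using Af by blast
      then have "i' = i" using incidence_Stab[OF p a, of "f i"] row[OF i] row[OF i'(1)] by simp
      then show ?thesis using i' by simp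
    qed
    have gg: "\<phi> (g j) = g j" if j: "j < k" for j
    proof -
      have "\<phi> (g j) \<in> \<phi> ` nb b" by (rule imageI) (rule gB[OF j])
      then have "\<phi> (g j) \<in> nb b" by (simp only: pB)
      then obtain j' where j': "j' < k" "\<phi> (g j) = g j'" using Bg by blast
      have "staircase i j \<longleftrightarrow> staircase i j'" if i: "i < k" for i
        using Stab_edge_iff[OF p a, of "f i" "g j"] R_iff[OF i j] R_iff[OF i j'(1)] ff[OF i] j'(2) by simp
      then have "j = j'" using staircase_columns_distinct[OF k5 j j'(1)] by blast
      then show ?thesis using j' by simp
    qed
    have "\<phi> x = x" for x
    proof (cases "x \<in> V")
      case True
      then show ?thesis using Af[of x] Bg[of x] ff gg ab(3) by blast
    next
      case False
      then show ?thesis by (rule Stab_fix[OF p])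
    qed
    then show ?thesis by (intro ext) simp
  qed
  then show ?thesis unfolding asymmetric_subset_def using RE by blast
qed

theorem asymmetric:
  assumes "conn V" shows asymmetric_subset
proof (rule ccontr)
  assume no: "\<not> asymmetric_subset"
  have ne: "V \<noteq> {}" using assms by (simp add: conn_def)
  have nc: "\<not> (\<forall>v\<in>V. clnb v = V)" using asymmetric_complete[OF ne] no by blast
  from assms no nc show False
    by (rule root_cases) (use no asymmetric_complete_bipartite in blast)
qed

end

section \<open>Transfer to pair graphs and the distinguishing index\<close>

lemma regular_pair_graph:
  assumes "5 \<le> k" "pair_graph G" "regular k G"
  shows "regular_graph (pverts G) (\<lambda>x y. (x, y) \<in> parcs G) k"
proof -
  interpret pair_graph G by fact
  show ?thesis
  proof
    show "finite (pverts G)" by (rule pair_finite_verts)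
    show "(y, x) \<in> parcs G" if "(x, y) \<in> parcs G" for x y
      using pair_sym_arcs that by (auto simp: symmetric_def dest: symD)
    show "(x, x) \<notin> parcs G" for x using pair_no_loops[of "(x, x)"] by auto
    show "x \<in> pverts G" if "(x, y) \<in> parcs G" for x y
      using in_arcsD1[of x y] that by simp
    show "card {y. (x, y) \<in> parcs G} = k" if "x \<in> pverts G" for x
    proof -
      have "out_arcs (with_proj G) x = Pair x ` {y. (x, y) \<in> parcs G}"
        by (auto simp: out_arcs_def)
      moreover have "inj_on (Pair x) {y. (x, y) \<in> parcs G}" by (rule inj_onI) simp
      ultimately have "out_degree (with_proj G) x = card {y. (x, y) \<in> parcs G}"
        by (simp only: out_degree_def card_image)
      then show ?thesis using assms(3) that by (simp add: regular_def)
    qed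
  qed fact
qed

theorem theorem3p2:
  fixes G :: "'a pair_pre_digraph" and k n :: nat
  assumes "k \<ge> 5"
    and "pair_graph G"
    and "Digraph_Component.connected G"
    and "regular k G"
    and "card (pverts G) = n"
  shows "distinguishing_index G \<le> 2"
proof -
  interpret pair_graph G by fact
  interpret R: regular_graph "pverts G" "\<lambda>x y. (x, y) \<in> parcs G" k
    using assms by (intro regular_pair_graph)
  have E: "edges G = R.ED" by (simp add: edges_def R.ED_def)
  have "R.conn (pverts G)"
  proof -
    have ne: "pverts G \<noteq> {}"
      using assms(3) by (auto simp: Digraph_Component.connected_def strongly_connected_def)
    \<comment> \<open>Connectedness is defined through the symmetric closure, which gives the same
      reachability because the arcs are symmetric.\<close>
    have re: "u \<rightarrow>\<^sup>*\<^bsub>with_proj G\<^esub> v" if "u \<in> pverts G" "v \<in> pverts G" for u v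
      using assms(3) that reachable_mk_symmetric_eq[OF pair_sym_arcs, of u v]
      by (auto simp: Digraph_Component.connected_def strongly_connected_def)
    have "R.reach (pverts G) u v" if "u \<rightarrow>\<^sup>*\<^bsub>with_proj G\<^esub> v" for u v
      using that
    proof (induction rule: reachable_induct)
      case (step x y)
      then have "(x, y) \<in> parcs G" by (simp add: arcs_ends_conv)
      then have "R.reach (pverts G) x y" by (intro R.reach_step) (auto intro: R.adj_V R.adj_V2)
      then show ?case using step R.reach_trans by blast
    qed simp
    then show ?thesis using ne re by (simp add: R.conn_def)
  qed
  from R.asymmetric[OF this] obtain A where
    A: "A \<subseteq> R.ED" "\<And>\<phi>. \<phi> \<in> R.Stab (pverts G) \<Longrightarrow> act \<phi> A = A \<Longrightarrow> \<phi> = id"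
    unfolding R.asymmetric_subset_def by blast
  define c where "c e = (if e \<in> A then 0 else 1 :: nat)" for e
  have "distinguishing_labeling G 2 c"
    unfolding distinguishing_labeling_def
  proof (intro conjI allI impI ballI)
    show "c ` edges G \<subseteq> {..<2}" by (auto simp: c_def)
  next
    fix \<phi> v assume f: "automorphism G \<phi> \<and> preserves_labeling G \<phi> c" and v: "v \<in> pverts G"
    \<comment> \<open>An automorphism may take arbitrary values off the vertex set; the identity
      there makes it a permutation in \<open>Stab\<close>.\<close>
    define \<psi> where "\<psi> = restrict_to (pverts G) \<phi>"
    have eq: "\<psi> x = \<phi> x" if "x \<in> pverts G" for x using that by (simp add: \<psi>_def restrict_to_def)
    have bij: "bij_betw \<phi> (pverts G) (pverts G)" using f by (simp add: automorphism_def)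
    have "bij_betw \<psi> (pverts G) (pverts G)"
      using bij by (rule bij_betw_cong[THEN iffD1, rotated]) (simp add: eq)
    then have perm: "\<psi> permutes pverts G"
      by (rule bij_imp_permutes) (simp add: \<psi>_def restrict_to_def)
    have adj: "(\<psi> x, \<psi> y) \<in> parcs G \<longleftrightarrow> (x, y) \<in> parcs G" for x y
    proof (cases "x \<in> pverts G \<and> y \<in> pverts G")
      case True
      then show ?thesis using f by (simp add: eq automorphism_def)
    next
      case False
      then show ?thesis
        using permutes_in_image[OF perm] R.adj_V[of x y] R.adj_V2[of x y]
          R.adj_V[of "\<psi> x" "\<psi> y"] R.adj_V2[of "\<psi> x" "\<psi> y"] by blast
    qed
    have S: "\<psi> \<in> R.Stab (pverts G)" using perm adj by (simp add: R.Stab_def)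
    \<comment> \<open>Inclusion suffices: \<psi> is injective and \<open>A\<close> is finite, so
      equality follows by counting.\<close>
    have sub: "act \<psi> A \<subseteq> A"
    proof
      fix e assume "e \<in> act \<psi> A"
      then obtain d where d: "d \<in> A" "e = \<psi> ` d" by blast
      then obtain x y where xy: "d = {x, y}" "(x, y) \<in> parcs G" using A(1) R.edgeE by blast
      then have "x \<in> pverts G" "y \<in> pverts G" using R.adj_V R.adj_V2 by blast+
      moreover have "c {\<phi> x, \<phi> y} = c {x, y}"
        using f xy(2) by (simp add: preserves_labeling_def E)
      ultimately have "c e = c d" using d xy by (simp add: eq)
      then show "e \<in> A" using d(1) by (simp add: c_def split: if_splits)
    qed
    have "finite A" using A(1) R.finite_ED by (rule finite_subset)
    moreover have "card (act \<psi> A) = card A"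
      by (rule card_image) (use R.Stab_inj[OF S] in \<open>meson inj_image_eq_iff inj_onI\<close>)
    ultimately have "act \<psi> A = A" using sub card_subset_eq by blast
    then have "\<psi> = id" by (rule A(2)[OF S])
    then show "\<phi> v = v" using eq[OF v] by simp
  qed
  then have "distinguishing_index G \<le> enat 2"
    unfolding distinguishing_index_def by (intro INF_lower) blast
  then show ?thesis by (simp add: numeral_eq_enat)
qed

end
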